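(* Let $K$ be the universal Knaster continuum and let $\mathrm{Homeo}(K)$ be its group of homeomorphisms with the uniform-convergence topology. Then $\mathrm{Homeo}(K)$ contains an open subgroup $U$ with a comeager conjugacy class; that is, there is an open subgroup $U \le \mathrm{Homeo}(K)$ and an element $u\in U$ such that $\{h^{-1}uh : h\in U\}$ is comeager in $U$.
   Context: $\mathbb{N}=\{0,1,2,\dots\}$. For an integer $d\ge 1$, the standard degree-$d$ tent map $T_d:[0,1]\to[0,1]$ is defined by $T_d(x)=dx-m$ if $x\in[\frac{m}{d},\frac{m+1}{d}]$ with $m$ even, and $T_d(x)=1+m-dx$ if $x\in[\frac{m}{d},\frac{m+1}{d}]$ with $m$ odd ($0\le m\le d-1$). Fix a sequence of primes $(p_n)_{n\ge 1}$ in which every prime number appears infinitely many times. The universal Knaster continuum is the inverse limit $K=\varprojlim(I_n,T_{p_n})$, where $I_n=[0,1]$ for each $n\in\mathbb{N}$ and $T_{p_n}:I_n\to I_{n-1}$ for $n\ge1$; i.e. $K=\{(x_n)_{n\in\mathbb{N}}\in[0,1]^{\mathbb{N}} : T_{p_n}(x_n)=x_{n-1}\ \forall n\ge 1\}$ with the product topology. $\mathrm{Homeo}(K)$ with the uniform-convergence topology is a Polish group. *)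

theory Defs
  imports
    "HOL-Analysis.Analysis"
    "HOL-Algebra.Bij"
    "HOL-Computational_Algebra.Primes"
begin

section \<open>Tent maps and Knaster continua\<close>

text \<open>
  The index \<open>m\<close> is computed as a floor.  At \<open>x = 1\<close> this gives \<open>m = d\<close> instead of \<open>m = d - 1\<close>,
  but the two formulas agree there; see \<open>tent_even\<close> and \<open>tent_odd\<close> below, which are
  the usual piecewise description on closed intervals.
\<close>

definition tent :: "nat \<Rightarrow> real \<Rightarrow> real" where
  "tent d x =
     (let m = \<lfloor>real d * x\<rfloor>
      in if even m then real d * x - of_int m else 1 + of_int m - real d * x)"

lemma tent_aux:
  assumes "d \<ge> 1" "x \<in> {real m / real d .. (real m + 1) / real d}"
  shows "\<lfloor>real d * x\<rfloor> = int m \<or> \<lfloor>real d * x\<rfloor> = int m + 1 \<and> real d * x = real m + 1"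
proof -
  have "real m \<le> real d * x" "real d * x \<le> real m + 1"
    using assms by (auto simp: field_simps)
  then show ?thesis
    by linarith
qed

lemma tent_even:
  assumes "d \<ge> 1" "even m" "x \<in> {real m / real d .. (real m + 1) / real d}"
  shows "tent d x = real d * x - real m"
  using tent_aux[OF assms(1,3)] assms(2) by (auto simp: tent_def Let_def mult.commute)

lemma tent_odd:
  assumes "d \<ge> 1" "odd m" "x \<in> {real m / real d .. (real m + 1) / real d}"
  shows "tent d x = 1 + real m - real d * x"
  using tent_aux[OF assms(1,3)] assms(2) by (auto simp: tent_def Let_def mult.commute)

text \<open>The value \<open>p 0\<close> plays no role.\<close>

definition knaster :: "(nat \<Rightarrow> nat) \<Rightarrow> (nat \<Rightarrow> real) set" where
  "knaster p = {x. (\<forall>n. x n \<in> {0..1}) \<and> (\<forall>n\<ge>1. tent (p n) (x n) = x (n - 1))}"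

text \<open>A closed form, used to see that tent maps are continuous.\<close>

lemma tent_eq_arccos: "tent d x = arccos (cos (pi * (real d * x))) / pi"
proof -
  define y where "y = real d * x"
  define m where "m = \<lfloor>y\<rfloor>"
  have m: "of_int m \<le> y" "y \<le> of_int m + 1"
    by (simp_all add: m_def)
  show ?thesis
  proof (cases "even m")
    case True
    then obtain k where k: "m = 2 * k" by (elim evenE)
    have "cos (pi * y) = cos (pi * (y - of_int m) + 2 * pi * of_int k)"
      by (simp add: k algebra_simps)
    also have "\<dots> = cos (pi * (y - of_int m))"
      by (simp only: cos_add cos_int_2pin sin_int_2pin mult_1_right mult_zero_right diff_zero)
    finally have "arccos (cos (pi * y)) = pi * (y - of_int m)"
      using m by (simp add: arccos_cos)
    then show ?thesis
      using True by (simp add: tent_def Let_def m_def y_def)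
  next
    case False
    then obtain k where k: "m = 2 * k + 1" by (elim oddE)
    have "cos (pi * y) = cos (2 * pi * of_int (k + 1) - pi * (1 + of_int m - y))"
      by (simp add: k algebra_simps)
    also have "\<dots> = cos (pi * (1 + of_int m - y))"
      by (simp only: cos_diff cos_int_2pin sin_int_2pin mult.assoc[symmetric])
    finally have "arccos (cos (pi * y)) = pi * (1 + of_int m - y)"
      using m by (simp add: arccos_cos)
    then show ?thesis
      using False by (simp add: tent_def Let_def m_def y_def)
  qed
qed

lemma continuous_on_tent: "continuous_on S (tent d)"
  unfolding tent_eq_arccos[abs_def]
  by (intro continuous_intros) auto

lemma compact_knaster: "compact (knaster p)"
proof -
  have cont: "continuous_on UNIV (\<lambda>x::nat \<Rightarrow> real. x n)" for n
    by (rule continuous_on_product_coordinates)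
  have "knaster p = PiE UNIV (\<lambda>_. {0..1}) \<inter> (\<Inter>n\<in>{1..}. {x. tent (p n) (x n) = x (n - 1)})"
    by (auto simp: knaster_def PiE_def Pi_def)
  moreover have "compact (PiE UNIV (\<lambda>_::nat. {0..1::real}))"
    using compactin_PiE[of "\<lambda>_::nat. euclidean :: real topology" UNIV "\<lambda>_. {0..1}"]
    by (simp add: euclidean_product_topology)
  moreover have "closed {x. tent (p n) (x n) = x (n - 1)}" for n
    by (intro closed_Collect_eq cont continuous_on_compose2[OF continuous_on_tent[of UNIV] cont]) auto
  ultimately show ?thesis
    by (auto intro!: compact_Int_closed closed_INT)
qed


section \<open>Homeomorphism groups\<close>

text \<open>
  As in \<^const>\<open>BijGroup\<close>, maps are extensional (\<^const>\<open>undefined\<close> outside \<open>S\<close>), so that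
  a homeomorphism of \<open>S\<close> is represented by exactly one function.
\<close>

definition homeos :: "'a::topological_space set \<Rightarrow> ('a \<Rightarrow> 'a) set" where
  "homeos S = {f \<in> extensional S. homeomorphic_map (top_of_set S) (top_of_set S) f}"

definition Homeo :: "'a::topological_space set \<Rightarrow> ('a \<Rightarrow> 'a) monoid" where
  "Homeo S = (BijGroup S)\<lparr>carrier := homeos S\<rparr>"

text \<open>
  The topology of uniform convergence, from the supremum metric on bounded continuous functions.
  For \<^typ>\<open>nat \<Rightarrow> real\<close> the metric is the one of \<^theory>\<open>HOL-Analysis.Function_Metric\<close>,
  which induces the product topology; on compact \<open>S\<close> the choice of metric is immaterial.
\<close>

definition homeo_topology :: "'a::metric_space set \<Rightarrow> ('a \<Rightarrow> 'a) topology" where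
  "homeo_topology S =
     subtopology (mtopology_of (cfunspace (top_of_set S) euclidean_metric)) (homeos S)"

lemma subgroup_homeos: "subgroup (homeos S) (BijGroup S)"
proof -
  interpret group "BijGroup S" by (rule group_BijGroup)
  have sub: "homeos S \<subseteq> Bij S"
    by (auto simp: homeos_def Bij_def bij_betw_def homeomorphic_eq_everything_map)
  show ?thesis
  proof
    show "homeos S \<subseteq> carrier (BijGroup S)"
      using sub by (simp add: BijGroup_def)
  next
    fix f g assume fg: "f \<in> homeos S" "g \<in> homeos S"
    have "homeomorphic_map (top_of_set S) (top_of_set S) (f \<circ> g)"
      using fg by (auto simp: homeos_def intro: homeomorphic_map_compose)
    then have "homeomorphic_map (top_of_set S) (top_of_set S) (compose S f g)"
      by (rule homeomorphic_map_eq) (simp add: compose_def)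
    then have "compose S f g \<in> homeos S"
      by (simp add: homeos_def compose_extensional)
    then show "f \<otimes>\<^bsub>BijGroup S\<^esub> g \<in> homeos S"
      using fg sub by (auto simp: BijGroup_def)
  next
    have "homeomorphic_map (top_of_set S) (top_of_set S) (\<lambda>x\<in>S. x)"
      by (rule homeomorphic_map_eq[where f = id]) auto
    then show "\<one>\<^bsub>BijGroup S\<^esub> \<in> homeos S"
      by (simp add: BijGroup_def homeos_def)
  next
    fix f assume f: "f \<in> homeos S"
    then obtain g where g: "homeomorphic_maps (top_of_set S) (top_of_set S) f g"
      by (auto simp: homeos_def homeomorphic_map_maps)
    have fB: "f \<in> Bij S" using f sub by auto
    have "homeomorphic_map (top_of_set S) (top_of_set S) g"
      using g homeomorphic_maps_sym homeomorphic_map_maps by blast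
    moreover have "g x = (\<lambda>x\<in>S. inv_into S f x) x" if "x \<in> S" for x
      using g fB that
      by (force simp: homeomorphic_maps_def continuous_map_def Bij_def bij_betw_def
          intro!: inv_into_f_eq[symmetric])
    ultimately have "homeomorphic_map (top_of_set S) (top_of_set S) (\<lambda>x\<in>S. inv_into S f x)"
      by (auto elim!: homeomorphic_map_eq)
    then show "inv\<^bsub>BijGroup S\<^esub> f \<in> homeos S"
      using fB by (simp add: inv_BijGroup homeos_def)
  qed
qed

lemma group_Homeo: "group (Homeo S)"
  unfolding Homeo_def
  by (intro group.subgroup_imp_group group_BijGroup subgroup_homeos)

lemma topspace_homeo_topology:
  assumes "compact S"
  shows "topspace (homeo_topology S) = carrier (Homeo S)"
proof -
  have "f \<in> mspace (cfunspace (top_of_set S) euclidean_metric)" if "f \<in> homeos S" for f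
  proof -
    have "continuous_map (top_of_set S) (top_of_set S) f"
      using that unfolding homeos_def by (blast dest: homeomorphic_imp_continuous_map)
    then have "continuous_map (top_of_set S) euclidean f"
      by (simp add: continuous_map_in_subtopology)
    moreover have "compactin (top_of_set S) (topspace (top_of_set S))"
      using assms by (simp add: compactin_subtopology)
    moreover have "f \<in> extensional (topspace (top_of_set S))"
      using that by (simp add: homeos_def)
    ultimately show ?thesis
      unfolding compactin_mspace_cfunspace[OF \<open>compactin (top_of_set S) (topspace (top_of_set S))\<close>]
      by (simp del: continuous_map_iff_continuous topspace_subtopology)
  qed
  then show ?thesis
    by (auto simp: homeo_topology_def Homeo_def)
qed


section \<open>Baire category\<close>

definition nowhere_dense_in :: "'a topology \<Rightarrow> 'a set \<Rightarrow> bool" where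
  "nowhere_dense_in X N \<longleftrightarrow> N \<subseteq> topspace X \<and> X interior_of (X closure_of N) = {}"

definition meager_in :: "'a topology \<Rightarrow> 'a set \<Rightarrow> bool" where
  "meager_in X M \<longleftrightarrow>
     (\<exists>\<N>. countable \<N> \<and> (\<forall>N\<in>\<N>. nowhere_dense_in X N) \<and> M = \<Union>\<N>)"

definition comeager_in :: "'a topology \<Rightarrow> 'a set \<Rightarrow> bool" where
  "comeager_in X C \<longleftrightarrow> C \<subseteq> topspace X \<and> meager_in X (topspace X - C)"

end

theory Submission
  imports Defs
begin

text \<open>
  Because \<open>2\<close> occurs infinitely often in \<open>p\<close>, the point \<open>0\<close> is the only end point of \<open>K\<close>.  Every homeomorphism of \<open>K\<close> fixes it
  and hence acts on its arc component, a dense ray parametrised by \<open>[0,\<infinity>)\<close>.  In this parameter the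
  homeomorphisms close to the identity are uniform limits of odd increasing homeomorphisms of the line that commute
  with translation by \<open>2p\<^sub>1\<cdots>p\<^sub>n\<close> for some \<open>n\<close>; the closure of the group of all such maps is the open subgroup.

  A comeager conjugacy class then follows from the local form of Rosendal's criterion: every open set contains an open \<open>W\<close> such that
  any two nonempty open subsets of \<open>W\<close> are nearly conjugate by arbitrarily small elements; a back and forth argument
  makes any two generic elements conjugate.  For the line maps, \<open>W\<close> is a ball about a piecewise affine map \<open>F\<close>.
  Short intervals where \<open>F - id\<close> changes sign contain all fixed points of the maps near \<open>F\<close>; there two maps \<open>g\<^sub>1\<close>, \<open>g\<^sub>2\<close>
  become conjugate after a tiny copy of \<open>g\<^sub>2\<close> is inserted next to \<open>g\<^sub>1\<close>, and a tiny copy of \<open>g\<^sub>1\<close> next to \<open>g\<^sub>2\<close>.  In between, the conjugacy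
  follows orbits, and only boundedly many iterates matter.
\<close>

section \<open>Comeager conjugacy classes in metric groups\<close>

text \<open>The tent map of degree d is multiplication by d followed by \<open>fold1\<close>, the
  quotient of the line by u -> -u and u -> u + 2. An odd map that commutes with translation by 2A
  descends to this quotient at scale A, and at every multiple of A as well. This is why a line map
  of one level acts on all deeper coordinates of K, and why two level maps can be compared at a
  common level. The obstacle is uniformity. The maps near a given F live at arbitrarily deep levels,
  so the radius about F must be fixed before their period DA is known. It can be, because every
  bound comes from F alone: F fixes all multiples of A, so a stretch on which F - id keeps its sign
  is at most A long and is crossed in a number of iterates that does not depend on D. A second point
  is that the sup metric is invariant under right translations only, and that limits of
  homeomorphisms are homeomorphisms only if the inverses converge too. The back and forth therefore
  controls conjugators together with their inverses.\<close>

lemma comeagerI: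
  assumes "countable I" "\<And>i. i \<in> I \<Longrightarrow> openin X (W i)" "\<And>i. i \<in> I \<Longrightarrow> X closure_of (W i) = topspace X"
    and "C \<subseteq> topspace X" "\<And>x. x \<in> topspace X \<Longrightarrow> (\<And>i. i \<in> I \<Longrightarrow> x \<in> W i) \<Longrightarrow> x \<in> C"
  shows "comeager_in X C"
proof -
  \<comment> \<open>The nowhere dense pieces are cut down to the complement of C, since
    \<open>meager_in\<close> asks for equality with the union.\<close>
  let ?N = "(\<lambda>i. (topspace X - C) \<inter> (topspace X - W i)) ` I"
  have "nowhere_dense_in X ((topspace X - C) \<inter> (topspace X - W i))" if "i \<in> I" for i
  proof -
    have "X closure_of ((topspace X - C) \<inter> (topspace X - W i)) \<subseteq> topspace X - W i"
      by (intro closure_of_minimal closedin_diff closedin_topspace assms(2) that) auto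
    then have "X interior_of (X closure_of ((topspace X - C) \<inter> (topspace X - W i))) \<subseteq> X interior_of (topspace X - W i)"
      by (rule interior_of_mono)
    also have "\<dots> = {}" using assms(3)[OF that] by (simp add: interior_of_complement)
    finally show ?thesis by (auto simp: nowhere_dense_in_def)
  qed
  moreover have "topspace X - C = \<Union> ?N" using assms(5) by auto
  ultimately have "meager_in X (topspace X - C)" unfolding meager_in_def
    using assms(1) by (intro exI[of _ ?N]) auto
  then show ?thesis using assms(4) by (simp add: comeager_in_def)
qed

text \<open>What the sup metric provides on a closed group of homeomorphisms of a compact space.
  Right invariance and continuity of left translations at the unit already give joint continuity of
  product and inverse; completeness is asked for sequences whose inverses are fast Cauchy as
  well.\<close>

locale metric_group = group G + Metric_space "carrier G" d for G (structure) and d +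
  assumes right_inv: "\<And>f g h. f \<in> carrier G \<Longrightarrow> g \<in> carrier G \<Longrightarrow> h \<in> carrier G \<Longrightarrow> d (f \<otimes> h) (g \<otimes> h) = d f g"
    and left_cont: "\<And>g e. g \<in> carrier G \<Longrightarrow> e > 0 \<Longrightarrow> \<exists>\<delta>>0. \<forall>h\<in>carrier G. d h \<one> < \<delta> \<longrightarrow> d (g \<otimes> h) g < e"
    and separable: "\<exists>Q\<subseteq>carrier G. countable Q \<and> (\<forall>x\<in>carrier G. \<forall>e>0. \<exists>q\<in>Q. d x q < e)"
    and complete: "\<And>s. (\<And>k::nat. s k \<in> carrier G) \<Longrightarrow> (\<And>k. d (s k) (s (Suc k)) < (1/2) ^ k) \<Longrightarrow>
      (\<And>k. d (inv (s k)) (inv (s (Suc k))) < (1/2) ^ k) \<Longrightarrow> \<exists>l\<in>carrier G. \<forall>e>0. \<exists>N. \<forall>k\<ge>N. d (s k) l < e"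
begin

definition cj :: "'a \<Rightarrow> 'a \<Rightarrow> 'a" where "cj h x = h \<otimes> x \<otimes> inv h"

lemma cj_closed [simp]: "h \<in> carrier G \<Longrightarrow> x \<in> carrier G \<Longrightarrow> cj h x \<in> carrier G"
  by (simp add: cj_def)

lemma cj_cj: "g \<in> carrier G \<Longrightarrow> h \<in> carrier G \<Longrightarrow> x \<in> carrier G \<Longrightarrow> cj g (cj h x) = cj (g \<otimes> h) x"
  by (simp add: cj_def m_assoc inv_mult_group)

lemma cj_one: "x \<in> carrier G \<Longrightarrow> cj \<one> x = x"
  by (simp add: cj_def)

lemma cj_eqI:
  assumes "h \<in> carrier G" "x \<in> carrier G" "y \<in> carrier G" "h \<otimes> x = y \<otimes> h"
  shows "cj h x = y"
  using assms by (simp add: cj_def m_assoc)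

text \<open>Right invariance turns closeness of x and y into closeness of
  \<open>x \<otimes> inv y\<close> to the unit, where \<open>left_cont\<close> applies.\<close>

lemma left_mult_cont:
  assumes "g \<in> carrier G" "e > 0"
  shows "\<exists>\<delta>>0. \<forall>x\<in>carrier G. \<forall>y\<in>carrier G. d x y < \<delta> \<longrightarrow> d (g \<otimes> x) (g \<otimes> y) < e"
proof -
  obtain \<delta> where \<delta>: "\<delta> > 0" "\<And>h. h \<in> carrier G \<Longrightarrow> d h \<one> < \<delta> \<Longrightarrow> d (g \<otimes> h) g < e"
    using left_cont[OF assms] by blast
  have "d (g \<otimes> x) (g \<otimes> y) < e" if "x \<in> carrier G" "y \<in> carrier G" "d x y < \<delta>" for x y
  proof -
    have "d (x \<otimes> inv y) \<one> = d x y" using right_inv[of x y "inv y"] that by simp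
    then have "d (g \<otimes> (x \<otimes> inv y)) g < e" using \<delta>(2) that by simp
    moreover have "d (g \<otimes> (x \<otimes> inv y) \<otimes> y) (g \<otimes> y) = d (g \<otimes> (x \<otimes> inv y)) g"
      using that assms by (intro right_inv) auto
    moreover have "g \<otimes> (x \<otimes> inv y) \<otimes> y = g \<otimes> x" using that assms by (simp add: m_assoc)
    ultimately show ?thesis by simp
  qed
  then show ?thesis using \<delta>(1) by blast
qed

lemma mult_cont:
  assumes "x \<in> carrier G" "y \<in> carrier G" "e > 0"
  shows "\<exists>\<delta>>0. \<forall>x'\<in>carrier G. \<forall>y'\<in>carrier G. d x' x < \<delta> \<longrightarrow> d y' y < \<delta> \<longrightarrow> d (x' \<otimes> y') (x \<otimes> y) < e"
proof -
  obtain \<delta> where \<delta>: "\<delta> > 0" "\<And>u v. u \<in> carrier G \<Longrightarrow> v \<in> carrier G \<Longrightarrow> d u v < \<delta> \<Longrightarrow> d (x \<otimes> u) (x \<otimes> v) < e/2"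
    using left_mult_cont[of x "e/2"] assms by auto
  have "d (x' \<otimes> y') (x \<otimes> y) < e" if h: "x' \<in> carrier G" "y' \<in> carrier G" "d x' x < min \<delta> (e/2)" "d y' y < min \<delta> (e/2)" for x' y'
  proof -
    have "d (x' \<otimes> y') (x \<otimes> y) \<le> d (x' \<otimes> y') (x \<otimes> y') + d (x \<otimes> y') (x \<otimes> y)"
      using h assms by (intro triangle) auto
    moreover have "d (x' \<otimes> y') (x \<otimes> y') = d x' x" using h assms by (intro right_inv) auto
    moreover have "d (x \<otimes> y') (x \<otimes> y) < e/2" using h assms by (intro \<delta>(2)) auto
    ultimately show ?thesis using h by simp
  qed
  then show ?thesis using \<delta>(1) assms(3) by (intro exI[of _ "min \<delta> (e/2)"]) auto
qed

lemma inv_cont: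
  assumes "x \<in> carrier G" "e > 0"
  shows "\<exists>\<delta>>0. \<forall>x'\<in>carrier G. d x' x < \<delta> \<longrightarrow> d (inv x') (inv x) < e"
proof -
  obtain \<delta> where \<delta>: "\<delta> > 0" "\<And>h. h \<in> carrier G \<Longrightarrow> d h \<one> < \<delta> \<Longrightarrow> d (inv x \<otimes> h) (inv x) < e"
    using left_cont[of "inv x" e] assms by auto
  have "d (inv x') (inv x) < e" if h: "x' \<in> carrier G" "d x' x < \<delta>" for x'
  proof -
    have "d (x \<otimes> inv x') \<one> = d x x'" using right_inv[of x x' "inv x'"] h assms by simp
    then have "d (inv x \<otimes> (x \<otimes> inv x')) (inv x) < e" using \<delta>(2)[of "x \<otimes> inv x'"] h assms by (simp add: commute)
    then show ?thesis using h assms by (simp add: m_assoc[symmetric])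
  qed
  then show ?thesis using \<delta>(1) by blast
qed

lemma cj_cont:
  assumes "h \<in> carrier G" "x \<in> carrier G" "e > 0"
  shows "\<exists>\<delta>>0. \<forall>h'\<in>carrier G. \<forall>x'\<in>carrier G. d h' h < \<delta> \<longrightarrow> d x' x < \<delta> \<longrightarrow> d (cj h' x') (cj h x) < e"
proof -
  obtain \<delta>1 where 1: "\<delta>1 > 0" "\<And>u v. u \<in> carrier G \<Longrightarrow> v \<in> carrier G \<Longrightarrow> d u (h \<otimes> x) < \<delta>1 \<Longrightarrow> d v (inv h) < \<delta>1 \<Longrightarrow> d (u \<otimes> v) (h \<otimes> x \<otimes> inv h) < e"
    using mult_cont[of "h \<otimes> x" "inv h" e] assms by auto
  obtain \<delta>2 where 2: "\<delta>2 > 0" "\<And>u v. u \<in> carrier G \<Longrightarrow> v \<in> carrier G \<Longrightarrow> d u h < \<delta>2 \<Longrightarrow> d v x < \<delta>2 \<Longrightarrow> d (u \<otimes> v) (h \<otimes> x) < \<delta>1"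
    using mult_cont[of h x \<delta>1] assms 1 by auto
  obtain \<delta>3 where 3: "\<delta>3 > 0" "\<And>u. u \<in> carrier G \<Longrightarrow> d u h < \<delta>3 \<Longrightarrow> d (inv u) (inv h) < \<delta>1"
    using inv_cont[of h \<delta>1] assms 1 by auto
  show ?thesis
    using 1 2 3 by (intro exI[of _ "min \<delta>2 \<delta>3"]) (auto simp: cj_def)
qed

text \<open>Local density of conjugation orbits: conjugates of x by small elements need not fill a
  neighbourhood of x; being dense in one is enough for the back and forth of
  \<open>loc_conjugate\<close>.\<close>

definition loc :: "'a \<Rightarrow> bool" where
  "loc x \<longleftrightarrow> (\<forall>\<epsilon>>0. \<exists>r>0. \<forall>y\<in>carrier G. d x y < r \<longrightarrow> (\<forall>\<eta>>0. \<exists>h\<in>carrier G. d h \<one> < \<epsilon> \<and> d (cj h x) y < \<eta>))"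

lemma locD:
  assumes "loc x" "\<epsilon> > 0"
  shows "\<exists>r>0. \<forall>y\<in>carrier G. d x y < r \<longrightarrow> (\<forall>\<eta>>0. \<exists>h\<in>carrier G. d h \<one> < \<epsilon> \<and> d (cj h x) y < \<eta>)"
  using assms by (simp add: loc_def)

text \<open>Conjugation by g is a homeomorphism that keeps small elements small, so all data can be
  pulled back by the inverse of g. In \<open>reach_step\<close> this gives local density at the
  current conjugate of y instead of y.\<close>

lemma loc_cj:
  assumes x: "x \<in> carrier G" and g: "g \<in> carrier G" and l: "loc x"
  shows "loc (cj g x)"
  unfolding loc_def
proof (intro allI impI)
  fix \<epsilon> :: real assume "\<epsilon> > 0"
  have gi: "inv g \<in> carrier G" "cj g \<one> = \<one>" "cj (inv g) (cj g x) = x" using g x by (auto simp: cj_cj cj_one) (auto simp: cj_def)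
  obtain \<epsilon>' where e: "\<epsilon>' > 0" "\<And>h. h \<in> carrier G \<Longrightarrow> d h \<one> < \<epsilon>' \<Longrightarrow> d (cj g h) \<one> < \<epsilon>"
    using cj_cont[of g \<one> \<epsilon>] \<open>\<epsilon> > 0\<close> g gi by force
  obtain r where r: "r > 0" "\<forall>y\<in>carrier G. d x y < r \<longrightarrow> (\<forall>\<eta>>0. \<exists>h\<in>carrier G. d h \<one> < \<epsilon>' \<and> d (cj h x) y < \<eta>)"
    using locD[OF l e(1)] by (elim exE conjE)
  obtain r' where r': "r' > 0" "\<And>y. y \<in> carrier G \<Longrightarrow> d y (cj g x) < r' \<Longrightarrow> d (cj (inv g) y) x < r"
    using cj_cont[of "inv g" "cj g x" r] r(1) g x gi by force
  have "\<exists>h\<in>carrier G. d h \<one> < \<epsilon> \<and> d (cj h (cj g x)) y < \<eta>" if y: "y \<in> carrier G" "d (cj g x) y < r'" and \<eta>: "\<eta> > 0" for y \<eta>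
  proof -
    let ?z = "cj (inv g) y"
    have gz: "cj g ?z = y" using g y by (simp add: cj_cj cj_one)
    obtain \<eta>' where e': "\<eta>' > 0" "\<And>u. u \<in> carrier G \<Longrightarrow> d u ?z < \<eta>' \<Longrightarrow> d (cj g u) y < \<eta>"
      using cj_cont[of g ?z \<eta>] \<eta> g y gz by force
    obtain h where h: "h \<in> carrier G" "d h \<one> < \<epsilon>'" "d (cj h x) ?z < \<eta>'"
      using r(2)[rule_format, of ?z \<eta>'] r'(2)[of y] y e' g by (auto simp: commute)
    have "cj (cj g h) (cj g x) = cj g (cj h x)"
      using g x h by (simp add: cj_cj) (simp add: cj_def m_assoc)
    then show ?thesis using e(2)[OF h(1,2)] e'(2)[of "cj h x"] h g x by (intro bexI[of _ "cj g h"]) auto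
  qed
  then show "\<exists>r>0. \<forall>y\<in>carrier G. d (cj g x) y < r \<longrightarrow> (\<forall>\<eta>>0. \<exists>h\<in>carrier G. d h \<one> < \<epsilon> \<and> d (cj h (cj g x)) y < \<eta>)"
    using r'(1) by blast
qed

text \<open>Invariant of the back and forth: the conjugator b of y is frozen, while the conjugator
  of x may still move by 2^-k. The bounds on inverses are carried along because
  \<open>complete\<close> needs them.\<close>

definition reach :: "nat \<Rightarrow> 'a \<Rightarrow> 'a \<Rightarrow> 'a \<Rightarrow> 'a \<Rightarrow> bool" where
  "reach k x y a b \<longleftrightarrow> (\<forall>\<eta>>0. \<exists>a'\<in>carrier G. d a a' < (1/2) ^ k \<and> d (inv a) (inv a') < (1/2) ^ k \<and> d (cj a' x) (cj b y) < \<eta>)"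

lemma small_translate:
  assumes "b \<in> carrier G" "e > 0"
  shows "\<exists>\<epsilon>>0. \<forall>u\<in>carrier G. d u \<one> < \<epsilon> \<longrightarrow> d b (u \<otimes> b) < e \<and> d (inv b) (inv (u \<otimes> b)) < e"
proof -
  obtain \<delta> where \<delta>: "\<delta> > 0" "\<And>x'. x' \<in> carrier G \<Longrightarrow> d x' b < \<delta> \<Longrightarrow> d (inv x') (inv b) < e"
    using inv_cont[OF assms] by blast
  have "d b (u \<otimes> b) < e \<and> d (inv b) (inv (u \<otimes> b)) < e" if "u \<in> carrier G" "d u \<one> < min \<delta> e" for u
  proof -
    have "d (u \<otimes> b) b = d u \<one>" using right_inv[of u \<one> b] that assms by simp
    then show ?thesis using \<delta>(2)[of "u \<otimes> b"] that assms by (simp add: commute)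
  qed
  then show ?thesis using \<delta>(1) assms(2) by (intro exI[of _ "min \<delta> e"]) auto
qed

text \<open>Local density at \<open>cj b y\<close> supplies a radius before a' is chosen; a' brings
  x inside this radius. Then small conjugates of \<open>cj b y\<close> approach
  \<open>cj a' x\<close>, so at the next stage y can chase x with half the tolerance.\<close>

lemma reach_step:
  assumes c: "x \<in> carrier G" "y \<in> carrier G" "a \<in> carrier G" "b \<in> carrier G"
    and l: "loc y" and s: "reach k x y a b" and e: "e > 0"
  shows "\<exists>a'\<in>carrier G. d a a' < (1/2) ^ k \<and> d (inv a) (inv a') < (1/2) ^ k \<and> d (cj a' x) (cj b y) < e \<and> reach (Suc k) y x b a'"
proof -
  obtain \<epsilon> where \<epsilon>: "\<epsilon> > 0" "\<And>u. u \<in> carrier G \<Longrightarrow> d u \<one> < \<epsilon> \<Longrightarrow> d b (u \<otimes> b) < (1/2) ^ Suc k \<and> d (inv b) (inv (u \<otimes> b)) < (1/2) ^ Suc k"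
    using small_translate[OF c(4), of "(1/2) ^ Suc k"] by (metis half_gt_zero_iff zero_less_power zero_less_one)
  obtain r where r: "r > 0" "\<forall>z\<in>carrier G. d (cj b y) z < r \<longrightarrow> (\<forall>\<eta>>0. \<exists>h\<in>carrier G. d h \<one> < \<epsilon> \<and> d (cj h (cj b y)) z < \<eta>)"
    using locD[OF loc_cj[OF c(2,4) l] \<epsilon>(1)] by (elim exE conjE)
  obtain a' where a': "a' \<in> carrier G" "d a a' < (1/2) ^ k" "d (inv a) (inv a') < (1/2) ^ k" "d (cj a' x) (cj b y) < min r e"
    using s r(1) e unfolding reach_def by (metis min_less_iff_conj)
  have "reach (Suc k) y x b a'"
    unfolding reach_def
  proof (intro allI impI)
    fix \<eta> :: real assume "\<eta> > 0"
    have "d (cj b y) (cj a' x) < r" using a' by (simp add: commute)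
    then obtain u where u: "u \<in> carrier G" "d u \<one> < \<epsilon>" "d (cj u (cj b y)) (cj a' x) < \<eta>"
      using r(2)[rule_format, of "cj a' x" \<eta>] a' c \<open>\<eta> > 0\<close> by auto
    then show "\<exists>b'\<in>carrier G. d b b' < (1/2) ^ Suc k \<and> d (inv b) (inv b') < (1/2) ^ Suc k \<and> d (cj b' y) (cj a' x) < \<eta>"
      using \<epsilon>(2)[of u] c by (intro bexI[of _ "u \<otimes> b"]) (auto simp: cj_cj)
  qed
  then show ?thesis using a' by auto
qed

lemma half_power_2: "(1/2::real) ^ (2 * k) \<le> (1/2) ^ k" "(1/2::real) ^ Suc (2 * k) \<le> (1/2) ^ k"
  by (rule power_decreasing; simp)+

text \<open>The conjugators of x and of y both converge while the conjugated elements approach each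
  other; in the limit x and y are conjugated to the same element.\<close>

lemma loc_conjugate:
  assumes x: "x \<in> carrier G" "loc x" and y: "y \<in> carrier G" "loc y"
    and dense: "\<And>z e. z \<in> carrier G \<Longrightarrow> e > 0 \<Longrightarrow> \<exists>h\<in>carrier G. d (cj h y) z < e"
  shows "\<exists>g\<in>carrier G. y = cj g x"
proof -
  obtain \<epsilon> where \<epsilon>: "\<epsilon> > 0" "\<And>u. u \<in> carrier G \<Longrightarrow> d u \<one> < \<epsilon> \<Longrightarrow> d \<one> u < 1 \<and> d \<one> (inv u) < 1"
  proof -
    obtain e where "e > 0" "\<forall>u\<in>carrier G. d u \<one> < e \<longrightarrow> d \<one> (u \<otimes> \<one>) < 1 \<and> d (inv \<one>) (inv (u \<otimes> \<one>)) < 1"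
      using small_translate[of \<one> 1] by auto
    then show ?thesis using that[of e] by auto
  qed
  obtain r where r: "r > 0" "\<forall>z\<in>carrier G. d x z < r \<longrightarrow> (\<forall>\<eta>>0. \<exists>h\<in>carrier G. d h \<one> < \<epsilon> \<and> d (cj h x) z < \<eta>)"
    using locD[OF x(2) \<epsilon>(1)] by (elim exE conjE)
  \<comment> \<open>Density of the class of y gives a first conjugate inside the ball in which small
    conjugates of x are dense.\<close>
  obtain b0 where b0: "b0 \<in> carrier G" "d (cj b0 y) x < r" using dense[OF x(1) r(1)] by blast
  have init: "reach 0 x y \<one> b0"
    unfolding reach_def
  proof (intro allI impI)
    fix \<eta> :: real assume "\<eta> > 0"
    then obtain h where "h \<in> carrier G" "d h \<one> < \<epsilon>" "d (cj h x) (cj b0 y) < \<eta>"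
      using r(2)[rule_format, of "cj b0 y" \<eta>] b0 y by (auto simp: commute)
    then show "\<exists>a'\<in>carrier G. d \<one> a' < (1/2) ^ 0 \<and> d (inv \<one>) (inv a') < (1/2) ^ 0 \<and> d (cj a' x) (cj b0 y) < \<eta>"
      using \<epsilon>(2)[of h] by auto
  qed
  \<comment> \<open>One round consists of two uses of \<open>reach_step\<close>, at stages 2n and 2n
    + 1, with the roles of x and y exchanged in between; both tolerances are at most 2^-n.\<close>
  let ?P = "\<lambda>n p. fst p \<in> carrier G \<and> snd p \<in> carrier G \<and> reach (2 * n) x y (fst p) (snd p)"
  let ?Q = "\<lambda>n p q. d (fst p) (fst q) < (1/2) ^ n \<and> d (inv (fst p)) (inv (fst q)) < (1/2) ^ n \<and>
    d (snd p) (snd q) < (1/2) ^ n \<and> d (inv (snd p)) (inv (snd q)) < (1/2) ^ n \<and> d (cj (fst q) x) (cj (snd q) y) < (1/2) ^ n"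
  have "\<exists>f. \<forall>n. ?P n (f n) \<and> ?Q n (f n) (f (Suc n))"
  proof (rule dependent_nat_choice)
    show "\<exists>p. ?P 0 p" using init b0 by (intro exI[of _ "(\<one>, b0)"]) auto
  next
    fix p n assume p: "?P n p"
    define a b where "a = fst p" and "b = snd p"
    have ab: "a \<in> carrier G" "b \<in> carrier G" "reach (2 * n) x y a b" using p by (auto simp: a_def b_def)
    have pos: "(1/2::real) ^ n > 0" by simp
    obtain a' where a': "a' \<in> carrier G" "d a a' < (1/2) ^ (2*n)" "d (inv a) (inv a') < (1/2) ^ (2*n)" "reach (Suc (2*n)) y x b a'"
      using reach_step[OF x(1) y(1) ab(1,2) y(2) ab(3) pos] by blast
    obtain b' where b': "b' \<in> carrier G" "d b b' < (1/2) ^ Suc (2*n)" "d (inv b) (inv b') < (1/2) ^ Suc (2*n)"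
      "d (cj b' y) (cj a' x) < (1/2) ^ n" "reach (Suc (Suc (2*n))) x y a' b'"
      using reach_step[OF y(1) x(1) ab(2) a'(1) x(2) a'(4) pos] by blast
    have "?P (Suc n) (a', b')" using a' b' by simp
    moreover have "?Q n p (a', b')"
      using less_le_trans[OF a'(2) half_power_2(1)] less_le_trans[OF a'(3) half_power_2(1)]
        less_le_trans[OF b'(2) half_power_2(2)] less_le_trans[OF b'(3) half_power_2(2)] b'(4) commute[of "cj b' y" "cj a' x"]
      by (simp add: a_def[symmetric] b_def[symmetric])
    ultimately show "\<exists>q. ?P (Suc n) q \<and> ?Q n p q" by blast
  qed
  then obtain f where f: "\<And>n. ?P n (f n)" "\<And>n. ?Q n (f n) (f (Suc n))" by blast
  obtain a where a: "a \<in> carrier G" "\<And>e. e > 0 \<Longrightarrow> \<exists>N. \<forall>k\<ge>N. d (fst (f k)) a < e"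
    using complete[of "\<lambda>k. fst (f k)"] f by blast
  obtain b where b: "b \<in> carrier G" "\<And>e. e > 0 \<Longrightarrow> \<exists>N. \<forall>k\<ge>N. d (snd (f k)) b < e"
    using complete[of "\<lambda>k. snd (f k)"] f by blast
  have "d (cj a x) (cj b y) \<le> 0"
  proof (rule field_le_epsilon)
    fix e :: real assume e: "e > 0"
    obtain \<delta>1 where d1: "\<delta>1 > 0" "\<And>h. h \<in> carrier G \<Longrightarrow> d h a < \<delta>1 \<Longrightarrow> d (cj h x) (cj a x) < e/3"
      using cj_cont[of a x "e/3"] a(1) x(1) e by (metis divide_pos_pos zero_less_numeral mdist_zero)
    obtain \<delta>2 where d2: "\<delta>2 > 0" "\<And>h. h \<in> carrier G \<Longrightarrow> d h b < \<delta>2 \<Longrightarrow> d (cj h y) (cj b y) < e/3"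
      using cj_cont[of b y "e/3"] b(1) y(1) e by (metis divide_pos_pos zero_less_numeral mdist_zero)
    obtain N1 where N1: "\<forall>k\<ge>N1. d (fst (f k)) a < \<delta>1" using a(2)[OF d1(1)] by blast
    obtain N2 where N2: "\<forall>k\<ge>N2. d (snd (f k)) b < \<delta>2" using b(2)[OF d2(1)] by blast
    obtain N3 where N3: "(1/2::real) ^ N3 < e/3" using real_arch_pow_inv[of "e/3" "1/2"] e by auto
    define k where "k = N1 + N2 + N3"
    let ?a = "fst (f (Suc k))" and ?b = "snd (f (Suc k))"
    have c: "?a \<in> carrier G" "?b \<in> carrier G" using f(1) by auto
    have "d (cj ?a x) (cj ?b y) < (1/2) ^ k" using f(2)[of k] by simp
    also have "\<dots> \<le> (1/2) ^ N3" unfolding k_def by (rule power_decreasing) auto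
    finally have 3: "d (cj ?a x) (cj ?b y) < e/3" using N3 by simp
    have 1: "d (cj ?a x) (cj a x) < e/3" using d1(2)[OF c(1)] N1 by (simp add: k_def)
    have 2: "d (cj ?b y) (cj b y) < e/3" using d2(2)[OF c(2)] N2 by (simp add: k_def)
    have "d (cj a x) (cj b y) \<le> d (cj a x) (cj ?a x) + d (cj ?a x) (cj b y)"
      using a b c x y by (intro triangle) auto
    moreover have "d (cj ?a x) (cj b y) \<le> d (cj ?a x) (cj ?b y) + d (cj ?b y) (cj b y)"
      using a b c x y by (intro triangle) auto
    ultimately show "d (cj a x) (cj b y) \<le> 0 + e" using 1 2 3 commute[of "cj a x" "cj ?a x"] by linarith
  qed
  then have "cj a x = cj b y" using a b x y nonneg[of "cj a x" "cj b y"] zero[of "cj a x" "cj b y"] by auto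
  then have "cj (inv b) (cj a x) = y" using b y by (simp add: cj_cj cj_one)
  then show ?thesis using a b x by (intro bexI[of _ "inv b \<otimes> a"]) (auto simp: cj_cj)
qed

section \<open>Generic elements and their conjugates\<close>

definition hit :: "'a set \<Rightarrow> 'a \<Rightarrow> real \<Rightarrow> 'a set" where
  "hit V q \<eta> = {x \<in> carrier G. \<exists>h\<in>V. d (cj h x) q < \<eta>}"

text \<open>Adding the interior of the complement makes an open set dense, whether or not it was
  dense before. A generic point outside the hit set thus has a whole neighbourhood outside
  it.\<close>

definition hit_or_miss :: "'a set \<Rightarrow> 'a \<Rightarrow> real \<Rightarrow> 'a set" where
  "hit_or_miss V q \<eta> = hit V q \<eta> \<union> {x \<in> carrier G. \<exists>r>0. mball x r \<inter> hit V q \<eta> = {}}"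

text \<open>Near conjugacy of open sets: it speaks of approximations z1 and z2, because only
  perturbed elements can be made exactly conjugate.\<close>

definition good :: "'a set \<Rightarrow> 'a \<Rightarrow> real \<Rightarrow> bool" where
  "good V x \<delta> \<longleftrightarrow> (\<forall>y1\<in>mball x \<delta>. \<forall>y2\<in>mball x \<delta>. \<forall>\<eta>>0. \<exists>z1\<in>carrier G. \<exists>z2\<in>carrier G. \<exists>h\<in>V.
     d z1 y1 < \<eta> \<and> d z2 y2 < \<eta> \<and> z2 = cj h z1)"

lemma dense_mtopologyI:
  assumes "W \<subseteq> carrier G" "\<And>x e. x \<in> carrier G \<Longrightarrow> e > 0 \<Longrightarrow> \<exists>y\<in>W. d x y < e"
  shows "mtopology closure_of W = topspace mtopology"
  using assms by (auto simp: metric_closure_of) (meson subsetD)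

lemma open_hit:
  assumes "V \<subseteq> carrier G" "q \<in> carrier G" shows "openin mtopology (hit V q \<eta>)"
  unfolding openin_mtopology
proof (intro conjI allI impI)
  show "hit V q \<eta> \<subseteq> carrier G" by (auto simp: hit_def)
  fix x assume "x \<in> hit V q \<eta>"
  then obtain h where h: "x \<in> carrier G" "h \<in> V" "d (cj h x) q < \<eta>" by (auto simp: hit_def)
  then have hc: "h \<in> carrier G" using assms by auto
  obtain \<delta> where \<delta>: "\<delta> > 0" "\<And>x'. x' \<in> carrier G \<Longrightarrow> d x' x < \<delta> \<Longrightarrow> d (cj h x') (cj h x) < \<eta> - d (cj h x) q"
    using cj_cont[OF hc h(1), of "\<eta> - d (cj h x) q"] h(3) hc by (metis diff_gt_0_iff_gt mdist_zero)
  have "mball x \<delta> \<subseteq> hit V q \<eta>"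
  proof
    fix y assume "y \<in> mball x \<delta>"
    then have y: "y \<in> carrier G" "d y x < \<delta>" by (auto simp: commute)
    have "d (cj h y) q \<le> d (cj h y) (cj h x) + d (cj h x) q" using y h hc assms by (intro triangle) auto
    then have "d (cj h y) q < \<eta>" using \<delta>(2)[OF y] by linarith
    then show "y \<in> hit V q \<eta>" using y h by (auto simp: hit_def)
  qed
  then show "\<exists>r>0. mball x r \<subseteq> hit V q \<eta>" using \<delta>(1) by blast
qed

lemma open_hit_or_miss:
  assumes "V \<subseteq> carrier G" "q \<in> carrier G" shows "openin mtopology (hit_or_miss V q \<eta>)"
  unfolding hit_or_miss_def
proof (intro openin_Un open_hit assms)
  show "openin mtopology {x \<in> carrier G. \<exists>r>0. mball x r \<inter> hit V q \<eta> = {}}"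
    unfolding openin_mtopology
  proof (intro conjI allI impI)
    fix x assume "x \<in> {x \<in> carrier G. \<exists>r>0. mball x r \<inter> hit V q \<eta> = {}}"
    then obtain r where r: "x \<in> carrier G" "r > 0" "mball x r \<inter> hit V q \<eta> = {}" by blast
    have "y \<in> {x \<in> carrier G. \<exists>r>0. mball x r \<inter> hit V q \<eta> = {}}" if y: "y \<in> mball x r" for y
    proof -
      have "mball y (r - d x y) \<subseteq> mball x r" using y by (intro mball_subset) (auto simp: commute)
      then have "mball y (r - d x y) \<inter> hit V q \<eta> = {}" using r(3) by blast
      moreover have "r - d x y > 0" "y \<in> carrier G" using y by auto
      ultimately show ?thesis by blast
    qed
    then have "mball x r \<subseteq> {x \<in> carrier G. \<exists>r>0. mball x r \<inter> hit V q \<eta> = {}}" by blast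
    then show "\<exists>s>0. mball x s \<subseteq> {x \<in> carrier G. \<exists>r>0. mball x r \<inter> hit V q \<eta> = {}}" using r by blast
  qed auto
qed

lemma dense_hit_or_miss: "mtopology closure_of (hit_or_miss V q \<eta>) = topspace mtopology"
proof (rule dense_mtopologyI)
  fix x and e :: real assume x: "x \<in> carrier G" "e > 0"
  show "\<exists>y\<in>hit_or_miss V q \<eta>. d x y < e"
  proof (cases "mball x e \<inter> hit V q \<eta> = {}")
    case True
    then show ?thesis using x by (intro bexI[of _ x]) (auto simp: hit_or_miss_def)
  qed (auto simp: hit_or_miss_def)
qed (auto simp: hit_or_miss_def hit_def)

text \<open>A point q of the ball cannot be missed: by \<open>good\<close> there are z1 arbitrarily
  near x with a V-conjugate arbitrarily near q, so x is not interior to the complement of the hit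
  set, and \<open>hit_or_miss\<close> leaves only a hit.\<close>

lemma loc_ball:
  assumes x: "x \<in> carrier G" and x': "x' \<in> carrier G" "d x x' < \<delta>" and good: "good V x' \<delta>"
    and Q: "Q \<subseteq> carrier G" "\<And>z e. z \<in> carrier G \<Longrightarrow> e > 0 \<Longrightarrow> \<exists>q\<in>Q. d z q < e"
    and hm: "\<And>q k. q \<in> Q \<Longrightarrow> x \<in> hit_or_miss V q (1 / real (Suc k))"
    and V: "V \<subseteq> carrier G" and y: "y \<in> carrier G" "d x y < \<delta> - d x x'" and \<eta>: "\<eta> > 0"
  shows "\<exists>h\<in>V. d (cj h x) y < \<eta>"
proof -
  obtain q where q: "q \<in> Q" "d y q < min (\<eta>/2) (\<delta> - d x x' - d x y)" using Q(2)[OF y(1)] y \<eta> by (metis diff_gt_0_iff_gt half_gt_zero min_less_iff_conj)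
  have qc: "q \<in> carrier G" using q Q by auto
  obtain k where k: "1 / real (Suc k) < \<eta>/2" using nat_approx_posE[of "\<eta>/2"] \<eta> by auto
  have "x \<in> hit V q (1 / real (Suc k))"
  proof (rule ccontr)
    assume "x \<notin> hit V q (1 / real (Suc k))"
    then obtain s where s: "s > 0" "mball x s \<inter> hit V q (1 / real (Suc k)) = {}" using hm[OF q(1), of k] by (auto simp: hit_or_miss_def)
    have "d x' q \<le> d x' x + d x q" "d x q \<le> d x y + d y q" using x x' y qc by (auto intro: triangle)
    then have "q \<in> mball x' \<delta>" using q x' qc commute[of x x'] by (auto simp: in_mball)
    moreover have "x \<in> mball x' \<delta>" using x x' by (auto simp: commute)
    ultimately obtain z1 z2 h where z: "z1 \<in> carrier G" "z2 \<in> carrier G" "h \<in> V" "d z1 x < min s (1 / real (Suc k))" "d z2 q < min s (1 / real (Suc k))" "z2 = cj h z1"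
      using good[unfolded good_def, rule_format, of x q "min s (1 / real (Suc k))"] s(1) by auto
    then have "z1 \<in> mball x s \<inter> hit V q (1 / real (Suc k))" using x by (auto simp: hit_def commute)
    then show False using s by auto
  qed
  then obtain h where h: "h \<in> V" "d (cj h x) q < 1 / real (Suc k)" by (auto simp: hit_def)
  have "d (cj h x) y \<le> d (cj h x) q + d q y" using h V x y qc by (intro triangle) auto
  then show ?thesis using h k q commute[of q y] by (intro bexI[of _ h]) auto
qed

theorem comeager_conjugacy_class:
  assumes local: "\<And>\<epsilon> x \<eta>. \<epsilon> > 0 \<Longrightarrow> x \<in> carrier G \<Longrightarrow> \<eta> > 0 \<Longrightarrow> \<exists>x'\<in>carrier G. d x x' < \<eta> \<and> (\<exists>\<delta>>0. good {h \<in> carrier G. d h \<one> < \<epsilon>} x' \<delta>)"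
    and global: "\<And>y1 y2 \<eta>. y1 \<in> carrier G \<Longrightarrow> y2 \<in> carrier G \<Longrightarrow> \<eta> > 0 \<Longrightarrow>
      \<exists>z1\<in>carrier G. \<exists>z2\<in>carrier G. \<exists>h\<in>carrier G. d z1 y1 < \<eta> \<and> d z2 y2 < \<eta> \<and> z2 = cj h z1"
  shows "\<exists>u\<in>carrier G. comeager_in mtopology {inv h \<otimes> u \<otimes> h | h. h \<in> carrier G}"
proof -
  obtain Q where Q: "Q \<subseteq> carrier G" "countable Q" "\<And>z e. z \<in> carrier G \<Longrightarrow> e > 0 \<Longrightarrow> \<exists>q\<in>Q. d z q < e"
    using separable by blast
  define V where "V n = {h \<in> carrier G. d h \<one> < 1 / real (Suc n)}" for n
  define L where "L n = {x \<in> carrier G. \<exists>x'\<in>carrier G. \<exists>\<delta>. d x x' < \<delta> \<and> good (V n) x' \<delta>}" for n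
  \<comment> \<open>\<open>Inl n\<close> imposes the local condition at scale 1/(n+1);
    \<open>Some n\<close> restricts conjugators to the ball \<open>V n\<close> and yields
    \<open>loc\<close>; \<open>None\<close> admits all conjugators and yields dense classes.\<close>
  define W where "W = (\<lambda>i. case i of Inl n \<Rightarrow> L n | Inr (v, q, k) \<Rightarrow> hit_or_miss (case v of None \<Rightarrow> carrier G | Some n \<Rightarrow> V n) q (1 / real (Suc k)))"
  define I where "I = (UNIV :: nat set) <+> (UNIV :: nat option set) \<times> Q \<times> (UNIV :: nat set)"
  have VG: "V n \<subseteq> carrier G" for n by (auto simp: V_def)
  have I: "countable I" unfolding I_def using Q(2) by (intro countable_Plus countable_SIGMA) auto
  have oL: "openin mtopology (L n)" for n
    unfolding openin_mtopology
  proof (intro conjI allI impI)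
    fix x assume "x \<in> L n"
    then obtain x' \<delta> where x: "x \<in> carrier G" "x' \<in> carrier G" "d x x' < \<delta>" "good (V n) x' \<delta>" by (auto simp: L_def)
    have "y \<in> L n" if y: "y \<in> carrier G" "d x y < \<delta> - d x x'" for y
    proof -
      have "d y x' \<le> d y x + d x x'" using x y by (intro triangle) auto
      then have "d y x' < \<delta>" using y(2) commute[of x y] by linarith
      then show ?thesis using x y by (auto simp: L_def)
    qed
    then show "\<exists>r>0. mball x r \<subseteq> L n" using x by (intro exI[of _ "\<delta> - d x x'"]) auto
  qed (auto simp: L_def)
  have dL: "mtopology closure_of (L n) = topspace mtopology" for n
  proof (rule dense_mtopologyI)
    fix x and e :: real assume x: "x \<in> carrier G" "e > 0"
    obtain x' \<delta> where "x' \<in> carrier G" "d x x' < e" "\<delta> > 0" "good (V n) x' \<delta>"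
      using local[of "1 / real (Suc n)" x e] x unfolding V_def by auto
    then show "\<exists>y\<in>L n. d x y < e" by (intro bexI[of _ x']) (auto simp: L_def intro!: exI[of _ \<delta>] bexI[of _ x'])
  qed (auto simp: L_def)
  have oW: "openin mtopology (W i)" "mtopology closure_of (W i) = topspace mtopology" if "i \<in> I" for i
    using that oL dL open_hit_or_miss[OF _ subsetD[OF Q(1)]] dense_hit_or_miss VG
    by (auto simp: W_def I_def split: sum.splits prod.splits option.splits)
  define S where "S = {x \<in> carrier G. \<forall>i\<in>I. x \<in> W i}"
  have S_loc: "loc x" if "x \<in> S" for x
    unfolding loc_def
  proof (intro allI impI)
    fix \<epsilon> :: real assume "\<epsilon> > 0"
    then obtain n where n: "1 / real (Suc n) < \<epsilon>" using nat_approx_posE by blast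
    have x: "x \<in> carrier G" using that by (simp add: S_def)
    have "Inl n \<in> I" unfolding I_def by (intro InlI UNIV_I)
    then have "x \<in> L n" using that by (force simp: S_def W_def)
    then obtain x' \<delta> where x': "x' \<in> carrier G" "d x x' < \<delta>" "good (V n) x' \<delta>" by (auto simp: L_def)
    have hm: "x \<in> hit_or_miss (V n) q (1 / real (Suc k))" if "q \<in> Q" for q k
    proof -
      have "Inr (Some n, q, k) \<in> I" using that unfolding I_def by (intro InrI) simp
      then show ?thesis using \<open>x \<in> S\<close> by (force simp: S_def W_def)
    qed
    have "\<exists>h\<in>carrier G. d h \<one> < \<epsilon> \<and> d (cj h x) y < \<eta>" if y: "y \<in> carrier G" "d x y < \<delta> - d x x'" "\<eta> > 0" for y \<eta>
      using loc_ball[OF x x' Q(1,3) hm VG y] n by (force simp: V_def)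
    then show "\<exists>r>0. \<forall>y\<in>carrier G. d x y < r \<longrightarrow> (\<forall>\<eta>>0. \<exists>h\<in>carrier G. d h \<one> < \<epsilon> \<and> d (cj h x) y < \<eta>)"
      using x' by (intro exI[of _ "\<delta> - d x x'"]) auto
  qed
  have S_dense: "\<exists>h\<in>carrier G. d (cj h x) y < e" if xS: "x \<in> S" and y: "y \<in> carrier G" and e: "e > 0" for x y e
  proof -
    have x: "x \<in> carrier G" using xS by (simp add: S_def)
    have hm: "x \<in> hit_or_miss (carrier G) q (1 / real (Suc k))" if "q \<in> Q" for q k
    proof -
      have "Inr (None, q, k) \<in> I" using that unfolding I_def by (intro InrI) simp
      then show ?thesis using xS by (force simp: S_def W_def)
    qed
    \<comment> \<open>By \<open>global\<close> every ball is good for conjugators from the whole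
      group; this radius exceeds the distance to y, so \<open>loc_ball\<close> reaches y.\<close>
    have "good (carrier G) x (d x y + 1)" unfolding good_def using global by (auto simp: in_mball)
    from loc_ball[OF x x _ this Q(1,3) hm _ y _ e] show ?thesis using x nonneg[of x y] by (simp add: add_nonneg_pos)
  qed
  show ?thesis
  proof (cases "S = {}")
    case True
    \<comment> \<open>If the chosen dense open sets have empty intersection, every subset is
      comeager, and the class of the unit serves.\<close>
    have "comeager_in mtopology {inv h \<otimes> \<one> \<otimes> h | h. h \<in> carrier G}"
      by (rule comeagerI[OF I oW]) (use True in \<open>auto simp: S_def\<close>)
    then show ?thesis by blast
  next
    case False
    then obtain u where u: "u \<in> S" by auto
    then have uc: "u \<in> carrier G" by (simp add: S_def)
    have "comeager_in mtopology {inv h \<otimes> u \<otimes> h | h. h \<in> carrier G}"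
    proof (rule comeagerI[OF I oW])
      fix x assume "x \<in> topspace mtopology" "\<And>i. i \<in> I \<Longrightarrow> x \<in> W i"
      then have x: "x \<in> S" "x \<in> carrier G" by (auto simp: S_def)
      obtain g where g: "g \<in> carrier G" "x = cj g u"
        using loc_conjugate[OF uc S_loc[OF u] x(2) S_loc[OF x(1)] S_dense[OF x(1)]] by blast
      then show "x \<in> {inv h \<otimes> u \<otimes> h | h. h \<in> carrier G}"
        by (intro CollectI exI[of _ "inv g"]) (auto simp: cj_def)
    qed (use uc in auto)
    then show ?thesis using uc by blast
  qed
qed

end

section \<open>The sup metric on a homeomorphism group\<close>

definition sup_dist :: "'a::metric_space set \<Rightarrow> ('a \<Rightarrow> 'a) \<Rightarrow> ('a \<Rightarrow> 'a) \<Rightarrow> real" where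
  "sup_dist S = mdist (cfunspace (top_of_set S) euclidean_metric)"

lemma homeosD:
  assumes "f \<in> homeos S"
  shows homeos_continuous: "continuous_on S f"
    and homeos_mem: "x \<in> S \<Longrightarrow> f x \<in> S"
    and homeos_inverse_exists: "\<exists>g. continuous_on S g \<and> (\<forall>x\<in>S. g x \<in> S \<and> g (f x) = x \<and> f (g x) = x)"
proof -
  obtain g where "homeomorphic_maps (top_of_set S) (top_of_set S) f g"
    using assms by (auto simp: homeos_def homeomorphic_map_maps)
  then have "continuous_on S f \<and> f ` S \<subseteq> S \<and> continuous_on S g \<and> g ` S \<subseteq> S \<and> (\<forall>x\<in>S. g (f x) = x) \<and> (\<forall>x\<in>S. f (g x) = x)"
    by (auto simp: homeomorphic_maps_def continuous_map_in_subtopology)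
  then show "continuous_on S f" "x \<in> S \<Longrightarrow> f x \<in> S"
    "\<exists>g. continuous_on S g \<and> (\<forall>x\<in>S. g x \<in> S \<and> g (f x) = x \<and> f (g x) = x)" by blast+
qed

lemma homeosI_inverse:
  assumes "f \<in> extensional S" "continuous_on S f" "continuous_on S g" "\<And>x. x \<in> S \<Longrightarrow> f x \<in> S \<and> g x \<in> S \<and> g (f x) = x \<and> f (g x) = x"
  shows "f \<in> homeos S"
proof -
  have "homeomorphic_maps (top_of_set S) (top_of_set S) f g"
    using assms by (auto simp: homeomorphic_maps_def continuous_map_in_subtopology)
  then show ?thesis using assms(1) by (auto simp: homeos_def homeomorphic_map_maps)
qed

lemma homeos_onto: "f \<in> homeos S \<Longrightarrow> y \<in> S \<Longrightarrow> \<exists>x\<in>S. f x = y"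
  using homeos_inverse_exists by metis

lemma homeos_eqI: "f \<in> homeos S \<Longrightarrow> g \<in> homeos S \<Longrightarrow> (\<And>x. x \<in> S \<Longrightarrow> f x = g x) \<Longrightarrow> f = g"
  by (rule extensionalityI[of f S g]) (auto simp: homeos_def)

lemma carrier_Homeo [simp]: "carrier (Homeo S) = homeos S"
  by (simp add: Homeo_def)

lemma homeos_Bij: "homeos S \<subseteq> Bij S"
  using subgroup.subset[OF subgroup_homeos] by (simp add: BijGroup_def)

lemma mult_Homeo_mem [simp]: "f \<in> homeos S \<Longrightarrow> g \<in> homeos S \<Longrightarrow> f \<otimes>\<^bsub>Homeo S\<^esub> g \<in> homeos S"
  using monoid.m_closed[OF group.is_monoid[OF group_Homeo], of f S g] by simp

lemma inv_Homeo_mem [simp]: "f \<in> homeos S \<Longrightarrow> inv\<^bsub>Homeo S\<^esub> f \<in> homeos S"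
  using group.inv_closed[OF group_Homeo, of f S] by simp

lemma mult_Homeo: "f \<in> homeos S \<Longrightarrow> g \<in> homeos S \<Longrightarrow> x \<in> S \<Longrightarrow> (f \<otimes>\<^bsub>Homeo S\<^esub> g) x = f (g x)"
  using homeos_Bij by (auto simp: Homeo_def BijGroup_def compose_def subset_iff)

lemma one_Homeo: "x \<in> S \<Longrightarrow> \<one>\<^bsub>Homeo S\<^esub> x = x"
  by (simp add: Homeo_def BijGroup_def)

lemma inv_Homeo_left: assumes "f \<in> homeos S" "x \<in> S" shows "(inv\<^bsub>Homeo S\<^esub> f) (f x) = x"
  using mult_Homeo[OF inv_Homeo_mem[OF assms(1)] assms] group.l_inv[OF group_Homeo, of f S] one_Homeo[OF assms(2)] assms by simp

lemma inv_Homeo_right: assumes "f \<in> homeos S" "x \<in> S" shows "f ((inv\<^bsub>Homeo S\<^esub> f) x) = x"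
  using mult_Homeo[OF assms(1) inv_Homeo_mem[OF assms(1)] assms(2)] group.r_inv[OF group_Homeo, of f S] one_Homeo[OF assms(2)] assms by simp

context
  fixes S :: "'a::metric_space set"
  assumes S: "compact S"
begin

lemma homeos_cfunspace: "homeos S \<subseteq> mspace (cfunspace (top_of_set S) euclidean_metric)"
  using topspace_homeo_topology[OF S] by (auto simp: homeo_topology_def simp del: mspace_cfunspace)

lemma sup_dist_le:
  assumes "f \<in> homeos S" "g \<in> homeos S" "B \<ge> 0"
  shows "sup_dist S f g \<le> B \<longleftrightarrow> (\<forall>x\<in>S. dist (f x) (g x) \<le> B)"
proof
  assume "sup_dist S f g \<le> B"
  then show "\<forall>x\<in>S. dist (f x) (g x) \<le> B"
    using mdist_cfunspace_imp_mdist_le[of f "top_of_set S" euclidean_metric g B] assms homeos_cfunspace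
    by (auto simp: sup_dist_def simp del: mspace_cfunspace)
next
  assume "\<forall>x\<in>S. dist (f x) (g x) \<le> B"
  then show "sup_dist S f g \<le> B"
    unfolding sup_dist_def using assms(3) by (intro mdist_cfunspace_le) auto
qed

lemma Metric_space_sup_dist: "Metric_space (homeos S) (sup_dist S)"
  unfolding sup_dist_def
  by (rule Metric_space.subspace[OF Metric_space_mspace_mdist homeos_cfunspace])

lemma mtopology_sup_dist:
  assumes "U \<subseteq> homeos S"
  shows "Metric_space.mtopology U (sup_dist S) = subtopology (homeo_topology S) U"
proof -
  interpret Submetric "mspace (cfunspace (top_of_set S) (euclidean_metric :: 'a metric))" "sup_dist S" U
    unfolding sup_dist_def Submetric_def Submetric_axioms_def
    using assms homeos_cfunspace Metric_space_mspace_mdist by blast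
  show ?thesis
    using mtopology_submetric assms
    by (simp add: homeo_topology_def subtopology_subtopology mtopology_of_def sup_dist_def Int_absorb1 del: mspace_cfunspace)
qed

lemma sup_dist_nonneg: "f \<in> homeos S \<Longrightarrow> g \<in> homeos S \<Longrightarrow> 0 \<le> sup_dist S f g"
  using Metric_space.nonneg[OF Metric_space_sup_dist] by blast

lemma sup_dist_point: "f \<in> homeos S \<Longrightarrow> g \<in> homeos S \<Longrightarrow> x \<in> S \<Longrightarrow> dist (f x) (g x) \<le> sup_dist S f g"
  using sup_dist_le[of f g "sup_dist S f g"] sup_dist_nonneg[of f g] by auto

lemma openin_homeo_topologyI:
  assumes "U \<subseteq> homeos S" "\<And>h. h \<in> U \<Longrightarrow> \<exists>r>0. \<forall>g\<in>homeos S. sup_dist S h g < r \<longrightarrow> g \<in> U"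
  shows "openin (homeo_topology S) U"
proof -
  interpret Metric_space "homeos S" "sup_dist S" by (rule Metric_space_sup_dist)
  have "openin mtopology U" unfolding openin_mtopology
  proof (intro conjI allI impI assms(1))
    fix h assume "h \<in> U"
    then obtain r where "r > 0" "\<forall>g\<in>homeos S. sup_dist S h g < r \<longrightarrow> g \<in> U" using assms(2) by blast
    then show "\<exists>r>0. mball h r \<subseteq> U" by (intro exI[of _ r]) auto
  qed
  moreover have "mtopology = homeo_topology S"
    using mtopology_sup_dist[of "homeos S"] topspace_homeo_topology[OF S] by (metis carrier_Homeo order_refl subtopology_topspace)
  ultimately show ?thesis by simp
qed

lemma homeos_uniformly_continuous:
  assumes "f \<in> homeos S" "e > 0"
  shows "\<exists>\<delta>>0. \<forall>x\<in>S. \<forall>y\<in>S. dist x y \<le> \<delta> \<longrightarrow> dist (f x) (f y) \<le> e"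
proof -
  obtain \<delta> where "\<delta> > 0" "\<forall>x\<in>S. \<forall>y\<in>S. dist y x < \<delta> \<longrightarrow> dist (f y) (f x) < e"
    using compact_uniformly_continuous[OF homeos_continuous[OF assms(1)] S] assms(2) unfolding uniformly_continuous_on_def by blast
  then show ?thesis by (intro exI[of _ "\<delta>/2"]) (auto simp: dist_commute less_imp_le)
qed

text \<open>Since h maps S onto S, composing with h on the inside only reparametrises the
  supremum.\<close>

lemma sup_dist_right_inv:
  assumes "f \<in> homeos S" "g \<in> homeos S" "h \<in> homeos S"
  shows "sup_dist S (f \<otimes>\<^bsub>Homeo S\<^esub> h) (g \<otimes>\<^bsub>Homeo S\<^esub> h) = sup_dist S f g"
proof (rule antisym)
  show "sup_dist S (f \<otimes>\<^bsub>Homeo S\<^esub> h) (g \<otimes>\<^bsub>Homeo S\<^esub> h) \<le> sup_dist S f g"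
    using assms sup_dist_point[OF assms(1,2)] sup_dist_nonneg[OF assms(1,2)]
    by (subst sup_dist_le) (auto simp: mult_Homeo homeos_mem)
  show "sup_dist S f g \<le> sup_dist S (f \<otimes>\<^bsub>Homeo S\<^esub> h) (g \<otimes>\<^bsub>Homeo S\<^esub> h)"
  proof (subst sup_dist_le[OF assms(1,2)], rule sup_dist_nonneg; (intro ballI)?)
    fix y assume "y \<in> S"
    then obtain x where x: "x \<in> S" "h x = y" using homeos_onto[OF assms(3)] by blast
    then show "dist (f y) (g y) \<le> sup_dist S (f \<otimes>\<^bsub>Homeo S\<^esub> h) (g \<otimes>\<^bsub>Homeo S\<^esub> h)"
      using sup_dist_point[of "f \<otimes>\<^bsub>Homeo S\<^esub> h" "g \<otimes>\<^bsub>Homeo S\<^esub> h" x] assms by (auto simp: mult_Homeo)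
  qed (use assms in auto)
qed

lemma sup_dist_left_cont:
  assumes "g \<in> homeos S" "e > 0"
  shows "\<exists>\<delta>>0. \<forall>h\<in>homeos S. sup_dist S h \<one>\<^bsub>Homeo S\<^esub> < \<delta> \<longrightarrow> sup_dist S (g \<otimes>\<^bsub>Homeo S\<^esub> h) g < e"
proof -
  have one: "\<one>\<^bsub>Homeo S\<^esub> \<in> homeos S" using monoid.one_closed[OF group.is_monoid[OF group_Homeo], of S] by simp
  obtain \<delta> where \<delta>: "\<delta> > 0" "\<forall>x\<in>S. \<forall>y\<in>S. dist x y \<le> \<delta> \<longrightarrow> dist (g x) (g y) \<le> e/2"
    using homeos_uniformly_continuous[OF assms(1), of "e/2"] assms(2) by auto
  have "sup_dist S (g \<otimes>\<^bsub>Homeo S\<^esub> h) g < e" if h: "h \<in> homeos S" "sup_dist S h \<one>\<^bsub>Homeo S\<^esub> < \<delta>" for h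
  proof -
    have "sup_dist S (g \<otimes>\<^bsub>Homeo S\<^esub> h) g \<le> e/2"
      using sup_dist_point[OF h(1) one] h \<delta>(2) assms by (subst sup_dist_le) (force simp: mult_Homeo homeos_mem one_Homeo)+
    then show ?thesis using assms(2) by linarith
  qed
  then show ?thesis using \<delta>(1) by blast
qed

lemma uniform_limit_exists:
  assumes f: "\<And>k. continuous_on S (f k)" "\<And>k x. x \<in> S \<Longrightarrow> f k x \<in> S"
    and c: "\<And>k x. x \<in> S \<Longrightarrow> dist (f k x) (f (Suc k) x) \<le> (1/2::real) ^ k"
  obtains l where "continuous_on S l" "\<And>x. x \<in> S \<Longrightarrow> l x \<in> S" "\<And>k x. x \<in> S \<Longrightarrow> dist (f k x) (l x) \<le> 2 * (1/2) ^ k"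
proof -
  \<comment> \<open>The subtracted term is the remaining tail of the geometric series; it makes the
    induction on j close.\<close>
  have d: "dist (f k x) (f (k + j) x) \<le> 2 * (1/2) ^ k - 2 * (1/2) ^ (k + j)" if x: "x \<in> S" for k j x
  proof (induction j)
    case (Suc j)
    have "dist (f k x) (f (Suc (k + j)) x) \<le> dist (f k x) (f (k + j) x) + dist (f (k + j) x) (f (Suc (k + j)) x)"
      by (rule dist_triangle)
    then show ?case using Suc c[OF x, of "k + j"] by simp
  qed simp
  have d': "dist (f k x) (f (k + j) x) \<le> 2 * (1/2) ^ k" if "x \<in> S" for k j x
  proof -
    have "0 \<le> (1/2::real) ^ (k + j)" by simp
    then show ?thesis using d[OF that, of k j] by linarith
  qed
  have small: "\<exists>N. 2 * (1/2::real) ^ N < e" if "e > 0" for e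
    using real_arch_pow_inv[of "e/2" "1/2"] that by (auto simp: field_simps)
  have "\<exists>l\<in>S. (\<lambda>k. f k x) \<longlonglongrightarrow> l" if x: "x \<in> S" for x
  proof -
    have "Cauchy (\<lambda>k. f k x)"
    proof (rule CauchyI')
      fix e :: real assume "e > 0"
      then obtain N where N: "2 * (1/2::real) ^ N < e" using small by blast
      have "dist (f m x) (f n x) < e" if "m \<ge> N" "n > m" for m n
      proof -
        have "(1/2::real) ^ m \<le> (1/2) ^ N" using that by (intro power_decreasing) auto
        moreover have "dist (f m x) (f n x) \<le> 2 * (1/2) ^ m" using d'[OF x, of m "n - m"] that by simp
        ultimately show ?thesis using N by linarith
      qed
      then show "\<exists>M. \<forall>m\<ge>M. \<forall>n>m. dist (f m x) (f n x) < e" by blast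
    qed
    then show ?thesis
      using compact_imp_complete[OF S, unfolded complete_def, rule_format, of "\<lambda>k. f k x"] f(2)[OF x] by simp
  qed
  then obtain l where l: "\<And>x. x \<in> S \<Longrightarrow> l x \<in> S" "\<And>x. x \<in> S \<Longrightarrow> (\<lambda>k. f k x) \<longlonglongrightarrow> l x" by metis
  have n: "dist (f k x) (l x) \<le> 2 * (1/2) ^ k" if x: "x \<in> S" for k x
  proof (rule LIMSEQ_le_const2)
    show "(\<lambda>j. dist (f k x) (f j x)) \<longlonglongrightarrow> dist (f k x) (l x)" by (intro tendsto_intros l(2) x)
    have "dist (f k x) (f j x) \<le> 2 * (1/2) ^ k" if "j \<ge> k" for j using d'[OF x, of k "j - k"] that by simp
    then show "\<exists>N. \<forall>j\<ge>N. dist (f k x) (f j x) \<le> 2 * (1/2) ^ k" by blast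
  qed
  have "uniform_limit S f l sequentially"
  proof (rule uniform_limitI)
    fix e :: real assume "e > 0"
    then obtain N where N: "2 * (1/2::real) ^ N < e" using small by blast
    have "dist (f k x) (l x) < e" if "k \<ge> N" "x \<in> S" for k x
    proof -
      have "(1/2::real) ^ k \<le> (1/2) ^ N" using that by (intro power_decreasing) auto
      then show ?thesis using n[OF that(2), of k] N by linarith
    qed
    then show "\<forall>\<^sub>F k in sequentially. \<forall>x\<in>S. dist (f k x) (l x) < e" unfolding eventually_sequentially by blast
  qed
  then have "continuous_on S l" by (rule uniform_limit_theorem[rotated]) (use f(1) in auto)
  then show ?thesis using that l(1) n by blast
qed

text \<open>A uniform limit of homeomorphisms can fail to be injective. The Cauchy condition on the
  inverses yields a second limit map, and evaluating along \<open>v k x\<close> shows the two limits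
  to be inverse to each other.\<close>

lemma homeos_complete:
  assumes s: "\<And>k::nat. s k \<in> homeos S" and c1: "\<And>k. sup_dist S (s k) (s (Suc k)) < (1/2) ^ k"
    and c2: "\<And>k. sup_dist S (inv\<^bsub>Homeo S\<^esub> (s k)) (inv\<^bsub>Homeo S\<^esub> (s (Suc k))) < (1/2) ^ k"
  shows "\<exists>l\<in>homeos S. \<forall>e>0. \<exists>N. \<forall>k\<ge>N. sup_dist S (s k) l < e"
proof -
  let ?i = "\<lambda>k. inv\<^bsub>Homeo S\<^esub> (s k)"
  have i: "?i k \<in> homeos S" for k using s by simp
  have "dist (s k x) (s (Suc k) x) \<le> (1/2) ^ k" "dist (?i k x) (?i (Suc k) x) \<le> (1/2) ^ k" if "x \<in> S" for k x
    using sup_dist_point[OF s s that, of k "Suc k"] sup_dist_point[OF i i that, of k "Suc k"] c1[of k] c2[of k] by linarith+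
  note d = this
  obtain l where l: "continuous_on S l" "\<And>x. x \<in> S \<Longrightarrow> l x \<in> S" "\<And>k x. x \<in> S \<Longrightarrow> dist (s k x) (l x) \<le> 2 * (1/2) ^ k"
    using uniform_limit_exists[of s] homeos_continuous[OF s] homeos_mem[OF s] d(1) by blast
  obtain m where m: "continuous_on S m" "\<And>x. x \<in> S \<Longrightarrow> m x \<in> S" "\<And>k x. x \<in> S \<Longrightarrow> dist (?i k x) (m x) \<le> 2 * (1/2) ^ k"
    using uniform_limit_exists[of ?i] homeos_continuous[OF i] homeos_mem[OF i] d(2) by blast
  have lim: "(\<lambda>k. 2 * (1/2::real) ^ k) \<longlonglongrightarrow> 0"
    using tendsto_mult_left[OF LIMSEQ_power_zero[of "1/2::real"], of 2] by simp
  have null: "w \<longlonglongrightarrow> 0" if "\<And>k. 0 \<le> w k" "\<And>k. w k \<le> 2 * (1/2) ^ k" for w :: "nat \<Rightarrow> real"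
    using that by (intro real_tendsto_sandwich[where f = "\<lambda>_. 0" and h = "\<lambda>k. 2 * (1/2) ^ k", OF _ _ tendsto_const lim]) auto
  have inverse: "g (f x) = x"
    if g: "continuous_on S g" "\<And>x. x \<in> S \<Longrightarrow> g x \<in> S" "\<And>k x. x \<in> S \<Longrightarrow> dist (u k x) (g x) \<le> 2 * (1/2) ^ k"
      and f: "\<And>x. x \<in> S \<Longrightarrow> f x \<in> S" "\<And>k x. x \<in> S \<Longrightarrow> dist (v k x) (f x) \<le> 2 * (1/2) ^ k"
      and v: "\<And>k x. x \<in> S \<Longrightarrow> v k x \<in> S" "\<And>k x. x \<in> S \<Longrightarrow> u k (v k x) = x" and x: "x \<in> S"
    for f g :: "'a \<Rightarrow> 'a" and u v :: "nat \<Rightarrow> 'a \<Rightarrow> 'a" and x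
  proof -
    have "(\<lambda>k. dist (v k x) (f x)) \<longlonglongrightarrow> 0"
      by (rule null[OF zero_le_dist f(2)[OF x]])
    then have "(\<lambda>k. v k x) \<longlonglongrightarrow> f x" by (rule iffD2[OF tendsto_dist_iff])
    then have "(\<lambda>k. g (v k x)) \<longlonglongrightarrow> g (f x)"
      by (rule continuous_on_tendsto_compose[OF g(1)]) (use f(1) v(1) x in auto)
    moreover have "dist (g (v k x)) x \<le> 2 * (1/2) ^ k" for k
      using g(3)[OF v(1)[OF x], of k k] unfolding v(2)[OF x] by (simp only: dist_commute)
    then have "(\<lambda>k. dist (g (v k x)) x) \<longlonglongrightarrow> 0" by (rule null[rotated]) (rule zero_le_dist)
    then have "(\<lambda>k. g (v k x)) \<longlonglongrightarrow> x" by (rule iffD2[OF tendsto_dist_iff])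
    ultimately show ?thesis by (rule LIMSEQ_unique)
  qed
  have ml: "m (l x) = x" if "x \<in> S" for x
    by (rule inverse[where g = m and f = l and u = ?i and v = s, OF m l(2,3) homeos_mem[OF s] inv_Homeo_left[OF s] that])
  have lm: "l (m x) = x" if "x \<in> S" for x
    by (rule inverse[where g = l and f = m and u = s and v = ?i, OF l m(2,3) homeos_mem[OF i] inv_Homeo_right[OF s] that])
  have L: "restrict l S \<in> homeos S"
  proof (rule homeosI_inverse[where g = m])
    show "continuous_on S (restrict l S)" by (rule continuous_on_eq[OF l(1)]) simp
  qed (use l(2) m ml lm in auto)
  have near: "sup_dist S (s k) (restrict l S) \<le> 2 * (1/2) ^ k" for k
    using l(3) by (subst sup_dist_le[OF s L]) auto
  have "\<exists>N. \<forall>k\<ge>N. sup_dist S (s k) (restrict l S) < e" if e: "e > 0" for e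
  proof -
    obtain N where "\<forall>k\<ge>N. 2 * (1/2::real) ^ k < e"
      using order_tendstoD(2)[OF lim e] unfolding eventually_sequentially by blast
    then show ?thesis using near le_less_trans by blast
  qed
  then show ?thesis using L by blast
qed

end

text \<open>By compactness finitely many pairs (b, c) of basic open sets with f mapping b into c
  determine f up to a uniform error. Picking one member of A for each satisfiable finite set of
  pairs gives a countable dense set inside A itself.\<close>

lemma homeos_separable:
  fixes S :: "'a::{metric_space, second_countable_topology} set"
  assumes S: "compact S" and A: "A \<subseteq> homeos S"
  shows "\<exists>Q\<subseteq>A. countable Q \<and> (\<forall>x\<in>A. \<forall>e>0. \<exists>q\<in>Q. sup_dist S x q < e)"
proof -
  obtain B :: "'a set set" where B: "countable B" "topological_basis B" using ex_countable_basis by blast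
  define ok where "ok F f \<longleftrightarrow> f \<in> A \<and> (\<forall>(b, c)\<in>F. f ` (b \<inter> S) \<subseteq> c)" for F f
  define \<F> where "\<F> = {F. finite F \<and> F \<subseteq> B \<times> B} \<inter> {F. \<exists>f. ok F f}"
  define sel where "sel F = (SOME f. ok F f)" for F
  have sel: "ok F (sel F)" if "F \<in> \<F>" for F using that unfolding sel_def \<F>_def by (metis (mono_tags, lifting) IntD2 mem_Collect_eq someI_ex)
  have "countable {F. finite F \<and> F \<subseteq> B \<times> B}" using B(1) by (intro countable_Collect_finite_subset countable_SIGMA)
  then have "countable \<F>" unfolding \<F>_def by (rule countable_subset[rotated]) auto
  then have "countable (sel ` \<F>)" by simp
  moreover have "sel ` \<F> \<subseteq> A" using sel by (auto simp: ok_def)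
  moreover have "\<exists>q\<in>sel ` \<F>. sup_dist S f q < e" if f: "f \<in> A" and e: "e > 0" for f e
  proof -
    have fh: "f \<in> homeos S" using f A by auto
    have "\<exists>b\<in>B. \<exists>c\<in>B. x \<in> b \<and> f ` (b \<inter> S) \<subseteq> c \<and> c \<subseteq> ball (f x) (e/6)" if x: "x \<in> S" for x
    proof -
      obtain c where c: "c \<in> B" "f x \<in> c" "c \<subseteq> ball (f x) (e/6)"
        by (rule topological_basisE[OF B(2), of "ball (f x) (e/6)" "f x"]) (use e in auto)
      have "open c" by (rule topological_basis_open[OF B(2) c(1)])
      then obtain W where W: "open W" "x \<in> W" "\<forall>y\<in>S. y \<in> W \<longrightarrow> f y \<in> c"
        using homeos_continuous[OF fh] x c(2) unfolding continuous_on_topological by blast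
      obtain b where "b \<in> B" "x \<in> b" "b \<subseteq> W" by (rule topological_basisE[OF B(2) W(1,2)])
      then show ?thesis using c W(3) by blast
    qed
    then obtain b c where bc: "\<And>x. x \<in> S \<Longrightarrow> b x \<in> B \<and> c x \<in> B \<and> x \<in> b x \<and> f ` (b x \<inter> S) \<subseteq> c x \<and> c x \<subseteq> ball (f x) (e/6)"
      by metis
    have ob: "open (b x)" if "x \<in> S" for x using topological_basis_open[OF B(2)] bc that by blast
    have cover: "S \<subseteq> (\<Union>x\<in>S. b x)" using bc by blast
    obtain D where D: "D \<subseteq> S" "finite D" "S \<subseteq> (\<Union>x\<in>D. b x)" by (rule compactE_image[OF S ob cover])
    define F where "F = (\<lambda>x. (b x, c x)) ` D"
    have "ok F f" using f bc D(1) by (fastforce simp: ok_def F_def)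
    moreover have "finite F" "F \<subseteq> B \<times> B" using D bc by (auto simp: F_def)
    ultimately have F: "F \<in> \<F>" by (auto simp: \<F>_def)
    then have q: "ok F (sel F)" by (rule sel)
    then have qh: "sel F \<in> homeos S" using A by (auto simp: ok_def)
    have "dist (f y) (sel F y) \<le> e/3" if y: "y \<in> S" for y
    proof -
      obtain x where x: "x \<in> D" "y \<in> b x" using D(3) y by blast
      have "f y \<in> c x" using bc x D(1) y by blast
      moreover have "sel F y \<in> c x" using q x y by (auto simp: ok_def F_def)
      ultimately have "f y \<in> ball (f x) (e/6)" "sel F y \<in> ball (f x) (e/6)" using bc x D(1) by blast+
      then have "dist (f x) (f y) < e/6" "dist (f x) (sel F y) < e/6" by simp_all
      then show ?thesis using dist_triangle3[of "f y" "sel F y" "f x"] by linarith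
    qed
    then have "sup_dist S f (sel F) \<le> e/3" using sup_dist_le[OF S fh qh, of "e/3"] e by simp
    then have "sup_dist S f (sel F) < e" using e by linarith
    moreover have "sel F \<in> sel ` \<F>" using F by (rule imageI)
    ultimately show ?thesis by (rule bexI)
  qed
  ultimately show ?thesis by (intro exI[of _ "sel ` \<F>"] conjI ballI allI impI)
qed

lemma metric_group_homeos:
  fixes S :: "'a::{metric_space, second_countable_topology} set"
  assumes S: "compact S" and U: "subgroup U (Homeo S)"
    and closed: "\<And>h. h \<in> homeos S \<Longrightarrow> (\<And>e. e > 0 \<Longrightarrow> \<exists>l\<in>U. sup_dist S h l < e) \<Longrightarrow> h \<in> U"
  shows "metric_group ((Homeo S)\<lparr>carrier := U\<rparr>) (sup_dist S)"
proof -
  let ?G = "(Homeo S)\<lparr>carrier := U\<rparr>"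
  have UH: "U \<subseteq> homeos S" using subgroup.subset[OF U] by simp
  have inv: "inv\<^bsub>?G\<^esub> f = inv\<^bsub>Homeo S\<^esub> f" if "f \<in> U" for f
    by (rule group.m_inv_consistent[OF group_Homeo U that])
  have g: "group ?G" by (rule group.subgroup_imp_group[OF group_Homeo U])
  have m: "Metric_space U (sup_dist S)" by (rule Metric_space.subspace[OF Metric_space_sup_dist[OF S] UH])
  interpret Metric_space U "sup_dist S" by (rule m)
  show ?thesis
  proof (intro metric_group.intro metric_group_axioms.intro)
    show "Metric_space (carrier ?G) (sup_dist S)" using m by simp
    show "sup_dist S (f \<otimes>\<^bsub>?G\<^esub> h) (g \<otimes>\<^bsub>?G\<^esub> h) = sup_dist S f g"
      if "f \<in> carrier ?G" "g \<in> carrier ?G" "h \<in> carrier ?G" for f g h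
      using sup_dist_right_inv[OF S] UH that by auto
    show "\<exists>\<delta>>0. \<forall>h\<in>carrier ?G. sup_dist S h \<one>\<^bsub>?G\<^esub> < \<delta> \<longrightarrow>
        sup_dist S (g \<otimes>\<^bsub>?G\<^esub> h) g < e"
      if "g \<in> carrier ?G" "e > 0" for g e
    proof -
      have "g \<in> homeos S" using that UH by auto
      from sup_dist_left_cont[OF S this that(2)] show ?thesis using UH by auto
    qed
    show "\<exists>Q\<subseteq>carrier ?G. countable Q \<and> (\<forall>x\<in>carrier ?G. \<forall>e>0. \<exists>q\<in>Q. sup_dist S x q < e)"
      using homeos_separable[OF S UH] by simp
    fix s :: "nat \<Rightarrow> 'a \<Rightarrow> 'a"
    assume s: "\<And>k. s k \<in> carrier ?G" "\<And>k. sup_dist S (s k) (s (Suc k)) < (1/2) ^ k"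
      "\<And>k. sup_dist S (inv\<^bsub>?G\<^esub> (s k)) (inv\<^bsub>?G\<^esub> (s (Suc k))) < (1/2) ^ k"
    have sU: "s k \<in> U" for k using s(1) by simp
    then have sH: "s k \<in> homeos S" for k using UH by blast
    obtain l where l: "l \<in> homeos S" "\<forall>e>0. \<exists>N. \<forall>k\<ge>N. sup_dist S (s k) l < e"
      using homeos_complete[OF S sH s(2)] s(3) inv[OF sU] by auto
    have "l \<in> U"
    proof (rule closed[OF l(1)])
      fix e :: real assume "e > 0"
      then obtain N where "sup_dist S (s N) l < e" using l(2) by blast
      then show "\<exists>u\<in>U. sup_dist S l u < e" using sU commute by metis
    qed
    then show "\<exists>l\<in>carrier ?G. \<forall>e>0. \<exists>N. \<forall>k\<ge>N. sup_dist S (s k) l < e" using l(2) by auto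
  qed (use g in auto)
qed

section \<open>Odd equivariant homeomorphisms of the line\<close>

text \<open>Places the piece \<open>q j\<close>, given on [0,1], on [j, j+1]. It carries three
  constructions: the periodic extension \<open>ext\<close>, the orbit parametrisation
  \<open>abel\<close>, and the piecewise affine map of \<open>tame_approx\<close>.\<close>

definition glue :: "(int \<Rightarrow> real \<Rightarrow> real) \<Rightarrow> real \<Rightarrow> real" where
  "glue q t = q \<lfloor>t\<rfloor> (t - of_int \<lfloor>t\<rfloor>)"

lemma glue_eq:
  assumes "\<And>j. q j 1 = q (j + 1) 0" "of_int j \<le> t" "t \<le> of_int j + 1"
  shows "glue q t = q j (t - of_int j)"
proof (cases "t = of_int j + 1")
  case True
  then have "\<lfloor>t\<rfloor> = j + 1" by simp
  then show ?thesis using True assms(1)[of j] by (simp add: glue_def)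
next
  case False
  then have "\<lfloor>t\<rfloor> = j" using assms by (simp add: floor_eq_iff)
  then show ?thesis by (simp add: glue_def)
qed

lemma increasing_int_seq:
  fixes c :: "int \<Rightarrow> real"
  assumes "\<And>j. c j \<le> c (j + 1)" "i \<le> j"
  shows "c i \<le> c j"
  using assms(2)
proof (induction j rule: int_ge_induct)
  case (step k) then show ?case using assms(1)[of k] by linarith
qed simp

lemma strict_mono_glue:
  assumes "\<And>j. q j 1 = q (j + 1) 0" "\<And>j. strict_mono_on {0..1} (q j)"
  shows "strict_mono (glue q)"
proof (rule strict_monoI)
  fix x y :: real assume xy: "x < y"
  define i j where "i = \<lfloor>x\<rfloor>" and "j = \<lfloor>y\<rfloor>"
  have ij: "i \<le> j" using xy by (simp add: i_def j_def floor_mono)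
  have fx: "0 \<le> x - of_int i" "x - of_int i < 1" "0 \<le> y - of_int j" "y - of_int j < 1"
    unfolding i_def j_def by linarith+
  have m0: "q k s < q k t" if "0 \<le> s" "s < t" "t \<le> 1" for k s t
    using strict_mono_onD[OF assms(2), of s t k] that by auto
  have gl: "glue q x = q i (x - of_int i)" "glue q y = q j (y - of_int j)"
    by (simp_all add: glue_def i_def j_def)
  show "glue q x < glue q y"
  proof (cases "i = j")
    case True
    have "q i (x - of_int i) < q i (y - of_int i)"
      using fx xy True by (intro m0) linarith+
    then show ?thesis by (simp only: gl True)
  next
    case False
    have "q k 0 \<le> q (k + 1) 0" for k using m0[of 0 1 k] assms(1)[of k] by simp
    moreover have "i + 1 \<le> j" using False ij by simp
    ultimately have "q (i + 1) 0 \<le> q j 0"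
      using increasing_int_seq[where c = "\<lambda>k. q k 0" and i = "i + 1" and j = j] by simp
    moreover have "q i (x - of_int i) < q (i + 1) 0" using m0[of "x - of_int i" 1 i] fx assms(1) by simp
    moreover have "q j 0 \<le> q j (y - of_int j)"
      using m0[of 0 "y - of_int j" j] fx by (cases "y - of_int j = 0") auto
    ultimately show ?thesis unfolding gl by linarith
  qed
qed

lemma glue_onto:
  assumes "q k ` {0..1} = {q k 0..q k 1}" "q k 0 \<le> y" "y \<le> q k 1" "\<And>j. q j 1 = q (j + 1) 0"
  shows "y \<in> glue q ` {of_int k..of_int k + 1}"
proof -
  obtain s where s: "0 \<le> s" "s \<le> 1" "q k s = y" using assms(1-3) by (force simp: image_def)
  have "glue q (of_int k + s) = y" using glue_eq[of q k "of_int k + s"] assms(4) s by auto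
  then show ?thesis using s by force
qed

lemma unbounded_int_seq_bracket:
  fixes c :: "int \<Rightarrow> real"
  assumes "\<And>j. c j \<le> c (j + 1)" "c i \<le> y" "y < c k"
  shows "\<exists>j. c j \<le> y \<and> y < c (j + 1)"
proof -
  define n where "n = (LEAST n::nat. y < c (i + int n))"
  have "i < k" using assms increasing_int_seq[of c k i] by force
  then have ex: "y < c (i + int (nat (k - i)))" using assms by simp
  have n1: "y < c (i + int n)" unfolding n_def by (rule LeastI, rule ex)
  then obtain m where m: "n = Suc m" using assms(2) by (cases n) auto
  have "\<not> y < c (i + int m)" using not_less_Least[of m "\<lambda>n. y < c (i + int n)"] m n_def by simp
  then show ?thesis using n1 m by (intro exI[of _ "i + int m"]) (auto simp: algebra_simps)
qed

text \<open>The distance to the nearest even integer, see \<open>fold1_le\<close> and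
  \<open>fold1_attained\<close>. In this form all tent maps come from one function, and the
  symmetries of the cosine give its invariance under u -> -u and u -> u + 2.\<close>

definition fold1 :: "real \<Rightarrow> real" where
  "fold1 u = arccos (cos (pi * u)) / pi"

lemma tent_eq_fold1: "tent d x = fold1 (real d * x)"
  by (simp add: tent_eq_arccos fold1_def)

lemma fold1_range: "0 \<le> fold1 u" "fold1 u \<le> 1"
  by (simp_all add: fold1_def arccos_lbound arccos_ubound)

lemma fold1_repr:
  obtains s :: real and j :: int where "s = 1 \<or> s = -1" "fold1 u = s * u + 2 * of_int j"
proof -
  have t: "fold1 u = tent 1 u" by (simp add: tent_eq_fold1)
  show ?thesis
  proof (cases "even \<lfloor>u\<rfloor>")
    case True
    then obtain k where "\<lfloor>u\<rfloor> = 2 * k" by (elim evenE)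
    then have "fold1 u = 1 * u + 2 * of_int (- k)" by (simp add: t tent_def)
    then show ?thesis using that by blast
  next
    case False
    then obtain k where "\<lfloor>u\<rfloor> = 2 * k + 1" by (elim oddE)
    then have "fold1 u = (-1) * u + 2 * of_int (k + 1)" by (simp add: t tent_def)
    then show ?thesis using that by blast
  qed
qed

lemma fold1_minus [simp]: "fold1 (- u) = fold1 u"
  by (simp add: fold1_def)

lemma fold1_period [simp]: "fold1 (u + 2 * of_int j) = fold1 u"
proof -
  have "cos (pi * (u + 2 * of_int j)) = cos (pi * u + 2 * pi * of_int j)"
    by (simp add: algebra_simps)
  also have "\<dots> = cos (pi * u)"
    by (simp only: cos_add cos_int_2pin sin_int_2pin mult_1_right mult_zero_right diff_zero)
  finally show ?thesis by (simp add: fold1_def)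
qed

lemma fold1_sym: "s = 1 \<or> s = -1 \<Longrightarrow> fold1 (s * u + 2 * of_int j) = fold1 u"
  using fold1_minus[of u] fold1_period[of "s * u" j] by auto

lemma fold1_abs: "fold1 \<bar>u\<bar> = fold1 u"
  by (simp add: abs_if)

lemma fold1_id: "0 \<le> u \<Longrightarrow> u \<le> 1 \<Longrightarrow> fold1 u = u"
  by (simp add: fold1_def arccos_cos mult_left_le)

lemma fold1_le: "fold1 u \<le> \<bar>u - 2 * of_int j\<bar>"
proof -
  have "fold1 u = fold1 \<bar>u - 2 * of_int j\<bar>"
    using fold1_period[of u "-j"] by (simp add: fold1_abs)
  also have "\<dots> \<le> \<bar>u - 2 * of_int j\<bar>"
    by (cases "\<bar>u - 2 * of_int j\<bar> \<le> 1") (use fold1_id fold1_range(2)[of "\<bar>u - 2 * of_int j\<bar>"] in auto)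
  finally show ?thesis .
qed

lemma fold1_attained: obtains j :: int where "fold1 u = \<bar>u - 2 * of_int j\<bar>"
proof -
  obtain s j where sj: "s = 1 \<or> s = -1" "fold1 u = s * u + 2 * of_int j" by (rule fold1_repr)
  then have "fold1 u = \<bar>u - 2 * of_int (- j)\<bar> \<or> fold1 u = \<bar>u - 2 * of_int j\<bar>"
    using fold1_range(1)[of u] by (auto simp: abs_if)
  then show ?thesis using that by blast
qed

lemma fold1_lipschitz: "\<bar>fold1 u - fold1 v\<bar> \<le> \<bar>u - v\<bar>"
proof -
  have *: "fold1 u \<le> fold1 v + \<bar>u - v\<bar>" for u v
  proof -
    obtain j where "fold1 v = \<bar>v - 2 * of_int j\<bar>" by (rule fold1_attained)
    then show ?thesis using fold1_le[of u j] by linarith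
  qed
  show ?thesis using *[of u v] *[of v u] by linarith
qed

text \<open>Multiplication by an integer d takes a symmetric copy s u + 2j of u to the symmetric
  copy s (d u) + 2 (d j) of d u. This law collapses compositions of tent maps into a single
  fold.\<close>

lemma fold1_mult_fold1: "fold1 (real d * fold1 u) = fold1 (real d * u)"
proof -
  obtain s j where sj: "s = 1 \<or> s = -1" "fold1 u = s * u + 2 * of_int j" by (rule fold1_repr)
  then have "real d * fold1 u = s * (real d * u) + 2 * of_int (int d * j)" by (simp add: algebra_simps)
  then show ?thesis by (simp only: fold1_sym[OF sj(1)])
qed

text \<open>An integer q is a turning point of \<open>fold1\<close>, and on either side the slope is
  of modulus one up to the next integer.\<close>

lemma fold1_near_int:
  assumes "\<bar>v - of_int q\<bar> \<le> 1"
  shows "\<bar>fold1 v - fold1 (of_int q)\<bar> = \<bar>v - of_int q\<bar>"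
proof -
  have p: "fold1 v = \<bar>v - of_int q\<bar>" if "even q" "\<bar>v - of_int q\<bar> \<le> 1" for v q
  proof -
    obtain k where k: "q = 2 * k" using \<open>even q\<close> by (elim evenE)
    have "fold1 v = fold1 (v + 2 * of_int (- k))" by (simp only: fold1_period)
    also have "\<dots> = fold1 \<bar>v - of_int q\<bar>" using k by (simp add: fold1_abs)
    finally show ?thesis using that fold1_id by simp
  qed
  show ?thesis
  proof (cases "even q")
    case True then show ?thesis using p[of q v] p[of q "of_int q"] assms by simp
  next
    case False
    then have e: "even (q + 1)" "even (q - 1)" by auto
    have "fold1 v = 1 - \<bar>v - of_int q\<bar>"
    proof (cases "v \<ge> of_int q")
      case True then show ?thesis using p[OF e(1), of v] assms by auto
    next
      case False then show ?thesis using p[OF e(2), of v] assms by auto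
    qed
    moreover have "fold1 (of_int q) = 1" using p[OF e(1), of "of_int q"] by simp
    ultimately show ?thesis by simp
  qed
qed

text \<open>Oddness and the translation law make f commute with the symmetries t -> s t + 2jA of
  \<open>fold1 (t / A)\<close>, see \<open>lifts_sym\<close>; such a map descends to [0, A].\<close>

definition lifts :: "real \<Rightarrow> (real \<Rightarrow> real) set" where
  "lifts A = {f. strict_mono f \<and> surj f \<and> (\<forall>t. f (- t) = - f t) \<and> (\<forall>t. f (t + 2 * A) = f t + 2 * A)}"

lemma lifts_mono: "f \<in> lifts A \<Longrightarrow> x < y \<Longrightarrow> f x < f y"
  by (simp add: lifts_def strict_mono_def)

lemma lifts_mono_le: "f \<in> lifts A \<Longrightarrow> x \<le> y \<Longrightarrow> f x \<le> f y"
  using lifts_mono[of f A x y] by (cases "x = y") auto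

lemma lifts_less_iff: "f \<in> lifts A \<Longrightarrow> f x < f y \<longleftrightarrow> x < y"
  by (auto simp: lifts_def strict_mono_less)

lemma lifts_bij: "f \<in> lifts A \<Longrightarrow> bij f"
  by (simp add: lifts_def bij_def strict_mono_imp_inj_on)

lemma lifts_minus: "f \<in> lifts A \<Longrightarrow> f (- t) = - f t"
  by (simp add: lifts_def)

lemma lifts_0 [simp]: "f \<in> lifts A \<Longrightarrow> f 0 = 0"
  using lifts_minus[of f A 0] by simp

lemma lifts_period1: "f \<in> lifts A \<Longrightarrow> f (t + 2 * A) = f t + 2 * A"
  by (simp add: lifts_def)

lemma lifts_period:
  assumes "f \<in> lifts A" shows "f (t + 2 * of_int j * A) = f t + 2 * of_int j * A"
proof -
  have p: "f (t + 2 * real n * A) = f t + 2 * real n * A" for n t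
  proof (induction n)
    case (Suc n)
    have "f (t + 2 * real (Suc n) * A) = f ((t + 2 * real n * A) + 2 * A)" by (simp add: algebra_simps)
    also have "\<dots> = f (t + 2 * real n * A) + 2 * A" by (rule lifts_period1[OF assms])
    finally show ?case using Suc by (simp add: algebra_simps)
  qed simp
  show ?thesis
  proof (cases "j \<ge> 0")
    case True then show ?thesis using p[of t "nat j"] by simp
  next
    case False
    then show ?thesis using p[of "t + 2 * of_int j * A" "nat (- j)"] by simp
  qed
qed

text \<open>The symmetries compose to the reflection t -> 2A - t, and f fixes its centre.\<close>

lemma lifts_self: assumes "f \<in> lifts A" shows "f A = A"
  using lifts_period1[OF assms, of "-A"] lifts_minus[OF assms, of A] by simp

lemma lifts_int: assumes "f \<in> lifts A" shows "f (of_int j * A) = of_int j * A"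
proof (cases "even j")
  case True
  then obtain k where "j = 2 * k" by (elim evenE)
  then show ?thesis using lifts_period[OF assms, of 0 k] assms by simp
next
  case False
  then obtain k where "j = 2 * k + 1" by (elim oddE)
  then show ?thesis using lifts_period[OF assms, of A k] lifts_self[OF assms] by (simp add: algebra_simps)
qed

lemma lifts_sym:
  assumes "f \<in> lifts A" "s = 1 \<or> s = -1"
  shows "f (s * t + 2 * of_int j * A) = s * f t + 2 * of_int j * A"
  using assms lifts_period[OF assms(1)] lifts_minus[OF assms(1)] by auto

text \<open>The inclusion by which a map of one level counts as a map of every deeper level.\<close>

lemma lifts_mult: assumes "f \<in> lifts A" shows "f \<in> lifts (real q * A)"
proof -
  have "f (t + 2 * (real q * A)) = f t + 2 * (real q * A)" for t
    using lifts_period[OF assms, of t "int q"] by (simp add: algebra_simps)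
  then show ?thesis using assms by (simp add: lifts_def)
qed

lemma lifts_continuous: assumes "f \<in> lifts A" shows "continuous_on S f"
proof -
  have "continuous_on UNIV f"
    using assms lifts_mono_le[OF assms] by (intro continuous_onI_mono) (auto simp: lifts_def)
  then show ?thesis by (rule continuous_on_subset) simp
qed

lemma lifts_id: "(\<lambda>x. x) \<in> lifts A"
  by (auto simp: lifts_def strict_mono_def)

lemma lifts_comp: "f \<in> lifts A \<Longrightarrow> g \<in> lifts A \<Longrightarrow> f \<circ> g \<in> lifts A"
  using comp_surj[of g f] by (auto simp: lifts_def strict_mono_def comp_def)

lemma lifts_inv: assumes "f \<in> lifts A" shows "inv_into UNIV f \<in> lifts A"
proof -
  have b: "bij f" by (rule lifts_bij[OF assms])
  have fi: "f (inv_into UNIV f x) = x" for x using b by (simp add: bij_is_surj surj_f_inv_f)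
  have if': "inv_into UNIV f (f x) = x" for x using b by (simp add: bij_is_inj)
  have "inv_into UNIV f x < inv_into UNIV f y" if "x < y" for x y
    using that fi lifts_less_iff[OF assms, of "inv_into UNIV f x" "inv_into UNIV f y"] by simp
  moreover have "inv_into UNIV f (- t) = - inv_into UNIV f t" for t
    by (metis fi if' lifts_minus[OF assms])
  moreover have "inv_into UNIV f (t + 2 * A) = inv_into UNIV f t + 2 * A" for t
    by (metis fi if' lifts_period1[OF assms])
  ultimately show ?thesis using b by (auto simp: lifts_def strict_mono_def bij_imp_bij_inv bij_is_surj)
qed

lemma period_reduce:
  fixes A :: real assumes "A > 0"
  obtains j :: int and y where "x = y + 2 * of_int j * A" "-A \<le> y" "y < A"
proof
  let ?j = "\<lfloor>(x + A) / (2 * A)\<rfloor>"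
  show "x = (x - 2 * of_int ?j * A) + 2 * of_int ?j * A" by simp
  have "of_int ?j \<le> (x + A) / (2 * A)" "(x + A) / (2 * A) < of_int ?j + 1" by linarith+
  then have "of_int ?j * (2 * A) \<le> x + A" "x + A < (of_int ?j + 1) * (2 * A)"
    using assms by (simp_all only: pos_le_divide_eq pos_divide_less_eq mult_pos_pos zero_less_numeral)
  then show "-A \<le> x - 2 * of_int ?j * A" "x - 2 * of_int ?j * A < A" by (simp_all add: algebra_simps)
qed

lemma lifts_uniformly_continuous:
  assumes "f \<in> lifts A" "A > 0" "e > 0"
  shows "\<exists>d>0. \<forall>x y. \<bar>x - y\<bar> \<le> d \<longrightarrow> \<bar>f x - f y\<bar> \<le> e"
proof -
  \<comment> \<open>The doubled interval leaves room for the partner of a point that has been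
    reduced to [-A, A).\<close>
  have "uniformly_continuous_on {-2*A..2*A} f"
    by (intro compact_uniformly_continuous lifts_continuous[OF assms(1)]) auto
  then obtain d where d: "d > 0" "\<And>x y. x \<in> {-2*A..2*A} \<Longrightarrow> y \<in> {-2*A..2*A} \<Longrightarrow> dist y x < d \<Longrightarrow> dist (f y) (f x) < e"
    using assms(3) unfolding uniformly_continuous_on_def by metis
  have "\<bar>f x - f y\<bar> \<le> e" if xy: "\<bar>x - y\<bar> \<le> min (d/2) A" for x y
  proof -
    obtain j x' where x': "x = x' + 2 * of_int j * A" "-A \<le> x'" "x' < A" by (rule period_reduce[OF assms(2)])
    define y' where "y' = y - 2 * of_int j * A"
    have "f x - f y = f x' - f y'"
      using lifts_period[OF assms(1), of x' j] lifts_period[OF assms(1), of y' j] x' by (simp add: y'_def)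
    moreover have "\<bar>x' - y'\<bar> \<le> min (d/2) A" using xy x'(1) by (simp add: y'_def algebra_simps)
    moreover have "dist (f x') (f y') < e" using d(1) calculation(2) x' assms(2) by (intro d(2)) (auto simp: dist_real_def)
    ultimately show ?thesis by (simp add: dist_real_def)
  qed
  then show ?thesis using d(1) assms(2) by (intro exI[of _ "min (d/2) A"]) auto
qed

section \<open>Order isomorphisms of compact intervals and their odd periodic extension\<close>

definition oiso :: "real \<Rightarrow> real \<Rightarrow> real \<Rightarrow> real \<Rightarrow> (real \<Rightarrow> real) \<Rightarrow> bool" where
  "oiso a b c d f \<longleftrightarrow> strict_mono_on {a..b} f \<and> f ` {a..b} = {c..d}"

lemma oiso_less: "oiso a b c d f \<Longrightarrow> a \<le> x \<Longrightarrow> x < y \<Longrightarrow> y \<le> b \<Longrightarrow> f x < f y"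
  unfolding oiso_def by (auto elim!: strict_mono_onD)

lemma oiso_mem: "oiso a b c d f \<Longrightarrow> a \<le> x \<Longrightarrow> x \<le> b \<Longrightarrow> c \<le> f x \<and> f x \<le> d"
  unfolding oiso_def by (metis atLeastAtMost_iff image_eqI)

lemma oiso_onto: "oiso a b c d f \<Longrightarrow> c \<le> y \<Longrightarrow> y \<le> d \<Longrightarrow> \<exists>x. a \<le> x \<and> x \<le> b \<and> f x = y"
  unfolding oiso_def by (metis atLeastAtMost_iff imageE)

lemma oisoI:
  assumes "\<And>x y. a \<le> x \<Longrightarrow> x < y \<Longrightarrow> y \<le> b \<Longrightarrow> f x < f y"
    "\<And>x. a \<le> x \<Longrightarrow> x \<le> b \<Longrightarrow> c \<le> f x \<and> f x \<le> d"
    "\<And>y. c \<le> y \<Longrightarrow> y \<le> d \<Longrightarrow> \<exists>x. a \<le> x \<and> x \<le> b \<and> f x = y"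
  shows "oiso a b c d f"
  unfolding oiso_def
proof
  show "strict_mono_on {a..b} f" by (rule strict_mono_onI) (use assms(1) in auto)
  show "f ` {a..b} = {c..d}" using assms(2,3) by fastforce
qed

lemma oiso_left: assumes "oiso a b c d f" "a \<le> b" shows "f a = c"
proof -
  have "c \<le> d" using oiso_mem[OF assms(1), of a] assms(2) by auto
  then obtain x where x: "a \<le> x" "x \<le> b" "f x = c" using oiso_onto[OF assms(1), of c] by auto
  then show ?thesis using oiso_less[OF assms(1), of a x] oiso_mem[OF assms(1), of a] assms(2)
    by (cases "x = a") auto
qed

lemma oiso_right: assumes "oiso a b c d f" "a \<le> b" shows "f b = d"
proof -
  have "c \<le> d" using oiso_mem[OF assms(1), of a] assms(2) by auto
  then obtain x where x: "a \<le> x" "x \<le> b" "f x = d" using oiso_onto[OF assms(1), of d] by auto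
  then show ?thesis using oiso_less[OF assms(1), of x b] oiso_mem[OF assms(1), of b] assms(2)
    by (cases "x = b") auto
qed

lemma oiso_comp: assumes "oiso a b c d f" "oiso c d p q g" shows "oiso a b p q (\<lambda>x. g (f x))"
proof (rule oisoI)
  show "g (f x) < g (f y)" if "a \<le> x" "x < y" "y \<le> b" for x y
    using oiso_less[OF assms(1) that] oiso_mem[OF assms(1), of x] oiso_mem[OF assms(1), of y] that
    by (intro oiso_less[OF assms(2)]) auto
  show "p \<le> g (f x) \<and> g (f x) \<le> q" if "a \<le> x" "x \<le> b" for x
    using oiso_mem[OF assms(1) that] by (intro oiso_mem[OF assms(2)]) auto
  show "\<exists>x\<ge>a. x \<le> b \<and> g (f x) = y" if "p \<le> y" "y \<le> q" for y
    using oiso_onto[OF assms(2) that] oiso_onto[OF assms(1)] by blast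
qed

lemma oiso_join:
  assumes "oiso a b c d f" "oiso b b' d d' g" "a \<le> b" "b \<le> b'"
  shows "oiso a b' c d' (\<lambda>x. if x \<le> b then f x else g x)"
proof (rule oisoI)
  have fb: "f b = d" "g b = d" using oiso_right[OF assms(1,3)] oiso_left[OF assms(2,4)] by auto
  note m1 = oiso_mem[OF assms(1)] and m2 = oiso_mem[OF assms(2)]
  show "(if x \<le> b then f x else g x) < (if y \<le> b then f y else g y)" if h: "a \<le> x" "x < y" "y \<le> b'" for x y
  proof -
    consider "y \<le> b" | "x \<le> b" "b < y" | "b < x" using h by linarith
    then show ?thesis
    proof cases
      case 2
      then show ?thesis using m1[of x] oiso_less[OF assms(2), of b y] h fb by auto
    qed (use h oiso_less[OF assms(1)] oiso_less[OF assms(2)] in auto)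
  qed
  show "c \<le> (if x \<le> b then f x else g x) \<and> (if x \<le> b then f x else g x) \<le> d'" if "a \<le> x" "x \<le> b'" for x
    using m1[of x] m2[of x] m1[of b] m2[of b] that assms(3,4) by auto
  show "\<exists>x\<ge>a. x \<le> b' \<and> (if x \<le> b then f x else g x) = y" if y: "c \<le> y" "y \<le> d'" for y
  proof (cases "y \<le> d")
    case True
    then obtain x where "a \<le> x" "x \<le> b" "f x = y" using oiso_onto[OF assms(1)] y by blast
    then show ?thesis using assms by (intro exI[of _ x]) auto
  next
    case False
    then obtain x where "b \<le> x" "x \<le> b'" "g x = y" using oiso_onto[OF assms(2), of y] y by auto
    moreover have "x \<noteq> b" using calculation fb False by auto
    ultimately show ?thesis using assms by (intro exI[of _ x]) auto
  qed
qed

lemma lifts_oiso: assumes "f \<in> lifts A" "f a = c" "f b = d" shows "oiso a b c d f"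
proof (rule oisoI)
  show "\<exists>x\<ge>a. x \<le> b \<and> f x = y" if "c \<le> y" "y \<le> d" for y
  proof -
    obtain x where x: "f x = y" using assms(1) by (metis lifts_bij bij_pointE)
    then show ?thesis using lifts_less_iff[OF assms(1), of x a] lifts_less_iff[OF assms(1), of b x] that assms
      by (intro exI[of _ x]) auto
  qed
qed (use assms lifts_mono lifts_mono_le in \<open>blast+\<close>)

definition aff :: "real \<Rightarrow> real \<Rightarrow> real \<Rightarrow> real \<Rightarrow> real \<Rightarrow> real" where
  "aff a b c d x = c + (x - a) * ((d - c) / (b - a))"

lemma aff_left [simp]: "aff a b c d a = c"
  and aff_right [simp]: "a \<noteq> b \<Longrightarrow> aff a b c d b = d"
  by (auto simp: aff_def)

lemma aff_less: "a < b \<Longrightarrow> c < d \<Longrightarrow> x < y \<Longrightarrow> aff a b c d x < aff a b c d y"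
  by (simp add: aff_def divide_strict_right_mono mult_strict_right_mono)

lemma aff_le: "a < b \<Longrightarrow> c < d \<Longrightarrow> x \<le> y \<Longrightarrow> aff a b c d x \<le> aff a b c d y"
  using aff_less[of a b c d x y] by (cases "x = y") auto

lemma aff_aff: "a < b \<Longrightarrow> c < d \<Longrightarrow> aff c d p q (aff a b c d x) = aff a b p q x"
  by (simp add: aff_def)

lemma aff_same: "a < b \<Longrightarrow> aff a b a b x = x"
  by (simp add: aff_def)

lemma oiso_aff: assumes "a < b" "c < d" shows "oiso a b c d (aff a b c d)"
proof (rule oisoI)
  show "\<exists>x\<ge>a. x \<le> b \<and> aff a b c d x = y" if "c \<le> y" "y \<le> d" for y
    using that aff_le[OF assms(2,1), of c y] aff_le[OF assms(2,1), of y d] assms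
    by (intro exI[of _ "aff c d a b y"]) (auto simp: aff_aff aff_same)
  show "c \<le> aff a b c d x \<and> aff a b c d x \<le> d" if "a \<le> x" "x \<le> b" for x
    using that aff_le[OF assms, of a x] aff_le[OF assms, of x b] assms by auto
qed (use assms aff_less in auto)

text \<open>At a fixed point of [a, b] the affine map is a convex combination of its two end
  values.\<close>

lemma aff_near:
  assumes "a < b" "a \<le> x" "x \<le> b" "\<bar>c - p\<bar> \<le> e" "\<bar>d - q\<bar> \<le> e"
  shows "\<bar>aff a b c d x - aff a b p q x\<bar> \<le> e"
proof -
  define l where "l = (x - a) / (b - a)"
  have l: "0 \<le> l" "l \<le> 1" using assms by (auto simp: l_def)
  have eq: "aff a b u v x = (1 - l) * u + l * v" for u v
    by (simp add: aff_def l_def diff_divide_distrib algebra_simps)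
  have "\<bar>aff a b c d x - aff a b p q x\<bar> = \<bar>(1 - l) * (c - p) + l * (d - q)\<bar>"
    by (simp add: eq algebra_simps)
  also have "\<dots> \<le> \<bar>(1 - l) * (c - p)\<bar> + \<bar>l * (d - q)\<bar>"
    by (rule abs_triangle_ineq)
  also have "\<dots> = (1 - l) * \<bar>c - p\<bar> + l * \<bar>d - q\<bar>"
    using l by (simp add: abs_mult)
  also have "\<dots> \<le> (1 - l) * e + l * e"
    using l assms by (intro add_mono mult_left_mono) auto
  finally show ?thesis by (simp add: algebra_simps)
qed

text \<open>Translates of g on the even intervals, half turns of g on the odd ones; both are forced
  by oddness and the period 2A.\<close>

definition ext_piece :: "real \<Rightarrow> (real \<Rightarrow> real) \<Rightarrow> int \<Rightarrow> real \<Rightarrow> real" where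
  "ext_piece A g m s = (if even m then of_int m * A + g (s * A) else (of_int m + 1) * A - g ((1 - s) * A))"

definition ext :: "real \<Rightarrow> (real \<Rightarrow> real) \<Rightarrow> real \<Rightarrow> real" where
  "ext A g x = glue (ext_piece A g) (x / A)"

context
  fixes A :: real and g :: "real \<Rightarrow> real"
  assumes A: "A > 0" and g: "oiso 0 A 0 A g"
begin

lemma ext_g0 [simp]: "g 0 = 0" "g A = A"
  using oiso_left[OF g] oiso_right[OF g] A by auto

lemma ext_piece_join: "ext_piece A g j 1 = ext_piece A g (j + 1) 0"
  by (auto simp: ext_piece_def algebra_simps)

lemma ext_eq:
  assumes "of_int m * A \<le> x" "x \<le> (of_int m + 1) * A"
  shows "ext A g x = (if even m then of_int m * A + g (x - of_int m * A)
    else (of_int m + 1) * A - g ((of_int m + 1) * A - x))"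
proof -
  have "ext A g x = ext_piece A g m (x / A - of_int m)"
    unfolding ext_def using assms A
    by (intro glue_eq ext_piece_join) (auto simp: pos_le_divide_eq pos_divide_le_eq)
  moreover have "(x / A - of_int m) * A = x - of_int m * A" "(1 - (x / A - of_int m)) * A = (of_int m + 1) * A - x"
    using A by (auto simp: algebra_simps)
  ultimately show ?thesis by (simp add: ext_piece_def)
qed

lemma ext_piece_exists: obtains m :: int where "of_int m * A \<le> x" "x \<le> (of_int m + 1) * A"
proof
  have "of_int \<lfloor>x / A\<rfloor> \<le> x / A" "x / A \<le> of_int \<lfloor>x / A\<rfloor> + 1" by linarith+
  then show "of_int \<lfloor>x / A\<rfloor> * A \<le> x" "x \<le> (of_int \<lfloor>x / A\<rfloor> + 1) * A"
    using A by (simp_all only: pos_le_divide_eq pos_divide_le_eq)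
qed

lemma ext_on: "0 \<le> x \<Longrightarrow> x \<le> A \<Longrightarrow> ext A g x = g x"
  using ext_eq[of 0 x] by simp

lemma ext_lifts: "ext A g \<in> lifts A"
proof -
  have sm: "strict_mono (glue (ext_piece A g))"
  proof (rule strict_mono_glue, rule ext_piece_join)
    fix j
    have lt: "g (s * A) < g (t * A)" if "0 \<le> s" "s < t" "t \<le> 1" for s t
      using that A by (intro oiso_less[OF g]) (auto simp: mult_left_le_one_le)
    show "strict_mono_on {0..1} (ext_piece A g j)"
    proof (rule strict_mono_onI)
      fix s t :: real assume "s \<in> {0..1}" "t \<in> {0..1}" "s < t"
      then show "ext_piece A g j s < ext_piece A g j t"
        using lt[of s t] lt[of "1 - t" "1 - s"] by (auto simp: ext_piece_def)
    qed
  qed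
  have m: "ext A g x < ext A g y" if "x < y" for x y
    using that strict_monoD[OF sm, of "x / A" "y / A"] A by (simp add: ext_def divide_strict_right_mono)
  have o: "ext A g (- x) = - ext A g x" for x
  proof -
    obtain m where m: "of_int m * A \<le> x" "x \<le> (of_int m + 1) * A" by (rule ext_piece_exists)
    show ?thesis using ext_eq[OF m] ext_eq[of "- m - 1" "- x"] m by (auto simp: algebra_simps)
  qed
  have p: "ext A g (x + 2 * A) = ext A g x + 2 * A" for x
  proof -
    obtain m where m: "of_int m * A \<le> x" "x \<le> (of_int m + 1) * A" by (rule ext_piece_exists)
    show ?thesis using ext_eq[OF m] ext_eq[of "m + 2" "x + 2 * A"] m by (auto simp: algebra_simps)
  qed
  have "\<exists>x. y = ext A g x" for y
  proof -
    obtain m where m: "of_int m * A \<le> y" "y \<le> (of_int m + 1) * A" by (rule ext_piece_exists)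
    show ?thesis
    proof (cases "even m")
      case True
      then obtain s where s: "0 \<le> s" "s \<le> A" "g s = y - of_int m * A"
        using oiso_onto[OF g, of "y - of_int m * A"] m by (auto simp: algebra_simps)
      then show ?thesis using ext_eq[of m "s + of_int m * A"] True by (intro exI[of _ "s + of_int m * A"]) (auto simp: algebra_simps)
    next
      case False
      then obtain s where s: "0 \<le> s" "s \<le> A" "g s = (of_int m + 1) * A - y"
        using oiso_onto[OF g, of "(of_int m + 1) * A - y"] m by (auto simp: algebra_simps)
      then show ?thesis using ext_eq[of m "(of_int m + 1) * A - s"] False by (intro exI[of _ "(of_int m + 1) * A - s"]) (auto simp: algebra_simps)
    qed
  qed
  then show ?thesis using m o p by (auto simp: lifts_def strict_mono_def surj_def)
qed

end

text \<open>[0, A] meets every orbit of the group generated by negation and translation by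
  2A.\<close>

lemma interval_reduce:
  fixes A :: real
  assumes A: "A > 0" and "\<And>x. 0 \<le> x \<Longrightarrow> x \<le> A \<Longrightarrow> Q x"
    "\<And>x. Q x \<Longrightarrow> Q (- x)" "\<And>x j. Q x \<Longrightarrow> Q (x + 2 * of_int j * A)"
  shows "Q x"
proof -
  obtain j y where y: "x = y + 2 * of_int j * A" "-A \<le> y" "y < A" by (rule period_reduce[OF A])
  have "Q y" using assms(2)[of y] assms(2)[of "- y"] assms(3)[of "- y"] y by (cases "y \<ge> 0") auto
  then show ?thesis using assms(4) y by simp
qed

lemma lifts_dist_reduce:
  assumes "A > 0" "f \<in> lifts A" "g \<in> lifts A" "\<And>x. 0 \<le> x \<Longrightarrow> x \<le> A \<Longrightarrow> \<bar>f x - g x\<bar> \<le> e"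
  shows "\<bar>f x - g x\<bar> \<le> e"
  by (rule interval_reduce[OF assms(1), where Q = "\<lambda>x. \<bar>f x - g x\<bar> \<le> e"])
       (use assms lifts_period[OF assms(2)] lifts_period[OF assms(3)] lifts_minus[OF assms(2)] lifts_minus[OF assms(3)] in auto)

lemma lifts_eqI:
  assumes "A > 0" "f \<in> lifts A" "g \<in> lifts A" "\<And>x. 0 \<le> x \<Longrightarrow> x \<le> A \<Longrightarrow> f x = g x"
  shows "f = g"
  using lifts_dist_reduce[OF assms(1-3), of 0] assms(4) by fastforce

section \<open>Approximate conjugacy on intervals\<close>

text \<open>The perturbed maps preserve the intervals, so pieces with common end points can be
  joined. Separate intervals are allowed for the two maps because their fixed points, where the
  pieces end, differ.\<close>

definition conj_on :: "real \<Rightarrow> real \<Rightarrow> (real \<Rightarrow> real) \<Rightarrow> (real \<Rightarrow> real) \<Rightarrow> real \<Rightarrow> real \<Rightarrow> real \<Rightarrow> real \<Rightarrow> bool" where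
  "conj_on \<eta> \<epsilon> g1 g2 a1 b1 a2 b2 \<longleftrightarrow> (\<exists>G1 G2 H.
     oiso a1 b1 a1 b1 G1 \<and> oiso a2 b2 a2 b2 G2 \<and> oiso a1 b1 a2 b2 H \<and>
     (\<forall>x\<in>{a1..b1}. H (G1 x) = G2 (H x) \<and> \<bar>H x - x\<bar> \<le> \<epsilon> \<and> \<bar>G1 x - g1 x\<bar> \<le> \<eta>) \<and>
     (\<forall>y\<in>{a2..b2}. \<bar>G2 y - g2 y\<bar> \<le> \<eta>))"

lemma conj_on_join:
  assumes "conj_on \<eta> \<epsilon> g1 g2 a1 b1 a2 b2" "conj_on \<eta> \<epsilon> g1 g2 b1 c1 b2 c2"
    and le: "a1 \<le> b1" "b1 \<le> c1" "a2 \<le> b2" "b2 \<le> c2"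
  shows "conj_on \<eta> \<epsilon> g1 g2 a1 c1 a2 c2"
proof -
  obtain G1 G2 H where G: "oiso a1 b1 a1 b1 G1" "oiso a2 b2 a2 b2 G2" "oiso a1 b1 a2 b2 H"
    "\<And>x. x\<in>{a1..b1} \<Longrightarrow> H (G1 x) = G2 (H x) \<and> \<bar>H x - x\<bar> \<le> \<epsilon> \<and> \<bar>G1 x - g1 x\<bar> \<le> \<eta>"
    "\<And>y. y\<in>{a2..b2} \<Longrightarrow> \<bar>G2 y - g2 y\<bar> \<le> \<eta>"
    using assms(1) unfolding conj_on_def by blast
  obtain G1' G2' H' where G': "oiso b1 c1 b1 c1 G1'" "oiso b2 c2 b2 c2 G2'" "oiso b1 c1 b2 c2 H'"
    "\<And>x. x\<in>{b1..c1} \<Longrightarrow> H' (G1' x) = G2' (H' x) \<and> \<bar>H' x - x\<bar> \<le> \<epsilon> \<and> \<bar>G1' x - g1 x\<bar> \<le> \<eta>"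
    "\<And>y. y\<in>{b2..c2} \<Longrightarrow> \<bar>G2' y - g2 y\<bar> \<le> \<eta>"
    using assms(2) unfolding conj_on_def by blast
  let ?K1 = "\<lambda>x. if x \<le> b1 then G1 x else G1' x"
  let ?K2 = "\<lambda>x. if x \<le> b2 then G2 x else G2' x"
  let ?L = "\<lambda>x. if x \<le> b1 then H x else H' x"
  have j: "oiso a1 c1 a1 c1 ?K1" "oiso a2 c2 a2 c2 ?K2" "oiso a1 c1 a2 c2 ?L"
    using oiso_join[OF G(1) G'(1)] oiso_join[OF G(2) G'(2)] oiso_join[OF G(3) G'(3)] le by auto
  have c: "?L (?K1 x) = ?K2 (?L x)" if x: "x \<in> {a1..c1}" for x
  proof (cases "x \<le> b1")
    case True
    then have "G1 x \<le> b1" "H x \<le> b2" using x oiso_mem[OF G(1)] oiso_mem[OF G(3)] by auto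
    then show ?thesis using True x G(4)[of x] by auto
  next
    case False
    have "G1' b1 = b1" "H' b1 = b2" using oiso_left[OF G'(1)] oiso_left[OF G'(3)] le by auto
    then have "G1' x > b1" "H' x > b2" using x False oiso_less[OF G'(1), of b1 x] oiso_less[OF G'(3), of b1 x] by auto
    then show ?thesis using False x G'(4)[of x] by auto
  qed
  show ?thesis unfolding conj_on_def
    by (intro exI[of _ ?K1] exI[of _ ?K2] exI[of _ ?L] conjI ballI j c) (use G(4,5) G'(4,5) in auto)
qed

text \<open>Both perturbed maps are affine copies of one model g, so the affine map between the
  intervals conjugates them exactly; what remains to be checked is closeness.\<close>

lemma conj_on_copies:
  assumes g: "oiso a b a b g" "a < b" and c: "c1 < d1" "c2 < d2"
    and H: "\<And>x. c1 \<le> x \<Longrightarrow> x \<le> d1 \<Longrightarrow> \<bar>aff c1 d1 c2 d2 x - x\<bar> \<le> \<epsilon>"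
    and G1: "\<And>x. c1 \<le> x \<Longrightarrow> x \<le> d1 \<Longrightarrow> \<bar>aff a b c1 d1 (g (aff c1 d1 a b x)) - g1 x\<bar> \<le> \<eta>"
    and G2: "\<And>x. c2 \<le> x \<Longrightarrow> x \<le> d2 \<Longrightarrow> \<bar>aff a b c2 d2 (g (aff c2 d2 a b x)) - g2 x\<bar> \<le> \<eta>"
  shows "conj_on \<eta> \<epsilon> g1 g2 c1 d1 c2 d2"
  unfolding conj_on_def
proof (intro exI conjI ballI)
  show "oiso c1 d1 c1 d1 (\<lambda>x. aff a b c1 d1 (g (aff c1 d1 a b x)))"
    using oiso_comp[OF oiso_aff[OF c(1) g(2)] oiso_comp[OF g(1) oiso_aff[OF g(2) c(1)]]] .
  show "oiso c2 d2 c2 d2 (\<lambda>x. aff a b c2 d2 (g (aff c2 d2 a b x)))"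
    using oiso_comp[OF oiso_aff[OF c(2) g(2)] oiso_comp[OF g(1) oiso_aff[OF g(2) c(2)]]] .
  show "oiso c1 d1 c2 d2 (aff c1 d1 c2 d2)" by (rule oiso_aff[OF c])
qed (use assms in \<open>auto simp: aff_aff\<close>)

text \<open>When [c, d] almost fills [a, b], rescaling moves points by at most t before and after g;
  the first error passes through g and costs e.\<close>

lemma copy_near:
  assumes ab: "a < b" and cd: "c < d" and x: "c \<le> x" "x \<le> d" and g: "oiso a b a b g"
    and c: "\<bar>c - a\<bar> \<le> t" "\<bar>d - b\<bar> \<le> t" and sub: "a \<le> c" "d \<le> b"
    and uc: "\<And>x y. a \<le> x \<Longrightarrow> x \<le> b \<Longrightarrow> a \<le> y \<Longrightarrow> y \<le> b \<Longrightarrow> \<bar>x - y\<bar> \<le> t \<Longrightarrow> \<bar>g x - g y\<bar> \<le> e"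
  shows "\<bar>aff a b c d (g (aff c d a b x)) - g x\<bar> \<le> t + e"
proof -
  let ?y = "aff c d a b x"
  have y: "a \<le> ?y" "?y \<le> b" using oiso_mem[OF oiso_aff[OF cd ab] x] by auto
  have gy: "a \<le> g ?y" "g ?y \<le> b" using oiso_mem[OF g y] by auto
  have "\<bar>aff a b c d (g ?y) - aff a b a b (g ?y)\<bar> \<le> t"
    using c gy ab by (intro aff_near) auto
  moreover have "\<bar>aff c d a b x - aff c d c d x\<bar> \<le> t"
    using c cd x by (intro aff_near) auto
  then have "\<bar>g ?y - g x\<bar> \<le> e" using y x sub cd by (intro uc) (auto simp: aff_same)
  ultimately show ?thesis using ab by (simp add: aff_same)
qed

text \<open>A map that preserves a short interval moves its points by at most the length, whatever
  it does inside.\<close>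

lemma copy_small:
  assumes ab: "a < b" and cd: "c < d" and x: "c \<le> x" "x \<le> d" and g: "oiso a b a b g"
    and c: "d - c \<le> t" and k: "\<bar>k x - x\<bar> \<le> e"
  shows "\<bar>aff a b c d (g (aff c d a b x)) - k x\<bar> \<le> t + e"
proof -
  have "c \<le> aff a b c d (g (aff c d a b x)) \<and> aff a b c d (g (aff c d a b x)) \<le> d"
    using oiso_mem[OF oiso_comp[OF oiso_aff[OF cd ab] oiso_comp[OF g oiso_aff[OF ab cd]]] x] .
  then show ?thesis using x c k by linarith
qed

text \<open>A small copy of each map is inserted at an end of the other one.\<close>

lemma conj_on_insert:
  assumes f1: "f1 \<in> lifts A" and f2: "f2 \<in> lifts A" and A: "A > 0"
    and fx: "f1 a1 = a1" "f1 b1 = b1" "f2 a2 = a2" "f2 b2 = b2" "a1 < b1" "a2 < b2"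
    and lr: "l \<le> a1" "l \<le> a2" "b1 \<le> r" "b2 \<le> r" "r - l \<le> \<epsilon>" and \<eta>: "\<eta> > 0"
  shows "conj_on \<eta> \<epsilon> f1 f2 a1 b1 a2 b2"
proof -
  obtain t1 where t1: "t1 > 0" "\<And>x y. \<bar>x - y\<bar> \<le> t1 \<Longrightarrow> \<bar>f1 x - f1 y\<bar> \<le> \<eta>/3"
    using lifts_uniformly_continuous[OF f1 A, of "\<eta>/3"] \<eta> by auto
  obtain t2 where t2: "t2 > 0" "\<And>x y. \<bar>x - y\<bar> \<le> t2 \<Longrightarrow> \<bar>f2 x - f2 y\<bar> \<le> \<eta>/3"
    using lifts_uniformly_continuous[OF f2 A, of "\<eta>/3"] \<eta> by auto
  define t where "t = min (min t1 t2) (min (\<eta>/3) (min ((b1 - a1)/2) ((b2 - a2)/2)))"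
  have t: "t > 0" using t1(1) t2(1) \<eta> fx(5,6) by (simp add: t_def)
  have t': "t \<le> t1" "t \<le> t2" "t \<le> \<eta>/3" "t \<le> (b1 - a1)/2" "t \<le> (b2 - a2)/2"
    unfolding t_def by (blast intro: min.coboundedI1 min.coboundedI2 order_refl)+
  note t = t t'
  have o1: "oiso a1 b1 a1 b1 f1" and o2: "oiso a2 b2 a2 b2 f2"
    using lifts_oiso[OF f1] lifts_oiso[OF f2] fx by auto
  have H: "\<bar>aff c1 d1 c2 d2 x - x\<bar> \<le> \<epsilon>"
    if "c1 \<le> x" "x \<le> d1" "c1 < d1" "c2 < d2" "l \<le> c1" "l \<le> c2" "d1 \<le> r" "d2 \<le> r" for c1 d1 c2 d2 x
    using oiso_mem[OF oiso_aff[of c1 d1 c2 d2], of x] that lr by auto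
  \<comment> \<open>The model is f1: almost full size for the first map, a tiny copy at the left end
    for the second. The tiny copy is harmless because f2 is close to the identity near its fixed
    point a2.\<close>
  have "conj_on \<eta> \<epsilon> f1 f2 a1 (b1 - t) a2 (a2 + t)"
  proof (rule conj_on_copies[OF o1 fx(5)])
    fix x
    show "\<bar>aff a1 b1 a1 (b1 - t) (f1 (aff a1 (b1 - t) a1 b1 x)) - f1 x\<bar> \<le> \<eta>" if "a1 \<le> x" "x \<le> b1 - t"
      using copy_near[of a1 b1 a1 "b1 - t" x f1 t "\<eta>/3"] that t fx o1 t1(2) by force
    show "\<bar>aff a1 b1 a2 (a2 + t) (f1 (aff a2 (a2 + t) a1 b1 x)) - f2 x\<bar> \<le> \<eta>" if "a2 \<le> x" "x \<le> a2 + t"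
    proof -
      have "\<bar>f2 x - x\<bar> \<le> \<eta>/3 + \<eta>/3" using t2(2)[of x a2] that t fx(3) by linarith
      then show ?thesis using copy_small[of a1 b1 a2 "a2 + t" x f1 t f2 "\<eta>/3 + \<eta>/3"] that t fx o1 by force
    qed
  qed (use t fx lr in \<open>auto intro!: H\<close>)
  \<comment> \<open>Now the model is f2, and the tiny copy sits at the right end of the first
    interval.\<close>
  moreover have "conj_on \<eta> \<epsilon> f1 f2 (b1 - t) b1 (a2 + t) b2"
  proof (rule conj_on_copies[OF o2 fx(6)])
    fix x
    show "\<bar>aff a2 b2 (a2 + t) b2 (f2 (aff (a2 + t) b2 a2 b2 x)) - f2 x\<bar> \<le> \<eta>" if "a2 + t \<le> x" "x \<le> b2"
      using copy_near[of a2 b2 "a2 + t" b2 x f2 t "\<eta>/3"] that t fx o2 t2(2) by force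
    show "\<bar>aff a2 b2 (b1 - t) b1 (f2 (aff (b1 - t) b1 a2 b2 x)) - f1 x\<bar> \<le> \<eta>" if "b1 - t \<le> x" "x \<le> b1"
    proof -
      have "\<bar>f1 x - x\<bar> \<le> \<eta>/3 + \<eta>/3" using t1(2)[of x b1] that t fx(2) by linarith
      then show ?thesis using copy_small[of a2 b2 "b1 - t" b1 x f2 t f1 "\<eta>/3 + \<eta>/3"] that t fx o2 by force
    qed
  qed (use t fx lr in \<open>auto intro!: H\<close>)
  ultimately show ?thesis by (rule conj_on_join) (use t fx in auto)
qed

section \<open>Orbits in intervals without fixed points\<close>

lemma iterates_escape_up:
  assumes f: "f \<in> lifts A" and fa: "f a = a" and up: "\<And>x. u < x \<Longrightarrow> x < a \<Longrightarrow> x < f x"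
    and s: "u < s" "s < a" and y: "y < a"
  shows "\<exists>n. y < (f ^^ n) s"
proof (rule ccontr)
  assume "\<not> ?thesis"
  then have le: "(f ^^ n) s \<le> y" for n by (simp add: not_less)
  \<comment> \<open>The preimage z of L lies below L, so some iterate exceeds z and the next one
    exceeds L.\<close>
  define L where "L = (SUP n. (f ^^ n) s)"
  have bdd: "bdd_above (range (\<lambda>n. (f ^^ n) s))" using le by (intro bdd_aboveI[of _ y]) auto
  have L: "(f ^^ n) s \<le> L" for n unfolding L_def by (rule cSUP_upper[OF _ bdd]) simp
  have "L \<le> y" unfolding L_def by (rule cSUP_least) (use le in auto)
  then have Lu: "u < L" "L < a" using L[of 0] s y by auto
  obtain z where z: "f z = L" using lifts_bij[OF f] by (metis bij_pointE)
  have "z < L" using up[OF Lu] lifts_less_iff[OF f, of z L] z by simp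
  then obtain n where "z < (f ^^ n) s" unfolding L_def using less_cSUP_iff[OF _ bdd, of z] by auto
  then have "L < (f ^^ Suc n) s" using lifts_mono[OF f] z by fastforce
  then show False using L[of "Suc n"] by simp
qed

definition iterate :: "(real \<Rightarrow> real) \<Rightarrow> int \<Rightarrow> real \<Rightarrow> real" where
  "iterate f k x = (if k \<ge> 0 then (f ^^ nat k) x else (inv_into UNIV f ^^ nat (- k)) x)"

lemma iterate_0 [simp]: "iterate f 0 x = x" by (simp add: iterate_def)

lemma iterate_add1: assumes "bij f" shows "iterate f (k + 1) x = f (iterate f k x)"
proof -
  have fi: "f (inv_into UNIV f x) = x" for x using assms by (simp add: bij_is_surj surj_f_inv_f)
  consider "k \<ge> 0" | "k = -1" | "k < -1" by linarith
  then show ?thesis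
  proof cases
    case 1 then show ?thesis by (simp add: iterate_def nat_add_distrib)
  next
    case 2 then show ?thesis by (simp add: iterate_def fi)
  next
    case 3
    then have "nat (- k) = Suc (nat (- (k + 1)))" by simp
    then show ?thesis using 3 fi by (simp add: iterate_def)
  qed
qed

lemma lifts_funpow: "f \<in> lifts A \<Longrightarrow> f ^^ n \<in> lifts A"
proof (induction n)
  case 0
  have "f ^^ 0 = (\<lambda>x. x)" by auto
  then show ?case using lifts_id by metis
next
  case (Suc n)
  then show ?case using lifts_comp[of f A "f ^^ n"] by (simp add: comp_def)
qed

lemma lifts_iterate: assumes "f \<in> lifts A" shows "iterate f k \<in> lifts A"
proof (cases "k \<ge> 0")
  case True
  then have "iterate f k = f ^^ nat k" by (auto simp: iterate_def)
  then show ?thesis using lifts_funpow[OF assms] by metis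
next
  case False
  then have "iterate f k = inv_into UNIV f ^^ nat (- k)" by (auto simp: iterate_def)
  then show ?thesis using lifts_funpow[OF lifts_inv[OF assms]] by metis
qed

lemma lifts_inv_below:
  assumes f: "f \<in> lifts A" and up: "\<And>x. u < x \<Longrightarrow> x < a \<Longrightarrow> x < f x" and fx: "f u = u" "f a = a"
    and x: "u < x" "x < a"
  shows "inv_into UNIV f x < x \<and> u < inv_into UNIV f x"
proof -
  have fi: "f (inv_into UNIV f x) = x" using lifts_bij[OF f] by (simp add: bij_is_surj surj_f_inv_f)
  show ?thesis using lifts_less_iff[OF f, of "inv_into UNIV f x" x] lifts_less_iff[OF f, of u "inv_into UNIV f x"] up[OF x] fi fx x by simp
qed

text \<open>The inverse of f is odd and moves the points between -a and -u up, so the upward version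
  applies to it after reflection.\<close>

lemma iterates_escape_down:
  assumes f: "f \<in> lifts A" and fx: "f u = u" "f a = a" and up: "\<And>x. u < x \<Longrightarrow> x < a \<Longrightarrow> x < f x"
    and s: "u < s" "s < a" and y: "u < y"
  shows "\<exists>n. (inv_into UNIV f ^^ n) s < y"
proof -
  let ?i = "inv_into UNIV f"
  have i: "?i \<in> lifts A" by (rule lifts_inv[OF f])
  have fi: "?i (f x) = x" for x using lifts_bij[OF f] by (simp add: bij_is_inj)
  have iu: "?i (- (- u)) = u" using fi[of u] fx by simp
  have "x < ?i x" if "- a < x" "x < - u" for x
    using lifts_inv_below[OF f up fx, of "- x"] lifts_minus[OF i, of x] that by simp
  moreover have "?i (- u) = - u" using lifts_minus[OF i, of u] iu by simp
  ultimately obtain n where "- y < (?i ^^ n) (- s)"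
    using iterates_escape_up[OF i, of "- u" "- a" "- s" "- y"] s y by auto
  moreover have "(?i ^^ n) (- s) = - (?i ^^ n) s" by (induction n) (auto simp: lifts_minus[OF i])
  ultimately show ?thesis by (intro exI[of _ n]) simp
qed

text \<open>The inverse of an Abel coordinate: affine from [0,1] onto the fundamental domain
  [s, f s] and continued by iterates, so that adding 1 to the parameter amounts to applying f, see
  \<open>abel_add1\<close>. Two such parametrisations compose to a conjugacy.\<close>

definition abel :: "(real \<Rightarrow> real) \<Rightarrow> real \<Rightarrow> real \<Rightarrow> real" where
  "abel f s = glue (\<lambda>k t. iterate f k (s + t * (f s - s)))"

context
  fixes f :: "real \<Rightarrow> real" and A u a s :: real
  assumes f: "f \<in> lifts A" and fx: "f u = u" "f a = a" and up: "\<And>x. u < x \<Longrightarrow> x < a \<Longrightarrow> x < f x"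
    and s: "u < s" "s < a"
begin

lemma abel_join: "iterate f k (s + 1 * (f s - s)) = iterate f (k + 1) (s + 0 * (f s - s))"
proof -
  have "iterate f k (f s) = f (iterate f k s)" for k
  proof (induction k rule: int_induct[where k = 0])
    case base then show ?case by simp
  next
    case (step1 i) then show ?case by (simp add: iterate_add1[OF lifts_bij[OF f]])
  next
    case (step2 i)
    have "f (iterate f (i - 1) (f s)) = f (f (iterate f (i - 1) s))"
      using step2 iterate_add1[OF lifts_bij[OF f], of "i - 1"] by simp
    then show ?case using lifts_bij[OF f] by (simp add: bij_is_inj inj_eq)
  qed
  then show ?thesis by (simp add: iterate_add1[OF lifts_bij[OF f]])
qed

lemma abel_strict_mono: "strict_mono (abel f s)"
  unfolding abel_def
proof (rule strict_mono_glue, rule abel_join)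
  show "strict_mono_on {0..1} (\<lambda>t. iterate f k (s + t * (f s - s)))" for k
    using up[OF s] by (intro strict_mono_onI lifts_mono[OF lifts_iterate[OF f]]) (auto intro: mult_strict_right_mono)
qed

lemma abel_at: "of_int k \<le> t \<Longrightarrow> t \<le> of_int k + 1 \<Longrightarrow> abel f s t = iterate f k (s + (t - of_int k) * (f s - s))"
  unfolding abel_def using abel_join by (intro glue_eq) auto

lemma abel_add1: "abel f s (t + 1) = f (abel f s t)"
proof -
  have "of_int \<lfloor>t\<rfloor> \<le> t" "t \<le> of_int \<lfloor>t\<rfloor> + 1" by linarith+
  then show ?thesis using abel_at[of "\<lfloor>t\<rfloor>" t] abel_at[of "\<lfloor>t\<rfloor> + 1" "t + 1"]
    iterate_add1[OF lifts_bij[OF f], of "\<lfloor>t\<rfloor>"] by (simp add: add.commute)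
qed

lemma abel_of_nat: "abel f s (real n) = (f ^^ n) s"
  using abel_at[of "int n" "real n"] by (simp add: iterate_def)

text \<open>The orbit of s escapes in both directions, so y lies between two consecutive iterates,
  that is, in a translate of the fundamental domain.\<close>

lemma abel_onto: assumes y: "u < y" "y < a" shows "y \<in> range (abel f s)"
proof -
  obtain n where n: "y < (f ^^ n) s" using iterates_escape_up[OF f fx(2) up s y(2)] by auto
  obtain m where m: "(inv_into UNIV f ^^ m) s < y" using iterates_escape_down[OF f fx up s y(1)] by auto
  define c where "c k = iterate f k (s + 0 * (f s - s))" for k
  have "f s > s" using up[OF s] .
  then have "c j \<le> c (j + 1)" for j
    using lifts_mono[OF lifts_iterate[OF f], of s "f s" j] abel_join[of j] by (simp add: c_def)
  moreover have "c (- int m) \<le> y" "y < c (int n)" using n m by (auto simp: c_def iterate_def)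
  ultimately obtain j where j: "c j \<le> y" "y < c (j + 1)" using unbounded_int_seq_bracket[of c "- int m" y "int n"] by auto
  have img: "(\<lambda>t. s + t * (f s - s)) ` {0..1} = {s..f s}"
  proof -
    have "oiso 0 1 s (f s) (aff 0 1 s (f s))" by (rule oiso_aff) (use up[OF s] in auto)
    then show ?thesis by (simp add: oiso_def aff_def)
  qed
  have it: "iterate f k ` {p..q} = {iterate f k p..iterate f k q}" for k p q
  proof -
    show ?thesis using lifts_oiso[OF lifts_iterate[OF f, of k], of p "iterate f k p" q "iterate f k q"] by (simp add: oiso_def)
  qed
  have "y \<in> glue (\<lambda>k t. iterate f k (s + t * (f s - s))) ` {of_int j..of_int j + 1}"
  proof (rule glue_onto)
    show "(\<lambda>t. iterate f j (s + t * (f s - s))) ` {0..1} = {iterate f j (s + 0 * (f s - s))..iterate f j (s + 1 * (f s - s))}"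
      using img it[of j s "f s"] by (simp add: image_image[of "iterate f j" "\<lambda>t. s + t * (f s - s)", symmetric])
  qed (use j abel_join[of j] abel_join in \<open>auto simp: c_def\<close>)
  then show ?thesis by (auto simp: abel_def)
qed

lemma abel_range: "u < abel f s t \<and> abel f s t < a"
proof -
  define k where "k = \<lfloor>t\<rfloor>"
  have k: "of_int k \<le> t" "t \<le> of_int k + 1" unfolding k_def by linarith+
  have fs: "s < f s" "f s < a" using up[OF s] lifts_mono[OF f s(2)] fx by auto
  have "0 \<le> (t - of_int k) * (f s - s)" using k fs by (intro mult_nonneg_nonneg) auto
  moreover have "(t - of_int k) * (f s - s) \<le> f s - s"
    using k fs by (intro mult_left_le_one_le) auto
  ultimately have "s \<le> s + (t - of_int k) * (f s - s)" "s + (t - of_int k) * (f s - s) \<le> f s"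
    by linarith+
  then have p: "u < s + (t - of_int k) * (f s - s)" "s + (t - of_int k) * (f s - s) < a" using fs s by auto
  have *: "(g ^^ n) p = p" if "g p = p" for g :: "real \<Rightarrow> real" and n p by (induction n) (use that in auto)
  have fi: "inv_into UNIV f (f x) = x" for x using lifts_bij[OF f] by (simp add: bij_is_inj)
  have "iterate f k u = u" "iterate f k a = a"
    using *[of f u] *[of f a] *[of "inv_into UNIV f" u] *[of "inv_into UNIV f" a] fi[of u] fi[of a] fx by (auto simp: iterate_def)
  then show ?thesis using abel_at[OF k] lifts_mono[OF lifts_iterate[OF f] p(1), of k] lifts_mono[OF lifts_iterate[OF f] p(2), of k] by simp
qed

end

text \<open>Only the modulus of continuity of f is used, so one \<delta> serves all g1 and g2 near
  f, regardless of their period.\<close>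

lemma iterates_shadow:
  assumes f: "f \<in> lifts A" "A > 0" and e: "\<epsilon> > 0"
  shows "\<exists>\<delta>>0. \<forall>g1 g2 x y. (\<forall>z. \<bar>g1 z - f z\<bar> \<le> \<delta>) \<longrightarrow> (\<forall>z. \<bar>g2 z - f z\<bar> \<le> \<delta>) \<longrightarrow> \<bar>x - y\<bar> \<le> 2 * \<delta> \<longrightarrow>
    (\<forall>k\<le>m. \<bar>(g1 ^^ k) x - (g2 ^^ k) y\<bar> \<le> \<epsilon>)"
  using e
proof (induction m arbitrary: \<epsilon>)
  case 0
  then show ?case by (intro exI[of _ "\<epsilon>/2"]) auto
next
  case (Suc m)
  obtain r where r: "r > 0" "\<And>x y. \<bar>x - y\<bar> \<le> r \<Longrightarrow> \<bar>f x - f y\<bar> \<le> \<epsilon>/2"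
    using lifts_uniformly_continuous[OF f, of "\<epsilon>/2"] Suc.prems by auto
  obtain d where d: "d > 0" "\<And>g1 g2 x y k. (\<forall>z. \<bar>g1 z - f z\<bar> \<le> d) \<Longrightarrow> (\<forall>z. \<bar>g2 z - f z\<bar> \<le> d) \<Longrightarrow> \<bar>x - y\<bar> \<le> 2 * d \<Longrightarrow> k \<le> m \<Longrightarrow>
    \<bar>(g1 ^^ k) x - (g2 ^^ k) y\<bar> \<le> min r \<epsilon>"
    using Suc.IH[of "min r \<epsilon>"] r Suc.prems by (metis min_less_iff_conj)
  have "\<bar>(g1 ^^ k) x - (g2 ^^ k) y\<bar> \<le> \<epsilon>"
    if h: "\<forall>z. \<bar>g1 z - f z\<bar> \<le> min d (\<epsilon>/4)" "\<forall>z. \<bar>g2 z - f z\<bar> \<le> min d (\<epsilon>/4)"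
      "\<bar>x - y\<bar> \<le> 2 * min d (\<epsilon>/4)" "k \<le> Suc m" for g1 g2 x y k
  proof -
    have hd: "\<bar>(g1 ^^ k) x - (g2 ^^ k) y\<bar> \<le> min r \<epsilon>" if "k \<le> m" for k
      using h that by (intro d(2)) auto
    show ?thesis
    proof (cases "k \<le> m")
      case True then show ?thesis using hd[of k] by simp
    next
      case False
      then have k: "k = Suc m" using h by simp
      let ?x = "(g1 ^^ m) x" and ?y = "(g2 ^^ m) y"
      have "\<bar>f ?x - f ?y\<bar> \<le> \<epsilon>/2" using hd[of m] by (intro r(2)) auto
      moreover have "\<bar>g1 ?x - f ?x\<bar> \<le> \<epsilon>/4" "\<bar>g2 ?y - f ?y\<bar> \<le> \<epsilon>/4" using h by auto
      ultimately have "\<bar>g1 ?x - g2 ?y\<bar> \<le> \<epsilon>" by linarith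
      then show ?thesis using k by simp
    qed
  qed
  then show ?case using d(1) Suc.prems by (intro exI[of _ "min d (\<epsilon>/4)"]) auto
qed

text \<open>The conjugacy is \<open>abel g2 s\<close> after the inverse of \<open>abel g1 s\<close>,
  and g1, g2 stay unperturbed. Its displacement is bounded along orbits: below s, and beyond q, both
  points lie in an interval of length at most \<epsilon>; in between at most m iterates occur, which
  \<open>sh\<close> controls. The start points in the two fundamental domains differ by at most
  2\<delta>.\<close>

lemma conj_on_gap_up:
  assumes g1: "g1 \<in> lifts A" "g1 u1 = u1" "g1 a1 = a1" "\<And>x. u1 < x \<Longrightarrow> x < a1 \<Longrightarrow> x < g1 x"
    and g2: "g2 \<in> lifts A" "g2 u2 = u2" "g2 a2 = a2" "\<And>x. u2 < x \<Longrightarrow> x < a2 \<Longrightarrow> x < g2 x"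
    and s: "s - \<epsilon> \<le> u1" "u1 < s" "s - \<epsilon> \<le> u2" "u2 < s"
    and q: "q < a1" "a1 \<le> q + \<epsilon>" "q < a2" "a2 \<le> q + \<epsilon>" "s \<le> q"
    and d: "\<bar>g1 s - g2 s\<bar> \<le> 2 * \<delta>" "\<delta> \<ge> 0" "\<eta> \<ge> 0"
    and sh: "\<And>x y k. \<bar>x - y\<bar> \<le> 2 * \<delta> \<Longrightarrow> k \<le> m \<Longrightarrow> \<bar>(g1 ^^ k) x - (g2 ^^ k) y\<bar> \<le> \<epsilon>"
    and m: "q \<le> (g1 ^^ m) s" "q \<le> (g2 ^^ m) s"
  shows "conj_on \<eta> \<epsilon> g1 g2 u1 a1 u2 a2"
proof -
  have sa: "s < a1" "s < a2" using q by auto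
  let ?a = "abel g1 s" and ?b = "abel g2 s"
  note A1 = g1 s(2) sa(1) and A2 = g2 s(4) sa(2)
  have ma: "?a x < ?a y" "?b x < ?b y" if "x < y" for x y
    using abel_strict_mono[OF A1] abel_strict_mono[OF A2] that by (auto simp: strict_mono_def)
  have inj: "inj ?a" using abel_strict_mono[OF A1] by (rule strict_mono_imp_inj_on)
  define c where "c = inv_into UNIV ?a"
  have ca: "c (?a t) = t" for t unfolding c_def using inj by simp
  have ac: "?a (c x) = x" if "u1 < x" "x < a1" for x
    unfolding c_def using abel_onto[OF A1 that] by (simp add: f_inv_into_f)
  define H where "H x = (if x \<le> u1 then u2 else if x \<ge> a1 then a2 else ?b (c x))" for x
  have Ha: "H (?a t) = ?b t" for t using abel_range[OF A1, of t] by (simp add: H_def ca)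
  have ua: "u1 < a1" "u2 < a2" using s sa by auto
  have Hu: "H u1 = u2" "H a1 = a2" using ua by (auto simp: H_def)
  have xt: "x = u1 \<or> x = a1 \<or> (\<exists>t. x = ?a t)" if "x \<in> {u1..a1}" for x
    using that ac[of x] by (cases "x = u1 \<or> x = a1") (auto simp: less_le intro: sym)
  have yt: "y = u2 \<or> y = a2 \<or> (\<exists>t. y = ?b t)" if "y \<in> {u2..a2}" for y
    using that abel_onto[OF A2, of y] by (cases "y = u2 \<or> y = a2") (auto simp: less_le)
  have near: "\<bar>?b t - ?a t\<bar> \<le> \<epsilon>" for t
  proof -
    define k where "k = \<lfloor>t\<rfloor>"
    have k: "of_int k \<le> t" "t \<le> of_int k + 1" unfolding k_def by linarith+
    have r: "u1 < ?a t" "?a t < a1" "u2 < ?b t" "?b t < a2" using abel_range[OF A1] abel_range[OF A2] by auto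
    consider "k < 0" | "k \<ge> 0" "k \<le> int m" | "k > int m" by linarith
    then show ?thesis
    proof cases
      case 1
      then have "t \<le> 0" using k by linarith
      then have "?a t \<le> s" "?b t \<le> s"
        using ma[of t 0] abel_of_nat[OF A1, of 0] abel_of_nat[OF A2, of 0] by (cases "t = 0"; simp)+
      then show ?thesis using r s by linarith
    next
      case 3
      then have "real m < t" using k by linarith
      then have "q \<le> ?a t" "q \<le> ?b t"
        using ma[of "real m" t] abel_of_nat[OF A1, of m] abel_of_nat[OF A2, of m] m by auto
      then show ?thesis using r q by linarith
    next
      case 2
      then obtain n where n: "k = int n" "n \<le> m" by (metis nonneg_int_cases of_nat_le_iff)
      let ?l = "t - of_int k"
      have "\<bar>(s + ?l * (g1 s - s)) - (s + ?l * (g2 s - s))\<bar> = ?l * \<bar>g1 s - g2 s\<bar>"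
        using k by (simp add: abs_mult right_diff_distrib[symmetric])
      also have "\<dots> \<le> \<bar>g1 s - g2 s\<bar>" using k by (intro mult_left_le_one_le) auto
      finally have "\<bar>(s + ?l * (g1 s - s)) - (s + ?l * (g2 s - s))\<bar> \<le> 2 * \<delta>" using d by simp
      from sh[OF this n(2)] show ?thesis
        using abel_at[OF A1 k] abel_at[OF A2 k] n by (simp add: iterate_def abs_minus_commute)
    qed
  qed
  have Hm: "H x < H y" if xy: "u1 \<le> x" "x < y" "y \<le> a1" for x y
  proof -
    have "x = u1 \<or> (\<exists>t. x = ?a t)" "y = a1 \<or> (\<exists>t. y = ?a t)" using xt[of x] xt[of y] xy by auto
    then show ?thesis using xy Hu Ha abel_range[OF A2] ua ma(2) abel_strict_mono[OF A1]
      by (metis strict_mono_less)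
  qed
  have oH: "oiso u1 a1 u2 a2 H"
  proof (rule oisoI)
    show "H x < H y" if "u1 \<le> x" "x < y" "y \<le> a1" for x y by (rule Hm[OF that])
    show "u2 \<le> H x \<and> H x \<le> a2" if "u1 \<le> x" "x \<le> a1" for x
      using xt[of x] that Hu Ha abel_range[OF A2] ua by (auto simp: less_imp_le)
    show "\<exists>x\<ge>u1. x \<le> a1 \<and> H x = y" if "u2 \<le> y" "y \<le> a2" for y
      using yt[of y] that Hu Ha abel_range[OF A1] ua by (metis atLeastAtMost_iff less_imp_le order_refl)
  qed
  have "H (g1 x) = g2 (H x) \<and> \<bar>H x - x\<bar> \<le> \<epsilon>" if x: "x \<in> {u1..a1}" for x
    using xt[OF x]
  proof (elim disjE exE)
    fix t assume "x = ?a t"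
    then show ?thesis using near[of t] Ha Ha[of "t + 1"] by (simp add: abel_add1[OF A1] abel_add1[OF A2])
  qed (use g1 g2 Hu s q in auto)
  moreover have "oiso u1 a1 u1 a1 g1" "oiso u2 a2 u2 a2 g2" using lifts_oiso g1 g2 by auto
  ultimately show ?thesis using oH d unfolding conj_on_def
    by (intro exI[of _ g1] exI[of _ g2] exI[of _ H]) auto
qed

lemma oiso_reflect: assumes "oiso (-b) (-a) (-d) (-c) f" shows "oiso a b c d (\<lambda>x. - f (- x))"
proof (rule oisoI)
  show "- f (- x) < - f (- y)" if "a \<le> x" "x < y" "y \<le> b" for x y
    using oiso_less[OF assms, of "-y" "-x"] that by auto
  show "c \<le> - f (- x) \<and> - f (- x) \<le> d" if "a \<le> x" "x \<le> b" for x
    using oiso_mem[OF assms, of "-x"] that by auto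
  show "\<exists>x\<ge>a. x \<le> b \<and> - f (- x) = y" if y: "c \<le> y" "y \<le> d" for y
  proof -
    obtain z where "-b \<le> z" "z \<le> -a" "f z = - y" using oiso_onto[OF assms, of "-y"] y by auto
    then show ?thesis by (intro exI[of _ "-z"]) auto
  qed
qed

text \<open>For odd maps x -> -x preserves the whole picture; this reduces gaps in which points move
  down to gaps in which they move up.\<close>

lemma conj_on_reflect:
  assumes "conj_on \<eta> \<epsilon> g1 g2 (-b1) (-a1) (-b2) (-a2)" "g1 \<in> lifts A" "g2 \<in> lifts A"
  shows "conj_on \<eta> \<epsilon> g1 g2 a1 b1 a2 b2"
proof -
  obtain G1 G2 H where G: "oiso (-b1) (-a1) (-b1) (-a1) G1" "oiso (-b2) (-a2) (-b2) (-a2) G2" "oiso (-b1) (-a1) (-b2) (-a2) H"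
    "\<And>x. x\<in>{-b1..-a1} \<Longrightarrow> H (G1 x) = G2 (H x) \<and> \<bar>H x - x\<bar> \<le> \<epsilon> \<and> \<bar>G1 x - g1 x\<bar> \<le> \<eta>"
    "\<And>y. y\<in>{-b2..-a2} \<Longrightarrow> \<bar>G2 y - g2 y\<bar> \<le> \<eta>"
    using assms(1) unfolding conj_on_def by blast
  show ?thesis unfolding conj_on_def
  proof (intro exI conjI ballI)
    show "oiso a1 b1 a1 b1 (\<lambda>x. - G1 (- x))" "oiso a2 b2 a2 b2 (\<lambda>x. - G2 (- x))" "oiso a1 b1 a2 b2 (\<lambda>x. - H (- x))"
      using G oiso_reflect by auto
    fix x assume x: "x \<in> {a1..b1}"
    have "- x \<in> {-b1..-a1}" using x by auto
    from G(4)[OF this]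
    show "- H (- (- G1 (- x))) = - G2 (- (- H (- x)))" "\<bar>- H (- x) - x\<bar> \<le> \<epsilon>" "\<bar>- G1 (- x) - g1 x\<bar> \<le> \<eta>"
      using lifts_minus[OF assms(2), of x] by auto
  next
    fix y assume y: "y \<in> {a2..b2}"
    have "- y \<in> {-b2..-a2}" using y by auto
    from G(5)[OF this] show "\<bar>- G2 (- y) - g2 y\<bar> \<le> \<eta>"
      using lifts_minus[OF assms(3), of y] by auto
  qed
qed

section \<open>Periodic data, thickening of fixed points, and tame maps\<close>

lemma periodic_int:
  fixes h :: "int \<Rightarrow> 'a"
  assumes "\<And>j. h (j + N) = h j" shows "h (j + k * N) = h j"
proof (induction k rule: int_induct[where k = 0])
  case (step1 i) then show ?case using assms[of "j + i * N"] by (simp add: algebra_simps)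
next
  case (step2 i) then show ?case using assms[of "j + (i - 1) * N"] by (simp add: algebra_simps)
qed simp

lemma periodic_int_reduce:
  fixes h :: "int \<Rightarrow> 'a"
  assumes "\<And>j. h (j + N) = h j" "N > 0" shows "h j \<in> h ` {0..<N}"
proof -
  have "h j = h (j mod N)" using periodic_int[of h N "j mod N" "j div N", OF assms(1)] by simp
  then show ?thesis using assms(2) by auto
qed

lemma periodic_int_min:
  fixes h :: "int \<Rightarrow> real"
  assumes "\<And>j. h (j + N) = h j" "N > 0" "\<And>j. h j > 0"
  obtains c where "c > 0" "\<And>j. c \<le> h j"
proof
  have "h ` {0..<N} \<noteq> {}" using assms(2) by auto
  then show "Min (h ` {0..<N}) > 0" using assms(3) by auto
  show "Min (h ` {0..<N}) \<le> h j" for j using periodic_int_reduce[of h N j, OF assms(1,2)] by (intro Min_le) auto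
qed

lemma lifts_contI:
  assumes "A > 0" "continuous_on UNIV f" "\<And>x y. x < y \<Longrightarrow> f x < f y" "\<And>t. f (- t) = - f t" "\<And>t. f (t + 2 * A) = f t + 2 * A"
  shows "f \<in> lifts A"
proof -
  have "surj f"
    unfolding surj_def
  proof
    fix y
    have n: "f (real n * (2 * A)) = real n * (2 * A)" for n
    proof (induction n)
      case 0 then show ?case using assms(4)[of 0] by simp
    next
      case (Suc n) then show ?case using assms(5)[of "real n * (2 * A)"] by (simp add: algebra_simps)
    qed
    obtain n where "\<bar>y\<bar> < real n * (2 * A)" using reals_Archimedean3[of "2 * A"] assms(1) by auto
    then have "f (- (real n * (2 * A))) \<le> y" "y \<le> f (real n * (2 * A))" using n[of n] assms(4) by auto
    moreover have "- (real n * (2 * A)) \<le> real n * (2 * A)" using assms(1) by simp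
    ultimately obtain x where "f x = y"
      using IVT'[of f "- (real n * (2 * A))" y "real n * (2 * A)"] continuous_on_subset[OF assms(2)] by auto
    then show "\<exists>x. y = f x" by auto
  qed
  then show ?thesis using assms by (auto simp: lifts_def strict_mono_def)
qed

text \<open>Clamps x to the interval of radius \<tau> about g x. Fixed points become the points that
  g moves by at most \<tau>, so the hull of the fixed points in a cell gets positive length, as
  insertion requires.\<close>

definition thicken :: "real \<Rightarrow> (real \<Rightarrow> real) \<Rightarrow> real \<Rightarrow> real" where
  "thicken \<tau> g x = max (g x - \<tau>) (min x (g x + \<tau>))"

lemma thicken_lifts: assumes "g \<in> lifts A" "A > 0" "\<tau> > 0" shows "thicken \<tau> g \<in> lifts A"
proof (rule lifts_contI[OF assms(2)])
  show "continuous_on UNIV (thicken \<tau> g)"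
    unfolding thicken_def[abs_def] by (intro continuous_intros lifts_continuous[OF assms(1)])
  show "thicken \<tau> g x < thicken \<tau> g y" if "x < y" for x y
    using lifts_mono[OF assms(1) that] that by (auto simp: thicken_def)
  show "thicken \<tau> g (- t) = - thicken \<tau> g t" "thicken \<tau> g (t + 2 * A) = thicken \<tau> g t + 2 * A" for t
    using lifts_minus[OF assms(1), of t] lifts_period1[OF assms(1), of t] assms(3) by (auto simp: thicken_def max_def min_def)
qed

lemma thicken_near: "\<tau> > 0 \<Longrightarrow> \<bar>thicken \<tau> g x - g x\<bar> \<le> \<tau>"
  by (auto simp: thicken_def max_def min_def)

lemma thicken_fixed: "\<tau> > 0 \<Longrightarrow> thicken \<tau> g x = x \<longleftrightarrow> \<bar>g x - x\<bar> \<le> \<tau>"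
  by (auto simp: thicken_def max_def min_def)

text \<open>[a, b] is the hull of the compact set of fixed points in [p, q]. It is nondegenerate
  because h moves points near x by at most \<tau>, and p < q leaves room on one side of x.\<close>

lemma thicken_cell:
  assumes h: "h \<in> lifts A" "A > 0" "\<tau> > 0" and x: "p \<le> x" "x \<le> q" "p < q" "h x = x"
  obtains a b where "p \<le> a" "a < b" "b \<le> q" "thicken \<tau> h a = a" "thicken \<tau> h b = b"
    "\<And>y. p \<le> y \<Longrightarrow> y \<le> q \<Longrightarrow> thicken \<tau> h y = y \<Longrightarrow> a \<le> y \<and> y \<le> b"
proof -
  let ?g = "thicken \<tau> h"
  define F where "F = {y \<in> {p..q}. ?g y = y}"
  have c: "continuous_on UNIV ?g" by (rule lifts_continuous[OF thicken_lifts[OF h]])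
  have "F = {p..q} \<inter> {y. ?g y = y}" by (auto simp: F_def)
  moreover have "closed {y. ?g y = y}" by (intro closed_Collect_eq c continuous_on_id)
  ultimately have F: "compact F" by (simp add: compact_Int_closed)
  obtain r where r: "r > 0" "\<And>x y. \<bar>x - y\<bar> \<le> r \<Longrightarrow> \<bar>h x - h y\<bar> \<le> \<tau>/2"
    using lifts_uniformly_continuous[OF h(1,2), of "\<tau>/2"] h(3) by auto
  define r' where "r' = min r (min (\<tau>/2) ((q - p)/2))"
  have r'0: "r' > 0" using r(1) h(3) x by (simp add: r'_def)
  have "r' \<le> r" "r' \<le> \<tau>/2" "r' \<le> (q - p)/2"
    unfolding r'_def by (blast intro: min.coboundedI1 min.coboundedI2 order_refl)+
  note r' = r'0 this
  have nF: "y \<in> F" if "p \<le> y" "y \<le> q" "\<bar>y - x\<bar> \<le> r'" for y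
  proof -
    have "\<bar>h y - x\<bar> \<le> \<tau>/2" using r(2)[of y x] that r' x by simp
    then have "\<bar>h y - y\<bar> \<le> \<tau>" using that r' by linarith
    then show ?thesis using that h(3) by (simp add: F_def thicken_fixed)
  qed
  have "x \<in> F" using nF[of x] x r' by auto
  moreover have "\<exists>y\<in>F. y \<noteq> x"
  proof (cases "x - r' \<ge> p")
    case True then show ?thesis using nF[of "x - r'"] x r' by (intro bexI[of _ "x - r'"]) auto
  next
    case False then show ?thesis using nF[of "x + r'"] x r' by (intro bexI[of _ "x + r'"]) auto
  qed
  then obtain y where y: "y \<in> F" "y \<noteq> x" by auto
  have ne: "F \<noteq> {}" using y by auto
  obtain a where a: "a \<in> F" "\<And>z. z \<in> F \<Longrightarrow> a \<le> z" using compact_attains_inf[OF F ne] by auto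
  obtain b where b: "b \<in> F" "\<And>z. z \<in> F \<Longrightarrow> z \<le> b" using compact_attains_sup[OF F ne] by auto
  have "a < b" using a(2)[of x] a(2)[of y] b(2)[of x] b(2)[of y] y \<open>x \<in> F\<close> by linarith
  then show ?thesis using a b that[of a b] by (auto simp: F_def)
qed

lemma lifts_ivt:
  assumes "g \<in> lifts A" "p < q" "(p < g p \<and> g q < q) \<or> (g p < p \<and> q < g q)"
  obtains x where "p < x" "x < q" "g x = x"
proof -
  have c: "continuous_on {p..q} (\<lambda>x. g x - x)" by (intro continuous_intros lifts_continuous[OF assms(1)])
  have "\<exists>x. p \<le> x \<and> x \<le> q \<and> g x - x = 0"
    using assms(3)
  proof
    assume "p < g p \<and> g q < q"
    then show ?thesis using IVT2'[of "\<lambda>x. g x - x" q 0 p] c assms(2) by auto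
  next
    assume "g p < p \<and> q < g q"
    then show ?thesis using IVT'[of "\<lambda>x. g x - x" p 0 q] c assms(2) by auto
  qed
  then obtain x where x: "p \<le> x" "x \<le> q" "g x = x" by auto
  then have "x \<noteq> p" "x \<noteq> q" using assms(3) by auto
  then show ?thesis using x by (intro that[of x]) auto
qed

lemma funpow_reach:
  assumes g: "g \<in> lifts A" and up: "\<And>x. s \<le> x \<Longrightarrow> x \<le> q \<Longrightarrow> x + d \<le> g x" and "s \<le> q" "d > 0" "q - s \<le> real m * d"
  shows "q \<le> (g ^^ m) s"
proof -
  \<comment> \<open>The minimum stops the count once q is passed; as g moves q up, the orbit then
    stays beyond q.\<close>
  have "min q (s + real k * d) \<le> (g ^^ k) s" for k
  proof (induction k)
    case (Suc k)
    let ?x = "(g ^^ k) s"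
    show ?case
    proof (cases "?x \<ge> q")
      case True
      then have "g q \<le> g ?x" by (rule lifts_mono_le[OF g])
      then have "q \<le> g ?x" using up[of q] assms by linarith
      then show ?thesis by simp
    next
      case False
      moreover have "s \<le> s + real k * d" using assms(4) by simp
      ultimately have "s \<le> ?x" using Suc assms(3) by linarith
      then have "?x + d \<le> g ?x" using up[of ?x] False by auto
      then show ?thesis using Suc False by (auto simp: algebra_simps min_def split: if_splits)
    qed
  qed (use assms in auto)
  from this[of m] show ?thesis using assms by auto
qed

text \<open>An interval longer than A contains a multiple of A, which f fixes. This bounds the
  number of iterates needed to cross a gap in terms of A, even for maps of period DA.\<close>

lemma lifts_gap_short:
  assumes "f \<in> lifts A" "A > 0" "s \<le> q" "(\<forall>x\<in>{s..q}. x < f x) \<or> (\<forall>x\<in>{s..q}. f x < x)"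
  shows "q - s \<le> A"
proof (rule ccontr)
  assume "\<not> q - s \<le> A"
  define k where "k = \<lceil>s / A\<rceil>"
  have "s / A \<le> of_int k" "of_int k < s / A + 1" unfolding k_def by linarith+
  then have "s \<le> of_int k * A" "of_int k * A < s + A"
    using assms(2) by (auto simp: field_simps)
  then have "of_int k * A \<in> {s..q}" using \<open>\<not> q - s \<le> A\<close> by auto
  then show False using lifts_int[OF assms(1), of k] assms(4) by (metis less_irrefl)
qed

text \<open>The cut points (j + 1/2)\<kappa> are symmetric under negation and under translation by
  2A, and they avoid the multiples of \<kappa>, among which are the multiples of A that every lift
  fixes. One bound c for all cells leaves a displacement of c/2 after any perturbation by at most
  c/2.\<close>

definition tame :: "(real \<Rightarrow> real) \<Rightarrow> real \<Rightarrow> nat \<Rightarrow> real \<Rightarrow> real \<Rightarrow> bool" where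
  "tame F A n \<kappa> c \<longleftrightarrow> F \<in> lifts A \<and> n > 0 \<and> \<kappa> > 0 \<and> A = real n * \<kappa> \<and> c > 0 \<and>
    (\<forall>j::int. (of_int j + 1/2) * \<kappa> + c \<le> F ((of_int j + 1/2) * \<kappa>) \<or> F ((of_int j + 1/2) * \<kappa>) \<le> (of_int j + 1/2) * \<kappa> - c) \<and>
    (\<forall>(j::int) x. (of_int j + 1/2) * \<kappa> < F ((of_int j + 1/2) * \<kappa>) \<longrightarrow> (of_int j + 3/2) * \<kappa> < F ((of_int j + 3/2) * \<kappa>) \<longrightarrow>
       (of_int j + 1/2) * \<kappa> \<le> x \<longrightarrow> x \<le> (of_int j + 3/2) * \<kappa> \<longrightarrow> x + c \<le> F x) \<and>
    (\<forall>(j::int) x. F ((of_int j + 1/2) * \<kappa>) < (of_int j + 1/2) * \<kappa> \<longrightarrow> F ((of_int j + 3/2) * \<kappa>) < (of_int j + 3/2) * \<kappa> \<longrightarrow>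
       (of_int j + 1/2) * \<kappa> \<le> x \<longrightarrow> x \<le> (of_int j + 3/2) * \<kappa> \<longrightarrow> F x \<le> x - c)"

text \<open>F is affine between its values \<open>v j\<close> at the cut points, and these are the
  values of f pushed up or down by a small \<nu> that is chosen so that no cut point is
  fixed.\<close>

lemma tame_approx:
  assumes f: "f \<in> lifts A" and A: "A > 0" and \<eta>: "\<eta> > 0" and \<epsilon>: "\<epsilon> > 0"
  shows "\<exists>F n \<kappa> c. tame F A n \<kappa> c \<and> \<kappa> \<le> \<epsilon> \<and> (\<forall>x. \<bar>F x - f x\<bar> \<le> \<eta>)"
proof -
  obtain d where d: "d > 0" "\<And>x y. \<bar>x - y\<bar> \<le> d \<Longrightarrow> \<bar>f x - f y\<bar> \<le> \<eta>/2"
    using lifts_uniformly_continuous[OF f A, of "\<eta>/2"] \<eta> by auto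
  obtain n0 where n0: "A < real n0 * min d \<epsilon>" using reals_Archimedean3[of "min d \<epsilon>"] d(1) \<epsilon> by (metis min_less_iff_conj)
  define n where "n = max 1 n0"
  define \<kappa> where "\<kappa> = A / real n"
  have n: "n > 0" by (simp add: n_def)
  have An: "A = real n * \<kappa>" using n by (simp add: \<kappa>_def)
  have "A < real n * min d \<epsilon>"
  proof -
    have "real n0 * min d \<epsilon> \<le> real n * min d \<epsilon>" using d \<epsilon> by (intro mult_right_mono) (auto simp: n_def)
    then show ?thesis using n0 by simp
  qed
  then have "\<kappa> < min d \<epsilon>" using n An by (simp add: mult_less_cancel_left_pos)
  moreover have "\<kappa> > 0" using A n by (simp add: \<kappa>_def)
  ultimately have \<kappa>: "\<kappa> > 0" "\<kappa> \<le> d" "\<kappa> \<le> \<epsilon>" by auto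
  define t :: "int \<Rightarrow> real" where "t j = (of_int j + 1/2) * \<kappa>" for j
  have t1: "t (j + 1) = t j + \<kappa>" for j by (simp add: t_def algebra_simps)
  have tn: "t (j + 2 * int n) = t j + 2 * A" for j by (simp add: t_def An algebra_simps)
  have to: "t (- j - 1) = - t j" for j by (simp add: t_def algebra_simps)
  \<comment> \<open>Signs of period 2n that are odd under the reflection j -> -j - 1 of the cut
    points, so that v keeps the symmetries of f.\<close>
  define w :: "int \<Rightarrow> real" where "w j = (if j mod (2 * int n) < int n then 1 else - 1)" for j
  have wn: "w (j + 2 * int n) = w j" for j by (simp add: w_def)
  have wo: "w (- j - 1) = - w j" for j
  proof -
    define N r where "N = 2 * int n" and "r = j mod N"
    have r: "0 \<le> r" "r < N" using n by (auto simp: r_def N_def)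
    have "- j - 1 = (N - 1 - r) + (- (j div N) - 1) * N"
      using div_mult_mod_eq[of j N] by (simp add: r_def algebra_simps)
    then have "(- j - 1) mod N = (N - 1 - r) mod N" by (metis mod_mult_self1)
    also have "\<dots> = N - 1 - r" using r by (intro mod_pos_pos_trivial) auto
    finally show ?thesis by (auto simp: w_def N_def[symmetric] r_def[symmetric]) (auto simp: N_def)
  qed
  have w1: "w j = 1 \<or> w j = - 1" for j by (simp add: w_def)
  obtain \<gamma> where \<gamma>: "\<gamma> > 0" "\<And>j. \<gamma> \<le> f (t (j + 1)) - f (t j)"
  proof (rule periodic_int_min[of "\<lambda>j. f (t (j + 1)) - f (t j)" "2 * int n"])
    show "f (t (j + 2 * int n + 1)) - f (t (j + 2 * int n)) = f (t (j + 1)) - f (t j)" for j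
      using tn[of j] tn[of "j + 1"] lifts_period1[OF f] by (simp add: add_ac)
    show "f (t (j + 1)) - f (t j) > 0" for j using lifts_mono[OF f, of "t j" "t (j + 1)"] t1 \<kappa> by simp
  qed (use n in auto)
  define B where "B = (\<lambda>j. \<bar>f (t j) - t j\<bar>) ` {0..<2 * int n}"
  have B: "\<bar>f (t j) - t j\<bar> \<in> B" for j
    unfolding B_def using tn lifts_period1[OF f] n by (intro periodic_int_reduce[of "\<lambda>j. \<bar>f (t j) - t j\<bar>"]) auto
  \<comment> \<open>Below \<gamma>/2, \<nu> keeps v increasing; below \<eta>/2, it leaves half of
    the tolerance to the oscillation of f on a cell; outside the finite set B, it takes every cut
    point off the diagonal.\<close>
  have "infinite {0<..<min (\<gamma>/2) (\<eta>/2)}" using \<gamma> \<eta> by (intro infinite_Ioo) auto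
  moreover have "finite B" by (simp add: B_def)
  ultimately obtain \<nu> where "\<nu> \<in> {0<..<min (\<gamma>/2) (\<eta>/2)} - B"
    using Diff_infinite_finite by (metis all_not_in_conv finite.emptyI)
  then have \<nu>: "\<nu> > 0" "2 * \<nu> < \<gamma>" "\<nu> \<le> \<eta>/2" "\<nu> \<notin> B" by auto
  define v where "v j = f (t j) + \<nu> * w j" for j
  have wv: "\<bar>\<nu> * w j\<bar> \<le> \<nu>" for j using w1[of j] \<nu> by auto
  have vn: "v (j + 2 * int n) = v j + 2 * A" for j using tn lifts_period1[OF f] wn by (simp add: v_def)
  have vo: "v (- j - 1) = - v j" for j unfolding v_def to wo using lifts_minus[OF f] by simp
  have v1: "v j < v (j + 1)" for j using \<gamma>(2)[of j] \<nu> wv[of j] wv[of "j + 1"] by (simp add: v_def)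
  have vt: "v j \<noteq> t j" for j
  proof
    assume "v j = t j"
    then have "\<bar>f (t j) - t j\<bar> = \<nu>" using w1[of j] \<nu> by (auto simp: v_def)
    then show False using B[of j] \<nu> by simp
  qed
  obtain c where c: "c > 0" "\<And>j. c \<le> \<bar>v j - t j\<bar>"
    by (rule periodic_int_min[of "\<lambda>j. \<bar>v j - t j\<bar>" "2 * int n"]) (use vn tn n vt in auto)
  define Q where "Q j s = v j + s * (v (j + 1) - v j)" for j s
  have Qj: "Q j 1 = Q (j + 1) 0" for j by (simp add: Q_def)
  have sm: "strict_mono (glue Q)"
    by (rule strict_mono_glue, rule Qj) (use v1 in \<open>auto intro!: strict_mono_onI mult_strict_right_mono simp: Q_def\<close>)
  define F where "F x = glue Q (x / \<kappa> - 1/2)" for x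
  have Fe: "F x = v j + (x - t j) / \<kappa> * (v (j + 1) - v j)" if "t j \<le> x" "x \<le> t (j + 1)" for x j
  proof -
    have e: "x / \<kappa> - 1/2 - of_int j = (x - t j) / \<kappa>" using \<kappa> by (simp add: t_def field_simps)
    have "of_int j \<le> x / \<kappa> - 1/2" "x / \<kappa> - 1/2 \<le> of_int j + 1" using that \<kappa> by (auto simp: t_def field_simps)
    from glue_eq[of Q, OF Qj this] show ?thesis unfolding F_def e by (simp add: Q_def)
  qed
  have piece: "\<exists>j. t j \<le> x \<and> x \<le> t (j + 1)" for x
  proof -
    define k where "k = \<lfloor>x / \<kappa> - 1/2\<rfloor>"
    have "of_int k + 1/2 \<le> x / \<kappa>" "x / \<kappa> \<le> of_int k + 1/2 + 1" unfolding k_def by linarith+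
    then have "t k \<le> x" "x \<le> t (k + 1)"
      using \<kappa>(1) by (simp_all only: t_def pos_le_divide_eq pos_divide_le_eq of_int_add of_int_1 add_ac)
    then show ?thesis by auto
  qed
  have Ft: "F (t j) = v j" for j using Fe[of j "t j"] t1[of j] \<kappa> by simp
  have Fm: "F x < F y" if "x < y" for x y
    using strict_monoD[OF sm, of "x / \<kappa> - 1/2" "y / \<kappa> - 1/2"] that \<kappa> by (simp add: F_def divide_strict_right_mono)
  have F_lifts: "F \<in> lifts A"
  proof -
    have "F (- x) = - F x" for x
    proof -
      obtain j where j: "t j \<le> x" "x \<le> t (j + 1)" using piece by auto
      have e: "t (- j - 2) = - t (j + 1)" "t (- j - 2 + 1) = - t j" "v (- j - 2) = - v (j + 1)" "v (- j - 2 + 1) = - v j"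
      proof -
        have i: "- j - 2 + 1 = - j - 1" "- (j + 1) - 1 = - j - 2" by auto
        show "t (- j - 2) = - t (j + 1)" "t (- j - 2 + 1) = - t j" "v (- j - 2) = - v (j + 1)" "v (- j - 2 + 1) = - v j"
          using to[of j] to[of "j + 1"] vo[of j] vo[of "j + 1"] unfolding i by auto
      qed
      define l where "l = (x - t j) / \<kappa>"
      have l: "(- x - - t (j + 1)) / \<kappa> = 1 - l" using t1[of j] \<kappa> by (simp add: l_def field_simps)
      have "F (- x) = - v (j + 1) + (1 - l) * (- v j - - v (j + 1))"
        using Fe[of "- j - 2" "- x"] j unfolding e l by simp
      moreover have "F x = v j + l * (v (j + 1) - v j)" using Fe[OF j] by (simp add: l_def)
      ultimately show ?thesis by (simp add: algebra_simps)
    qed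
    moreover have "F (x + 2 * A) = F x + 2 * A" for x
    proof -
      obtain j where j: "t j \<le> x" "x \<le> t (j + 1)" using piece by auto
      have e: "t (j + 2 * int n + 1) = t (j + 1) + 2 * A" "v (j + 2 * int n + 1) = v (j + 1) + 2 * A"
        using tn[of "j + 1"] vn[of "j + 1"] by (simp_all add: add_ac)
      show ?thesis using Fe[OF j] Fe[of "j + 2 * int n" "x + 2 * A"] j unfolding e tn vn by simp
    qed
    moreover have "surj F" unfolding surj_def
    proof
      fix y
      have v2: "v (j + k * (2 * int n)) = v j + of_int k * (2 * A)" for j k
        using periodic_int[of "\<lambda>j. v j - of_int j * \<kappa>" "2 * int n" j k] vn by (simp add: An algebra_simps)
      obtain m where "\<bar>y - v 0\<bar> < real m * (2 * A)" using reals_Archimedean3[of "2 * A"] A by auto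
      then have "v (0 + (- int m) * (2 * int n)) \<le> y" "y < v (0 + int m * (2 * int n))" unfolding v2 by auto
      then obtain j where j: "v j \<le> y" "y < v (j + 1)" using unbounded_int_seq_bracket[of v _ y] v1 less_imp_le by metis
      define l where "l = (y - v j) / (v (j + 1) - v j)"
      have l: "0 \<le> l" "l \<le> 1" using j by (auto simp: l_def)
      define x where "x = t j + l * \<kappa>"
      have "0 \<le> l * \<kappa>" "l * \<kappa> \<le> \<kappa>" using l \<kappa> mult_left_le_one_le[of \<kappa> l] by auto
      then have "t j \<le> x" "x \<le> t (j + 1)" using t1[of j] by (auto simp: x_def)
      from Fe[OF this] have "F x = v j + l * (v (j + 1) - v j)" using \<kappa> by (simp add: x_def)
      also have "\<dots> = y" using v1[of j] by (simp add: l_def)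
      finally have "F x = y" .
      then show "\<exists>x. y = F x" by auto
    qed
    ultimately show ?thesis using Fm by (auto simp: lifts_def strict_mono_def)
  qed
  have close: "\<bar>F x - f x\<bar> \<le> \<eta>" for x
  proof -
    obtain j where j: "t j \<le> x" "x \<le> t (j + 1)" using piece by auto
    have "v j \<le> F x" "F x \<le> v (j + 1)" using lifts_mono_le[OF F_lifts j(1)] lifts_mono_le[OF F_lifts j(2)] Ft by auto
    moreover have "f (t j) \<le> f x" "f x \<le> f (t (j + 1))" using lifts_mono_le[OF f j(1)] lifts_mono_le[OF f j(2)] by auto
    moreover have "\<bar>f (t (j + 1)) - f (t j)\<bar> \<le> \<eta>/2" using t1[of j] \<kappa> by (intro d(2)) auto
    ultimately show ?thesis using wv[of j] wv[of "j + 1"] \<nu> unfolding v_def by linarith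
  qed
  have "tame F A n \<kappa> c"
    unfolding tame_def
  proof (intro conjI allI impI)
    fix j
    show "(of_int j + 1/2) * \<kappa> + c \<le> F ((of_int j + 1/2) * \<kappa>) \<or> F ((of_int j + 1/2) * \<kappa>) \<le> (of_int j + 1/2) * \<kappa> - c"
      using c(2)[of j] Ft[of j] by (auto simp: t_def)
  next
    fix j x assume h: "(of_int j + 1/2) * \<kappa> < F ((of_int j + 1/2) * \<kappa>)" "(of_int j + 3/2) * \<kappa> < F ((of_int j + 3/2) * \<kappa>)"
      "(of_int j + 1/2) * \<kappa> \<le> x" "x \<le> (of_int j + 3/2) * \<kappa>"
    have e: "(of_int j + 3/2) * \<kappa> = t (j + 1)" "(of_int j + 1/2) * \<kappa> = t j" by (simp_all add: t_def algebra_simps)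
    note h = h[unfolded e Ft]
    define l where "l = (x - t j) / \<kappa>"
    have l: "0 \<le> l" "l \<le> 1" "x = t j + l * \<kappa>" using h t1[of j] \<kappa> by (simp_all add: l_def)
    \<comment> \<open>F - id is affine on the cell, hence a convex combination of its two end
      values, both at least c.\<close>
    have "F x - x = (1 - l) * (v j - t j) + l * (v (j + 1) - t (j + 1))"
      using Fe[OF h(3,4), folded l_def] l(3) t1[of j] by (simp add: algebra_simps)
    also have "\<dots> \<ge> (1 - l) * c + l * c"
      using l h c(2)[of j] c(2)[of "j + 1"] by (intro add_mono mult_left_mono) auto
    finally show "x + c \<le> F x" by (simp add: algebra_simps)
  next
    fix j x assume h: "F ((of_int j + 1/2) * \<kappa>) < (of_int j + 1/2) * \<kappa>" "F ((of_int j + 3/2) * \<kappa>) < (of_int j + 3/2) * \<kappa>"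
      "(of_int j + 1/2) * \<kappa> \<le> x" "x \<le> (of_int j + 3/2) * \<kappa>"
    have e: "(of_int j + 3/2) * \<kappa> = t (j + 1)" "(of_int j + 1/2) * \<kappa> = t j" by (simp_all add: t_def algebra_simps)
    note h = h[unfolded e Ft]
    define l where "l = (x - t j) / \<kappa>"
    have l: "0 \<le> l" "l \<le> 1" "x = t j + l * \<kappa>" using h t1[of j] \<kappa> by (simp_all add: l_def)
    have "x - F x = (1 - l) * (t j - v j) + l * (t (j + 1) - v (j + 1))"
      using Fe[OF h(3,4), folded l_def] l(3) t1[of j] by (simp add: algebra_simps)
    also have "\<dots> \<ge> (1 - l) * c + l * c"
      using l h c(2)[of j] c(2)[of "j + 1"] by (intro add_mono mult_left_mono) auto
    finally show "F x \<le> x - c" by (simp add: algebra_simps)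
  qed (fact F_lifts n \<kappa>(1) An c(1))+
  then show ?thesis using close \<kappa>(3) by blast
qed

text \<open>A conjugacy on [0, A] extends by \<open>ext\<close>; identities and distances between
  lifts are decided on [0, A].\<close>

lemma conj_on_lifts:
  assumes g: "g1 \<in> lifts A" "g2 \<in> lifts A" and A: "A > 0" and c: "conj_on \<eta> \<epsilon> g1 g2 0 A 0 A"
  shows "\<exists>z1\<in>lifts A. \<exists>z2\<in>lifts A. \<exists>h\<in>lifts A. (\<forall>x. \<bar>z1 x - g1 x\<bar> \<le> \<eta>) \<and> (\<forall>x. \<bar>z2 x - g2 x\<bar> \<le> \<eta>) \<and>
    (\<forall>x. \<bar>h x - x\<bar> \<le> \<epsilon>) \<and> h \<circ> z1 = z2 \<circ> h"
proof -
  obtain G1 G2 H where G: "oiso 0 A 0 A G1" "oiso 0 A 0 A G2" "oiso 0 A 0 A H"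
    "\<And>x. x\<in>{0..A} \<Longrightarrow> H (G1 x) = G2 (H x) \<and> \<bar>H x - x\<bar> \<le> \<epsilon> \<and> \<bar>G1 x - g1 x\<bar> \<le> \<eta>"
    "\<And>y. y\<in>{0..A} \<Longrightarrow> \<bar>G2 y - g2 y\<bar> \<le> \<eta>"
    using c unfolding conj_on_def by blast
  note e = ext_lifts[OF A G(1)] ext_lifts[OF A G(2)] ext_lifts[OF A G(3)]
  note o = ext_on[OF A G(1)] ext_on[OF A G(2)] ext_on[OF A G(3)]
  note m = oiso_mem[OF G(1)] oiso_mem[OF G(2)] oiso_mem[OF G(3)]
  have "\<bar>ext A G1 x - g1 x\<bar> \<le> \<eta>" "\<bar>ext A G2 x - g2 x\<bar> \<le> \<eta>" for x
    by (rule lifts_dist_reduce[OF A e(1) g(1)] lifts_dist_reduce[OF A e(2) g(2)], use G(4,5) o in simp)+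
  moreover have "\<bar>ext A H x - x\<bar> \<le> \<epsilon>" for x
    by (rule lifts_dist_reduce[OF A e(3) lifts_id], use G(4) o in simp)
  moreover have "ext A H \<circ> ext A G1 = ext A G2 \<circ> ext A H"
    by (rule lifts_eqI[OF A lifts_comp[OF e(3,1)] lifts_comp[OF e(2,3)]]) (use o m G(4) in auto)
  ultimately show ?thesis using e by blast
qed

text \<open>All lifts fix 0 and A, so when the conjugator may be large a single insertion on [0, A]
  is enough.\<close>

lemma lifts_conj_dense:
  assumes g: "g1 \<in> lifts A" "g2 \<in> lifts A" and A: "A > 0" and \<eta>: "\<eta> > 0"
  shows "\<exists>z1\<in>lifts A. \<exists>z2\<in>lifts A. \<exists>h\<in>lifts A. (\<forall>x. \<bar>z1 x - g1 x\<bar> \<le> \<eta>) \<and> (\<forall>x. \<bar>z2 x - g2 x\<bar> \<le> \<eta>) \<and>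
    h \<circ> z1 = z2 \<circ> h"
proof -
  have "conj_on \<eta> A g1 g2 0 A 0 A"
    by (rule conj_on_insert[OF g A, where l = 0 and r = A]) (use lifts_self[of _ A] lifts_0[of _ A] g A \<eta> in auto)
  from conj_on_lifts[OF g A this] show ?thesis by blast
qed

text \<open>On [s, q] both maps inherit a drift of at least c/2 from f; towards the ends the sign
  persists, since a change would produce a fixed point. The estimates involve the period A of f,
  through \<open>lifts_gap_short\<close>, and not the period B of the two maps.\<close>

lemma conj_on_gap:
  assumes f: "f \<in> lifts A" "A > 0" and g: "g1 \<in> lifts B" "g2 \<in> lifts B"
    and near: "\<And>x. \<bar>g1 x - f x\<bar> \<le> \<delta>" "\<And>x. \<bar>g2 x - f x\<bar> \<le> \<delta>" "\<delta> \<le> c/2" "c > 0" "\<delta> \<ge> 0"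
    and g1: "g1 u1 = u1" "g1 a1 = a1" "\<And>x. u1 < x \<Longrightarrow> x < a1 \<Longrightarrow> g1 x \<noteq> x"
    and g2: "g2 u2 = u2" "g2 a2 = a2" "\<And>x. u2 < x \<Longrightarrow> x < a2 \<Longrightarrow> g2 x \<noteq> x"
    and s: "s - \<epsilon> \<le> u1" "u1 < s" "s - \<epsilon> \<le> u2" "u2 < s"
    and q: "q < a1" "a1 \<le> q + \<epsilon>" "q < a2" "a2 \<le> q + \<epsilon>" "s \<le> q" and \<eta>: "\<eta> \<ge> 0"
    and fc: "(\<forall>x\<in>{s..q}. x + c \<le> f x) \<or> (\<forall>x\<in>{s..q}. f x \<le> x - c)"
    and sh: "\<And>x y k. \<bar>x - y\<bar> \<le> 2 * \<delta> \<Longrightarrow> k \<le> m \<Longrightarrow> \<bar>(g1 ^^ k) x - (g2 ^^ k) y\<bar> \<le> \<epsilon>"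
    and m: "A \<le> real m * (c/2)"
  shows "conj_on \<eta> \<epsilon> g1 g2 u1 a1 u2 a2"
proof -
  have qs: "q - s \<le> A" by (rule lifts_gap_short[OF f q(5)]) (use fc near in force)
  have d: "\<bar>g1 x - g2 x\<bar> \<le> 2 * \<delta>" for x using near(1,2)[of x] by linarith
  from fc show ?thesis
  proof
    assume up: "\<forall>x\<in>{s..q}. x + c \<le> f x"
    have up1: "x + c/2 \<le> g1 x" "x + c/2 \<le> g2 x" if "s \<le> x" "x \<le> q" for x
      using bspec[OF up, of x] that near(1,2)[of x] near(3) by (auto simp: abs_le_iff)
    have pos: "x < g x" if H: "g \<in> lifts B" "\<And>x. u < x \<Longrightarrow> x < a \<Longrightarrow> g x \<noteq> x" "u < s" "q < a"
      "\<And>x. s \<le> x \<Longrightarrow> x \<le> q \<Longrightarrow> x + c/2 \<le> g x" "u < x" "x < a" for g u a x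
    proof (rule ccontr)
      assume "\<not> x < g x"
      moreover have "g x \<noteq> x" by (rule H(2)[OF H(6,7)])
      ultimately have "g x < x" by linarith
      moreover have "s < g s" using H(5)[of s] q near by auto
      moreover have "x \<noteq> s" using calculation by auto
      ultimately obtain y where "min x s < y" "y < max x s" "g y = y"
        using lifts_ivt[OF H(1), of "min x s" "max x s"] by (cases "x < s") auto
      then show False using H(2)[of y] H q by auto
    qed
    show ?thesis
    proof (rule conj_on_gap_up[OF g(1) g1(1,2) _ g(2) g2(1,2) _ s q d near(5) \<eta> sh])
      show "x < g1 x" if "u1 < x" "x < a1" for x using pos[OF g(1) g1(3) s(2) q(1) up1(1) that] by blast
      show "x < g2 x" if "u2 < x" "x < a2" for x using pos[OF g(2) g2(3) s(4) q(3) up1(2) that] by blast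
      show "q \<le> (g1 ^^ m) s" by (rule funpow_reach[OF g(1) up1(1)]) (use near q qs m in auto)
      show "q \<le> (g2 ^^ m) s" by (rule funpow_reach[OF g(2) up1(2)]) (use near q qs m in auto)
    qed
  next
    assume dn: "\<forall>x\<in>{s..q}. f x \<le> x - c"
    have up1: "x + c/2 \<le> g1 x" "x + c/2 \<le> g2 x" if "- q \<le> x" "x \<le> - s" for x
      using bspec[OF dn, of "- x"] that near(1,2)[of x] near(3) lifts_minus[OF f(1), of x] by auto
    have pos: "x < g x" if H: "g \<in> lifts B" "\<And>x. u < x \<Longrightarrow> x < a \<Longrightarrow> g x \<noteq> x" "u < s" "q < a"
      "\<And>x. - q \<le> x \<Longrightarrow> x \<le> - s \<Longrightarrow> x + c/2 \<le> g x" "- a < x" "x < - u" for g u a x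
    proof (rule ccontr)
      assume "\<not> x < g x"
      moreover have "g x \<noteq> x" using H(2)[of "- x"] lifts_minus[OF H(1), of x] H by auto
      ultimately have "g x < x" by auto
      moreover have "- q < g (- q)" using H(5)[of "- q"] q near by auto
      moreover have "x \<noteq> - q" using calculation by auto
      ultimately obtain y where "min x (- q) < y" "y < max x (- q)" "g y = y"
        using lifts_ivt[OF H(1), of "min x (- q)" "max x (- q)"] by (cases "x < - q") auto
      then show False using H(2)[of "- y"] lifts_minus[OF H(1), of y] H q by auto
    qed
    show ?thesis
    proof (rule conj_on_reflect[OF _ g], rule conj_on_gap_up[where s = "- q" and q = "- s", OF g(1) _ _ _ g(2) _ _ _ _ _ _ _ _ _ _ _ _ d near(5) \<eta> sh])
      show "x < g1 x" if "- a1 < x" "x < - u1" for x using pos[OF g(1) g1(3) s(2) q(1) up1(1) that] by blast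
      show "x < g2 x" if "- a2 < x" "x < - u2" for x using pos[OF g(2) g2(3) s(4) q(3) up1(2) that] by blast
      show "- s \<le> (g1 ^^ m) (- q)" by (rule funpow_reach[OF g(1) up1(1)]) (use near q qs m in auto)
      show "- s \<le> (g2 ^^ m) (- q)" by (rule funpow_reach[OF g(2) up1(2)]) (use near q qs m in auto)
    qed (use s q g1 g2 lifts_minus[OF g(1)] lifts_minus[OF g(2)] in auto)
  qed
qed

text \<open>The interval \<open>[0, DA]\<close> is cut at the points \<open>(j + 1/2)\<kappa>\<close>.  The pieces on which \<open>f - id\<close> changes sign
  (and the two ends) contain all fixed points of the maps near \<open>f\<close>, and there the maps are conjugated
  by insertion; between consecutive such pieces they are conjugated along orbits.\<close>

lemma conj_on_tame:
  fixes n D :: nat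
  assumes tame: "tame f A n \<kappa> c" and \<kappa>: "\<kappa> \<le> \<epsilon>" and D: "D > 0"
    and h: "h1 \<in> lifts (real D * A)" "h2 \<in> lifts (real D * A)" "\<tau> > 0"
    and g: "g1 = thicken \<tau> h1" "g2 = thicken \<tau> h2"
    and near: "\<And>x. \<bar>h1 x - f x\<bar> + \<tau> \<le> \<delta>" "\<And>x. \<bar>h2 x - f x\<bar> + \<tau> \<le> \<delta>" "\<delta> \<le> c/2"
    and \<eta>: "\<eta> > 0"
    and sh: "\<And>x y k. \<bar>x - y\<bar> \<le> 2 * \<delta> \<Longrightarrow> k \<le> m \<Longrightarrow> \<bar>(g1 ^^ k) x - (g2 ^^ k) y\<bar> \<le> \<epsilon>"
    and m: "A \<le> real m * (c/2)"
  shows "conj_on \<eta> \<epsilon> g1 g2 0 (real D * A) 0 (real D * A)"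
proof -
  have f: "f \<in> lifts A" "A > 0" and n: "n > 0" "\<kappa> > 0" "\<kappa> \<le> \<epsilon>" "A = real n * \<kappa>" and c: "c > 0"
    using tame \<kappa> by (auto simp: tame_def)
  define B where "B = real D * A"
  have B: "B > 0" "B = real (D * n) * \<kappa>" using D f n by (simp_all add: B_def)
  note h = h[folded B_def]
  define t :: "nat \<Rightarrow> real" where "t j = (real j + 1/2) * \<kappa>" for j
  have t1: "t (Suc j) = t j + \<kappa>" for j by (simp add: t_def algebra_simps)
  have tp: "t j > 0" "t j \<ge> \<kappa>/2" for j
  proof -
    have "0 \<le> real j * \<kappa>" using n by simp
    then show "t j > 0" "t j \<ge> \<kappa>/2" using n by (auto simp: t_def distrib_right intro: add_nonneg_pos)
  qed
  have tne: "t j + c \<le> f (t j) \<or> f (t j) \<le> t j - c" for j 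
  proof -
    have "(of_int (int j) + 1/2) * \<kappa> = t j" by (simp add: t_def)
    then show ?thesis using tame unfolding tame_def by metis
  qed
  have tup: "x + c \<le> f x" if "t j < f (t j)" "t (Suc j) < f (t (Suc j))" "t j \<le> x" "x \<le> t (Suc j)" for j x
  proof -
    have e: "t (Suc j) = (of_int (int j) + 3/2) * \<kappa>" by (simp add: t_def algebra_simps)
    have "(of_int (int j) + 1/2) * \<kappa> = t j" by (simp add: t_def)
    then show ?thesis using tame that unfolding tame_def e by metis
  qed
  have tdn: "f x \<le> x - c" if "f (t j) < t j" "f (t (Suc j)) < t (Suc j)" "t j \<le> x" "x \<le> t (Suc j)" for j x
  proof -
    have e: "t (Suc j) = (of_int (int j) + 3/2) * \<kappa>" by (simp add: t_def algebra_simps)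
    have "(of_int (int j) + 1/2) * \<kappa> = t j" by (simp add: t_def)
    then show ?thesis using tame that unfolding tame_def e by metis
  qed
  have g': "g1 \<in> lifts B" "g2 \<in> lifts B" using thicken_lifts[OF _ B(1) h(3)] h g by auto
  have \<delta>: "\<delta> \<ge> 0" "\<tau> \<le> \<delta>" using near(1)[of 0] h(3) by linarith+
  have gn: "\<bar>g1 x - f x\<bar> \<le> \<delta>" "\<bar>g2 x - f x\<bar> \<le> \<delta>" for x
    using near(1,2)[of x] thicken_near[OF h(3), of h1 x] thicken_near[OF h(3), of h2 x] unfolding g by linarith+
  have gne: "g1 x \<noteq> x" "g2 x \<noteq> x" if "x + c \<le> f x \<or> f x \<le> x - c" for x
    using gn[of x] near(3) c that by auto
  have ins: "conj_on \<eta> \<epsilon> g1 g2 a1 b1 a2 b2"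
    if "g1 a1 = a1" "g1 b1 = b1" "g2 a2 = a2" "g2 b2 = b2" "a1 < b1" "a2 < b2"
      "l \<le> a1" "l \<le> a2" "b1 \<le> l + \<kappa>" "b2 \<le> l + \<kappa>" for a1 a2 b1 b2 l
    using conj_on_insert[OF g' B(1) that(1-6) that(7-10)] n \<eta> by auto
  \<comment> \<open>The conjugacy is built up to u1 and u2, the last fixed points before
    \<open>t j\<close>, which lie in the cell that ends at \<open>t i\<close>. From
    \<open>t i\<close> to \<open>t j\<close> the drift of f has one direction; the gap stays pending
    until the next fixed points appear.\<close>
  define Inv where "Inv j \<longleftrightarrow> (\<exists>i u1 u2. i \<le> j \<and> t i - \<kappa> \<le> u1 \<and> u1 < t i \<and> t i - \<kappa> \<le> u2 \<and> u2 < t i \<and> 0 \<le> u1 \<and> 0 \<le> u2 \<and>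
     g1 u1 = u1 \<and> g2 u2 = u2 \<and> (\<forall>x. u1 < x \<and> x \<le> t j \<longrightarrow> g1 x \<noteq> x) \<and> (\<forall>x. u2 < x \<and> x \<le> t j \<longrightarrow> g2 x \<noteq> x) \<and>
     ((\<forall>x\<in>{t i..t j}. x + c \<le> f x) \<or> (\<forall>x\<in>{t i..t j}. f x \<le> x - c)) \<and> conj_on \<eta> \<epsilon> g1 g2 0 u1 0 u2)" for j
  have InvI: "Inv j"
    if "i \<le> j" "t i - \<kappa> \<le> u1" "u1 < t i" "t i - \<kappa> \<le> u2" "u2 < t i" "0 \<le> u1" "0 \<le> u2"
     "g1 u1 = u1" "g2 u2 = u2" "\<And>x. u1 < x \<Longrightarrow> x \<le> t j \<Longrightarrow> g1 x \<noteq> x" "\<And>x. u2 < x \<Longrightarrow> x \<le> t j \<Longrightarrow> g2 x \<noteq> x"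
     "(\<forall>x\<in>{t i..t j}. x + c \<le> f x) \<or> (\<forall>x\<in>{t i..t j}. f x \<le> x - c)" "conj_on \<eta> \<epsilon> g1 g2 0 u1 0 u2" for i j u1 u2
    unfolding Inv_def using that by (intro exI[of _ i] exI[of _ u1] exI[of _ u2] conjI) blast+
  \<comment> \<open>Closes the pending gap along orbits and treats the hulls of the next fixed
    points by insertion.\<close>
  have extend: "conj_on \<eta> \<epsilon> g1 g2 0 b1 0 b2"
    if inv: "Inv j" and ab: "g1 a1 = a1" "g1 b1 = b1" "g2 a2 = a2" "g2 b2 = b2" "a1 < b1" "a2 < b2"
      "t j < a1" "t j < a2" "b1 \<le> t j + \<kappa>" "b2 \<le> t j + \<kappa>"
      and nofix: "\<And>x. t j \<le> x \<Longrightarrow> x < a1 \<Longrightarrow> g1 x \<noteq> x" "\<And>x. t j \<le> x \<Longrightarrow> x < a2 \<Longrightarrow> g2 x \<noteq> x" for j a1 a2 b1 b2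
  proof -
    obtain i u1 u2 where u: "i \<le> j" "t i - \<kappa> \<le> u1" "u1 < t i" "t i - \<kappa> \<le> u2" "u2 < t i" "0 \<le> u1" "0 \<le> u2"
     "g1 u1 = u1" "g2 u2 = u2" "\<And>x. u1 < x \<Longrightarrow> x \<le> t j \<Longrightarrow> g1 x \<noteq> x" "\<And>x. u2 < x \<Longrightarrow> x \<le> t j \<Longrightarrow> g2 x \<noteq> x"
     "(\<forall>x\<in>{t i..t j}. x + c \<le> f x) \<or> (\<forall>x\<in>{t i..t j}. f x \<le> x - c)" "conj_on \<eta> \<epsilon> g1 g2 0 u1 0 u2"
      using inv unfolding Inv_def by blast
    have tij: "t i \<le> t j" using u(1) n by (simp add: t_def)
    have "conj_on \<eta> \<epsilon> g1 g2 u1 a1 u2 a2"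
    proof (rule conj_on_gap[OF f g' gn near(3) c \<delta>(1) u(8) ab(1) _ u(9) ab(3) _ _ u(3) _ u(5) ab(7) _ ab(8) _ tij _ u(12) sh m])
      show "g1 x \<noteq> x" if "u1 < x" "x < a1" for x using u(10)[of x] nofix(1)[of x] that by linarith
      show "g2 x \<noteq> x" if "u2 < x" "x < a2" for x using u(11)[of x] nofix(2)[of x] that by linarith
    qed (use u ab n \<eta> in linarith)+
    moreover have "conj_on \<eta> \<epsilon> g1 g2 a1 b1 a2 b2" by (rule ins[OF ab(1-6), of "t j"]) (use ab in auto)
    ultimately have "conj_on \<eta> \<epsilon> g1 g2 u1 b1 u2 b2" by (rule conj_on_join) (use u ab tij in linarith)+
    with u(13) show ?thesis by (rule conj_on_join) (use u ab tij in linarith)+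
  qed
  have inv: "Inv j" for j
  proof (induction j)
    case 0
    \<comment> \<open>The first piece is the half cell from 0 to \<open>t 0\<close>; as 0 is fixed
      by both maps, both hulls start at 0.\<close>
    obtain a1 b1 where 1: "0 \<le> a1" "a1 < b1" "b1 \<le> t 0" "g1 a1 = a1" "g1 b1 = b1" "\<And>y. 0 \<le> y \<Longrightarrow> y \<le> t 0 \<Longrightarrow> g1 y = y \<Longrightarrow> a1 \<le> y \<and> y \<le> b1"
      using thicken_cell[OF h(1) B(1) h(3), of 0 0 "t 0"] tp[of 0] h g by auto
    obtain a2 b2 where 2: "0 \<le> a2" "a2 < b2" "b2 \<le> t 0" "g2 a2 = a2" "g2 b2 = b2" "\<And>y. 0 \<le> y \<Longrightarrow> y \<le> t 0 \<Longrightarrow> g2 y = y \<Longrightarrow> a2 \<le> y \<and> y \<le> b2"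
      using thicken_cell[OF h(2) B(1) h(3), of 0 0 "t 0"] tp[of 0] h g by auto
    have a0: "a1 = 0" "a2 = 0" using 1(1) 2(1) 1(6)[of 0] 2(6)[of 0] tp(1)[of 0] g' by auto
    have "b1 \<noteq> t 0" "b2 \<noteq> t 0" using gne[OF tne, of 0] 1(5) 2(5) by auto
    then have b: "b1 < t 0" "b2 < t 0" using 1 2 by auto
    have t0: "t 0 = \<kappa>/2" by (simp add: t_def)
    have cj: "conj_on \<eta> \<epsilon> g1 g2 0 b1 0 b2"
      using ins[OF 1(4,5) 2(4,5) 1(2) 2(2), of 0] 1(1,3) 2(1,3) t0 n a0 by simp
    have fc:  "(\<forall>x\<in>{t 0..t 0}. x + c \<le> f x) \<or> (\<forall>x\<in>{t 0..t 0}. f x \<le> x - c)" using tne[of 0] by auto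
    have f1: "g1 x \<noteq> x" if "b1 < x" "x \<le> t 0" for x using 1(6)[of x] 1(1,2) that by auto
    have f2: "g2 x \<noteq> x" if "b2 < x" "x \<le> t 0" for x using 2(6)[of x] 2(1,2) that by auto
    have "0 \<le> b1" "0 \<le> b2" "t 0 - \<kappa> \<le> b1" "t 0 - \<kappa> \<le> b2" using 1(1,2) 2(1,2) t0 n by auto
    then show ?case using InvI[OF _ _ b(1) _ b(2) _ _ 1(5) 2(5) f1 f2 fc cj] by auto
  next
    case (Suc j)
    show ?case
    proof (cases "(t j < f (t j) \<and> t (Suc j) < f (t (Suc j))) \<or> (f (t j) < t j \<and> f (t (Suc j)) < t (Suc j))")
      case True
      \<comment> \<open>Without a sign change the cell prolongs the drift; its direction agrees with
        the earlier one because the two stretches share the cut point \<open>t j\<close>.\<close>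
      have T: "(\<forall>x\<in>{t j..t (Suc j)}. x + c \<le> f x) \<or> (\<forall>x\<in>{t j..t (Suc j)}. f x \<le> x - c)"
        using True tup[of j] tdn[of j] by auto
      obtain i u1 u2 where u: "i \<le> j" "t i - \<kappa> \<le> u1" "u1 < t i" "t i - \<kappa> \<le> u2" "u2 < t i" "0 \<le> u1" "0 \<le> u2"
       "g1 u1 = u1" "g2 u2 = u2" "\<And>x. u1 < x \<Longrightarrow> x \<le> t j \<Longrightarrow> g1 x \<noteq> x" "\<And>x. u2 < x \<Longrightarrow> x \<le> t j \<Longrightarrow> g2 x \<noteq> x"
       "(\<forall>x\<in>{t i..t j}. x + c \<le> f x) \<or> (\<forall>x\<in>{t i..t j}. f x \<le> x - c)" "conj_on \<eta> \<epsilon> g1 g2 0 u1 0 u2"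
        using Suc unfolding Inv_def by blast
      have tij: "t i \<le> t j" "t j \<le> t (Suc j)" using u(1) n by (simp_all add: t_def)
      have nf: "g1 x \<noteq> x" "g2 x \<noteq> x" if "t j \<le> x" "x \<le> t (Suc j)" for x using T that gne[of x] by auto
      have f1: "g1 x \<noteq> x" if "u1 < x" "x \<le> t (Suc j)" for x using u(10)[of x] nf(1)[of x] that by linarith
      have f2: "g2 x \<noteq> x" if "u2 < x" "x \<le> t (Suc j)" for x using u(11)[of x] nf(2)[of x] that by linarith
      have fc: "(\<forall>x\<in>{t i..t (Suc j)}. x + c \<le> f x) \<or> (\<forall>x\<in>{t i..t (Suc j)}. f x \<le> x - c)"
      proof -
        have s: "{t i..t (Suc j)} = {t i..t j} \<union> {t j..t (Suc j)}" using tij by auto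
        have "t j \<in> {t i..t j}" "t j \<in> {t j..t (Suc j)}" using tij by auto
        moreover have "\<not> (t j + c \<le> f (t j) \<and> f (t j) \<le> t j - c)" using c by linarith
        ultimately have "\<not> ((\<forall>x\<in>{t i..t j}. x + c \<le> f x) \<and> (\<forall>x\<in>{t j..t (Suc j)}. f x \<le> x - c))"
          "\<not> ((\<forall>x\<in>{t i..t j}. f x \<le> x - c) \<and> (\<forall>x\<in>{t j..t (Suc j)}. x + c \<le> f x))"
          by blast+
        then show ?thesis using u(12) T unfolding s by blast
      qed
      have "i \<le> Suc j" using u(1) by simp
      then show ?thesis by (rule InvI[OF _ u(2-9) f1 f2 fc u(13)])
    next
      case False
      then have opp: "(t j + c \<le> f (t j) \<and> f (t (Suc j)) \<le> t (Suc j) - c) \<or> (f (t j) \<le> t j - c \<and> t (Suc j) + c \<le> f (t (Suc j)))"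
        using tne[of j] tne[of "Suc j"] c by auto
      have tjj: "t j < t (Suc j)" using t1[of j] n by simp
      have hs: "(t j < hh (t j) \<and> hh (t (Suc j)) < t (Suc j)) \<or> (hh (t j) < t j \<and> t (Suc j) < hh (t (Suc j)))"
        if "\<And>x. \<bar>hh x - f x\<bar> + \<tau> \<le> \<delta>" for hh
        using opp that[of "t j"] that[of "t (Suc j)"] near(3) c h(3) by linarith
      \<comment> \<open>The fixed points are found for the maps before thickening, since that is
        what makes the hulls nondegenerate in \<open>thicken_cell\<close>.\<close>
      obtain x1 where x1: "t j < x1" "x1 < t (Suc j)" "h1 x1 = x1" using lifts_ivt[OF h(1) tjj hs[OF near(1)]] by blast
      obtain x2 where x2: "t j < x2" "x2 < t (Suc j)" "h2 x2 = x2" using lifts_ivt[OF h(2) tjj hs[OF near(2)]] by blast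
      obtain a1 b1 where 1: "t j \<le> a1" "a1 < b1" "b1 \<le> t (Suc j)" "g1 a1 = a1" "g1 b1 = b1" "\<And>y. t j \<le> y \<Longrightarrow> y \<le> t (Suc j) \<Longrightarrow> g1 y = y \<Longrightarrow> a1 \<le> y \<and> y \<le> b1"
        using thicken_cell[OF h(1) B(1) h(3), of "t j" x1 "t (Suc j)"] tjj x1 g by (metis less_imp_le)
      obtain a2 b2 where 2: "t j \<le> a2" "a2 < b2" "b2 \<le> t (Suc j)" "g2 a2 = a2" "g2 b2 = b2" "\<And>y. t j \<le> y \<Longrightarrow> y \<le> t (Suc j) \<Longrightarrow> g2 y = y \<Longrightarrow> a2 \<le> y \<and> y \<le> b2"
        using thicken_cell[OF h(2) B(1) h(3), of "t j" x2 "t (Suc j)"] tjj x2 g by (metis less_imp_le)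
      have "a1 \<noteq> t j" "a2 \<noteq> t j" "b1 \<noteq> t (Suc j)" "b2 \<noteq> t (Suc j)" using gne[OF tne, of j] gne[OF tne, of "Suc j"] 1 2 by auto
      then have st: "t j < a1" "t j < a2" "b1 < t (Suc j)" "b2 < t (Suc j)" using 1 2 by auto
      have cj: "conj_on \<eta> \<epsilon> g1 g2 0 b1 0 b2"
      proof (rule extend[OF Suc 1(4,5) 2(4,5) 1(2) 2(2) st(1,2)])
        show "g1 x \<noteq> x" if "t j \<le> x" "x < a1" for x using 1(6)[of x] 1(2,3) that by auto
        show "g2 x \<noteq> x" if "t j \<le> x" "x < a2" for x using 2(6)[of x] 2(2,3) that by auto
      qed (use 1(3) 2(3) t1[of j] in auto)
      have fc:  "(\<forall>x\<in>{t (Suc j)..t (Suc j)}. x + c \<le> f x) \<or> (\<forall>x\<in>{t (Suc j)..t (Suc j)}. f x \<le> x - c)" using tne[of "Suc j"] by auto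
      have f1: "g1 x \<noteq> x" if "b1 < x" "x \<le> t (Suc j)" for x using 1(6)[of x] 1(1,2) that by auto
      have f2: "g2 x \<noteq> x" if "b2 < x" "x \<le> t (Suc j)" for x using 2(6)[of x] 2(1,2) that by auto
      have "0 \<le> b1" "0 \<le> b2" "t (Suc j) - \<kappa> \<le> b1" "t (Suc j) - \<kappa> \<le> b2"
        using tp(1)[of j] st 1(1,2) 2(1,2) t1[of j] by auto
      then show ?thesis using InvI[OF order_refl _ st(3) _ st(4) _ _ 1(5) 2(5) f1 f2 fc cj] by auto
    qed
  qed
  \<comment> \<open>What remains is the half cell from \<open>t J\<close> to B; both maps fix B, so
    both hulls end there.\<close>
  obtain J where J: "D * n = Suc J" using D n by (metis nat_0_less_mult_iff gr0_implies_Suc)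
  have BJ: "B = t J + \<kappa>/2" using J by (simp add: B(2) t_def algebra_simps)
  have tB: "t J < B" using BJ n by simp
  obtain a1 b1 where 1: "t J \<le> a1" "a1 < b1" "b1 \<le> B" "g1 a1 = a1" "g1 b1 = b1" "\<And>y. t J \<le> y \<Longrightarrow> y \<le> B \<Longrightarrow> g1 y = y \<Longrightarrow> a1 \<le> y \<and> y \<le> b1"
    using thicken_cell[OF h(1) B(1) h(3), of "t J" B B] tB lifts_self[OF h(1)] g by (metis less_imp_le order_refl)
  obtain a2 b2 where 2: "t J \<le> a2" "a2 < b2" "b2 \<le> B" "g2 a2 = a2" "g2 b2 = b2" "\<And>y. t J \<le> y \<Longrightarrow> y \<le> B \<Longrightarrow> g2 y = y \<Longrightarrow> a2 \<le> y \<and> y \<le> b2"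
    using thicken_cell[OF h(2) B(1) h(3), of "t J" B B] tB lifts_self[OF h(2)] g by (metis less_imp_le order_refl)
  have b: "b1 = B" "b2 = B" using 1(3) 2(3) 1(6)[of B] 2(6)[of B] tB lifts_self[OF g'(1)] lifts_self[OF g'(2)] by auto
  have "a1 \<noteq> t J" "a2 \<noteq> t J" using gne[OF tne, of J] 1 2 by auto
  then have st: "t J < a1" "t J < a2" using 1 2 by auto
  have "conj_on \<eta> \<epsilon> g1 g2 0 b1 0 b2"
  proof (rule extend[OF inv 1(4,5) 2(4,5) 1(2) 2(2) st(1,2)])
    show "g1 x \<noteq> x" if "t J \<le> x" "x < a1" for x using 1(6)[of x] 1(2,3) that by auto
    show "g2 x \<noteq> x" if "t J \<le> x" "x < a2" for x using 2(6)[of x] 2(2,3) that by auto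
  qed (use 1(3) 2(3) BJ n in auto)
  then show ?thesis unfolding b B_def .
qed

text \<open>The quantifier over D stands inside: \<delta> must serve the maps of all deeper levels
  at once.\<close>

definition conj_nearby :: "real \<Rightarrow> real \<Rightarrow> real \<Rightarrow> (real \<Rightarrow> real) \<Rightarrow> bool" where
  "conj_nearby A \<epsilon> \<delta> F \<longleftrightarrow> (\<forall>D>0. \<forall>g1\<in>lifts (real D * A). \<forall>g2\<in>lifts (real D * A).
     (\<forall>x. \<bar>g1 x - F x\<bar> \<le> \<delta>) \<longrightarrow> (\<forall>x. \<bar>g2 x - F x\<bar> \<le> \<delta>) \<longrightarrow> (\<forall>\<eta>>0.
     \<exists>z1\<in>lifts (real D * A). \<exists>z2\<in>lifts (real D * A). \<exists>h\<in>lifts (real D * A).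
       (\<forall>x. \<bar>z1 x - g1 x\<bar> \<le> \<eta>) \<and> (\<forall>x. \<bar>z2 x - g2 x\<bar> \<le> \<eta>) \<and> (\<forall>x. \<bar>h x - x\<bar> \<le> \<epsilon>) \<and> h \<circ> z1 = z2 \<circ> h))"

lemma lifts_local_conj:
  assumes f: "f \<in> lifts A" and A: "A > 0" and \<epsilon>: "\<epsilon> > 0" and \<eta>: "\<eta> > 0"
  shows "\<exists>F\<in>lifts A. (\<forall>x. \<bar>F x - f x\<bar> \<le> \<eta>) \<and> (\<exists>\<delta>>0. conj_nearby A \<epsilon> \<delta> F)"
proof -
  obtain F n \<kappa> c where T: "tame F A n \<kappa> c" "\<kappa> \<le> \<epsilon>" and F2: "\<And>x. \<bar>F x - f x\<bar> \<le> \<eta>"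
    using tame_approx[OF f A \<eta> \<epsilon>] by blast
  have F: "F \<in> lifts A" and c: "c > 0" using T(1) by (auto simp: tame_def)
  \<comment> \<open>Each iterate gains at least c/2 and a gap is at most A long, so m iterates cross
    it; \<delta> is then taken from shadowing over m iterates.\<close>
  obtain m where m: "A \<le> real m * (c/2)" using reals_Archimedean3[of "c/2"] c by (metis half_gt_zero less_imp_le)
  obtain \<delta>0 where \<delta>0: "\<delta>0 > 0" "\<And>g1 g2 x y k. (\<forall>z. \<bar>g1 z - F z\<bar> \<le> \<delta>0) \<Longrightarrow> (\<forall>z. \<bar>g2 z - F z\<bar> \<le> \<delta>0) \<Longrightarrow> \<bar>x - y\<bar> \<le> 2 * \<delta>0 \<Longrightarrow> k \<le> m \<Longrightarrow>
    \<bar>(g1 ^^ k) x - (g2 ^^ k) y\<bar> \<le> \<epsilon>"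
    using iterates_shadow[OF F A \<epsilon>, of m] by metis
  define \<delta> where "\<delta> = min \<delta>0 (c/2)"
  have \<delta>: "\<delta> > 0" "\<delta> \<le> \<delta>0" "\<delta> \<le> c/2" using \<delta>0(1) c by (auto simp: \<delta>_def)
  have main: "\<exists>z1\<in>lifts (real D * A). \<exists>z2\<in>lifts (real D * A). \<exists>h\<in>lifts (real D * A).
       (\<forall>x. \<bar>z1 x - g1 x\<bar> \<le> \<eta>') \<and> (\<forall>x. \<bar>z2 x - g2 x\<bar> \<le> \<eta>') \<and> (\<forall>x. \<bar>h x - x\<bar> \<le> \<epsilon>) \<and> h \<circ> z1 = z2 \<circ> h"
    if D: "D > 0" and g: "g1 \<in> lifts (real D * A)" "g2 \<in> lifts (real D * A)"
      and n1: "\<And>x. \<bar>g1 x - F x\<bar> \<le> \<delta>/2" and n2: "\<And>x. \<bar>g2 x - F x\<bar> \<le> \<delta>/2" and \<eta>': "\<eta>' > 0" for D g1 g2 \<eta>'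
  proof -
    \<comment> \<open>Thickening may spend half of the closeness \<delta> to F and half of the final
      tolerance.\<close>
    define \<tau> where "\<tau> = min (\<delta>/2) (\<eta>'/2)"
    have \<tau>: "\<tau> > 0" "\<tau> \<le> \<delta>/2" "\<tau> \<le> \<eta>'/2" using \<delta> \<eta>' by (auto simp: \<tau>_def)
    have DA: "real D * A > 0" using D A by simp
    let ?k1 = "thicken \<tau> g1" and ?k2 = "thicken \<tau> g2"
    note tn = thicken_near[OF \<tau>(1)]
    have k: "\<bar>?k1 x - F x\<bar> \<le> \<delta>" "\<bar>?k2 x - F x\<bar> \<le> \<delta>" for x
      using tn[of g1 x] tn[of g2 x] n1[of x] n2[of x] \<tau> by linarith+
    have "conj_on (\<eta>'/2) \<epsilon> ?k1 ?k2 0 (real D * A) 0 (real D * A)"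
    proof (rule conj_on_tame[OF T D g \<tau>(1) refl refl _ _ \<delta>(3) _ _ m])
      show "\<bar>g1 x - F x\<bar> + \<tau> \<le> \<delta>" for x using n1[of x] \<tau> by linarith
      show "\<bar>g2 x - F x\<bar> + \<tau> \<le> \<delta>" for x using n2[of x] \<tau> by linarith
      show "\<bar>(?k1 ^^ k) x - (?k2 ^^ k) y\<bar> \<le> \<epsilon>" if "\<bar>x - y\<bar> \<le> 2 * \<delta>" "k \<le> m" for x y k
        using k \<delta>(2) that by (intro \<delta>0(2)) (auto intro: order_trans)
    qed (use \<eta>' in auto)
    from conj_on_lifts[OF thicken_lifts[OF g(1) DA \<tau>(1)] thicken_lifts[OF g(2) DA \<tau>(1)] DA this]
    obtain z1 z2 h where z: "z1\<in>lifts (real D * A)" "z2\<in>lifts (real D * A)" "h\<in>lifts (real D * A)"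
      "\<And>x. \<bar>z1 x - ?k1 x\<bar> \<le> \<eta>'/2" "\<And>x. \<bar>z2 x - ?k2 x\<bar> \<le> \<eta>'/2" "\<forall>x. \<bar>h x - x\<bar> \<le> \<epsilon>" "h \<circ> z1 = z2 \<circ> h" by blast
    have "\<bar>z1 x - g1 x\<bar> \<le> \<eta>'" "\<bar>z2 x - g2 x\<bar> \<le> \<eta>'" for x
      using z(4,5)[of x] tn[of g1 x] tn[of g2 x] \<tau> by linarith+
    then show ?thesis using z by blast
  qed
  show ?thesis
    by (rule bexI[OF _ F], rule conjI, use F2 in blast, rule exI[of _ "\<delta>/2"]) (use main \<delta> in \<open>auto simp: conj_nearby_def\<close>)
qed

section \<open>The ray and the level homeomorphisms of the Knaster continuum\<close>

lemma fold1_continuous: "continuous_on S fold1"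
proof -
  have "fold1 = tent 1" by (simp add: tent_eq_fold1 fun_eq_iff)
  then show ?thesis using continuous_on_tent by metis
qed

lemma fold1_0 [simp]: "fold1 0 = 0" by (rule fold1_id) auto

lemma fold1_int: "fold1 (of_int k) = 0 \<or> fold1 (of_int k) = 1"
proof (cases "even k")
  case True
  then obtain j where "k = 2 * j" by (elim evenE)
  then show ?thesis using fold1_period[of 0 j] by simp
next
  case False
  then obtain j where "k = 2 * j + 1" by (elim oddE)
  then show ?thesis using fold1_period[of 1 j] fold1_id[of 1] by (simp add: add.commute)
qed

text \<open>Both values are distances to even integers; according to the signs inside the absolute
  values, either the difference or the sum of u and v is near an even integer.\<close>

lemma fold1_close:
  assumes "\<bar>fold1 u - fold1 v\<bar> \<le> \<delta>"
  obtains j :: int where "\<bar>(u - v) - 2 * of_int j\<bar> \<le> \<delta> \<or> \<bar>(u + v) - 2 * of_int j\<bar> \<le> \<delta>"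
proof -
  obtain a :: int where a: "fold1 u = \<bar>u - 2 * of_int a\<bar>" by (rule fold1_attained)
  obtain b :: int where b: "fold1 v = \<bar>v - 2 * of_int b\<bar>" by (rule fold1_attained)
  have "\<bar>(u - v) - 2 * of_int (a - b)\<bar> \<le> \<delta> \<or> \<bar>(u + v) - 2 * of_int (a + b)\<bar> \<le> \<delta>"
    using assms a b by (auto simp: abs_if split: if_splits)
  then show ?thesis using that by blast
qed

definition ray_homeo :: "(real \<Rightarrow> real) \<Rightarrow> bool" where
  "ray_homeo f \<longleftrightarrow> continuous_on {0..} f \<and> f 0 = 0 \<and> (\<forall>s t. 0 \<le> s \<longrightarrow> s < t \<longrightarrow> f s < f t)"

text \<open>Closeness of \<open>fold1 u\<close> and \<open>fold1 v\<close> forces \<open>u - v\<close> or \<open>u + v\<close> to be near an even integer.  While \<open>u - v\<close>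
  leaves the neighbourhood of \<open>0\<close>, the increasing function \<open>u + v\<close> is trapped, and \<open>u - v\<close> cannot vary more than \<open>u + v\<close>.\<close>

lemma fold1_shadow:
  assumes f: "ray_homeo f" and g: "ray_homeo g" and \<delta>: "0 < \<delta>" "\<delta> \<le> 1/8"
    and close: "\<And>t. t \<ge> 0 \<Longrightarrow> \<bar>fold1 (f t) - fold1 (g t)\<bar> \<le> \<delta>" and t: "t \<ge> 0"
  shows "\<bar>f t - g t\<bar> < 4 * \<delta>"
proof (rule ccontr)
  define D where "D s = \<bar>f s - g s\<bar>" for s
  define S where "S s = f s + g s" for s
  assume "\<not> ?thesis"
  then have t1: "4 * \<delta> \<le> D t" by (simp add: D_def)
  have cf: "continuous_on {0..} f" "continuous_on {0..} g" using f g by (auto simp: ray_homeo_def)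
  have cD: "continuous_on {0..b} D" and cS: "continuous_on {0..b} S" for b
    unfolding D_def[abs_def] S_def[abs_def]
    by (intro continuous_intros continuous_on_subset[OF cf(1)] continuous_on_subset[OF cf(2)]; auto)+
  have D0: "D 0 = 0" using f g by (simp add: D_def ray_homeo_def)
  have mono: "S s < S s'" "\<bar>D s' - D s\<bar> \<le> S s' - S s" if "0 \<le> s" "s < s'" for s s'
    using f g that unfolding ray_homeo_def S_def D_def by (smt (verit))+
  have cl: "compact {s \<in> {0..b}. c \<le> D s}" "compact {s \<in> {0..b}. D s \<le> c}" for b c
    using continuous_on_closed_Collect_le[OF continuous_on_const cD[of b]]
      continuous_on_closed_Collect_le[OF cD[of b] continuous_on_const]
    by (auto simp: compact_eq_bounded_closed intro: bounded_subset[OF bounded_closed_interval[of 0 b]])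
  \<comment> \<open>t2 is the first time at which D reaches 4\<delta>, and t0 below is the last time
    before it at which D is at most \<delta>. After t0, D exceeds \<delta>, and as 4\<delta> \<le>
    1/2 it is also far from the nonzero even integers, so S must be near an even integer.\<close>
  obtain t2 where t2: "0 \<le> t2" "t2 \<le> t" "4 * \<delta> \<le> D t2" "\<And>s. 0 \<le> s \<Longrightarrow> s \<le> t \<Longrightarrow> 4 * \<delta> \<le> D s \<Longrightarrow> t2 \<le> s"
    using compact_attains_inf[OF cl(1)[of t "4 * \<delta>"]] t t1 by force
  have D2: "D t2 = 4 * \<delta>"
  proof (rule ccontr)
    assume "D t2 \<noteq> 4 * \<delta>"
    then have "4 * \<delta> < D t2" using t2 by simp
    then obtain s where "0 \<le> s" "s \<le> t2" "D s = 4 * \<delta>"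
      using IVT'[of D 0 "4 * \<delta>" t2] D0 \<delta> cD[of t2] t2(1) by auto
    then show False using t2(2) t2(4)[of s] \<open>D t2 \<noteq> 4 * \<delta>\<close> by (cases "s = t2") auto
  qed
  obtain t0 where t0: "0 \<le> t0" "t0 \<le> t2" "D t0 \<le> \<delta>" "\<And>s. 0 \<le> s \<Longrightarrow> s \<le> t2 \<Longrightarrow> D s \<le> \<delta> \<Longrightarrow> s \<le> t0"
    using compact_attains_sup[OF cl(2)[of t2 \<delta>]] D0 \<delta> t2(1) by force
  have lt: "t0 < t2" using t0 D2 \<delta> by (cases "t0 = t2") auto
  have near: "\<exists>j::int. \<bar>S s - 2 * of_int j\<bar> \<le> \<delta>" if s: "t0 < s" "s \<le> t2" for s
  proof -
    have "D s > \<delta>" using t0(1) t0(4)[of s] s by force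
    moreover have "D s \<le> 4 * \<delta>" using t2(2) t2(4)[of s] s t0(1) D2 by (cases "s = t2") force+
    ultimately have no: "\<not> \<bar>(f s - g s) - 2 * of_int j\<bar> \<le> \<delta>" for j :: int
    proof -
      assume D: "\<delta> < D s" "D s \<le> 4 * \<delta>"
      show ?thesis
      proof (cases "j = 0")
        case False
        then have "\<bar>real_of_int j\<bar> \<ge> 1" by linarith
        then show ?thesis using D \<delta> by (auto simp: D_def abs_if split: if_splits)
      qed (use D in \<open>simp add: D_def\<close>)
    qed
    obtain j :: int where "\<bar>(f s - g s) - 2 * of_int j\<bar> \<le> \<delta> \<or> \<bar>(f s + g s) - 2 * of_int j\<bar> \<le> \<delta>"
      using fold1_close[OF close[of s]] s t0(1) by auto
    then show ?thesis using no unfolding S_def by blast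
  qed
  \<comment> \<open>To approach another even integer, the continuous function S would have to pass
    an odd one.\<close>
  have small: "S t2 - S s \<le> 2 * \<delta>" if s: "t0 < s" "s < t2" for s
  proof -
    obtain i j :: int where ij: "\<bar>S s - 2 * of_int i\<bar> \<le> \<delta>" "\<bar>S t2 - 2 * of_int j\<bar> \<le> \<delta>"
      using near[of s] near[of t2] s by auto
    have "S s < S t2" using mono(1)[of s t2] s t0(1) by simp
    have "S t2 < 2 * of_int i + 1"
    proof (rule ccontr)
      assume "\<not> ?thesis"
      moreover have "S s \<le> 2 * of_int i + 1" using ij(1) \<delta> by linarith
      moreover have "continuous_on {s..t2} S" using s t0(1) by (intro continuous_on_subset[OF cS[of t2]]) auto
      ultimately obtain r where r: "s \<le> r" "r \<le> t2" "S r = 2 * of_int i + 1"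
        using IVT'[of S s "2 * of_int i + 1" t2] s by auto
      then obtain k :: int where "\<bar>S r - 2 * of_int k\<bar> \<le> \<delta>" using near[of r] s by auto
      then have "\<bar>of_int (2 * i + 1 - 2 * k) :: real\<bar> \<le> \<delta>" using r by simp
      then have "\<bar>2 * i + 1 - 2 * k\<bar> < 1" using \<delta> by linarith
      then show False by presburger
    qed
    then have "j \<le> i" using ij(2) \<delta> by linarith
    then have "(of_int j :: real) \<le> of_int i" by simp
    then show ?thesis using ij by linarith
  qed
  have "S t2 - S t0 \<le> 2 * \<delta>"
  proof (rule ccontr)
    assume n: "\<not> ?thesis"
    define w where "w = (S t0 + (S t2 - 2 * \<delta>)) / 2"
    have w: "S t0 < w" "w < S t2 - 2 * \<delta>" using n by (auto simp: w_def)
    have "continuous_on {t0..t2} S" using t0(1) by (intro continuous_on_subset[OF cS[of t2]]) auto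
    then obtain s where s: "t0 \<le> s" "s \<le> t2" "S s = w" using IVT'[of S t0 w t2] w \<delta> lt by auto
    then have "t0 < s" "s < t2" using w \<delta> by (auto simp: less_le)
    then show False using small[of s] s w by simp
  qed
  \<comment> \<open>D rises by at least 3\<delta> from t0 to t2, but S rises by at most
    2\<delta>.\<close>
  then show False using mono(2)[OF t0(1) lt] D2 t0(3) \<delta> by linarith
qed

text \<open>Degree 2 is singled out because its tent map sends 1 to 0, which excludes end points
  other than 0, see \<open>interior_coord\<close>.\<close>

locale tower =
  fixes p :: "nat \<Rightarrow> nat"
  assumes p2: "\<And>n. n \<ge> 1 \<Longrightarrow> p n \<ge> 2" and inf_even: "\<And>m. \<exists>n>m. p n = 2"
begin

definition P :: "nat \<Rightarrow> nat" where "P n = (\<Prod>i=1..n. p i)"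

lemma P_0 [simp]: "P 0 = 1" and P_Suc: "P (Suc n) = P n * p (Suc n)"
  by (simp_all add: P_def)

lemma P_ge: "2 ^ n \<le> P n"
proof (induction n)
  case (Suc n)
  then show ?case using mult_mono[OF Suc p2[of "Suc n"]] by (simp add: P_Suc mult.commute)
qed simp

lemma P_pos [simp]: "P n > 0"
  using P_ge[of n] by (meson less_le_trans zero_less_numeral zero_less_power)

lemma P_nonzero [simp]: "P n \<noteq> 0"
  using P_pos[of n] by linarith

lemma P_unbounded: obtains n where "x \<le> real (P n)" "n \<ge> m"
proof -
  obtain k where k: "x < 2 ^ k" using real_arch_pow[of 2 x] by auto
  have "(2::real) ^ k \<le> 2 ^ (k + m)" by (intro power_increasing) auto
  also have "\<dots> \<le> real (P (k + m))" using P_ge[of "k + m"] by (metis of_nat_le_iff of_nat_numeral of_nat_power)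
  finally have "x \<le> real (P (k + m))" using k by linarith
  then show ?thesis using that[of "k + m"] by simp
qed

lemma P_dvd: assumes "m \<le> k" obtains q where "P k = q * P m" "q > 0"
proof -
  have "P m dvd P k" using assms by (induction k rule: dec_induct) (auto simp: P_Suc)
  then obtain q where "P k = q * P m" by (metis dvd_def mult.commute)
  then show ?thesis using that P_pos[of k] by (cases "q = 0") auto
qed

abbreviation K :: "(nat \<Rightarrow> real) set" where "K \<equiv> knaster p"

lemma K_iff: "x \<in> K \<longleftrightarrow> (\<forall>n. 0 \<le> x n \<and> x n \<le> 1) \<and> (\<forall>n. fold1 (real (p (Suc n)) * x (Suc n)) = x n)"
proof -
  have "(\<forall>n\<ge>1. tent (p n) (x n) = x (n - 1)) \<longleftrightarrow> (\<forall>n. tent (p (Suc n)) (x (Suc n)) = x n)"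
    (is "?l \<longleftrightarrow> ?r")
  proof
    assume ?l
    then show ?r by (metis diff_Suc_1 le_add1 plus_1_eq_Suc)
  next
    assume r: ?r
    show ?l
    proof (intro allI impI)
      fix n :: nat assume "n \<ge> 1"
      then obtain k where "n = Suc k" by (cases n) auto
      then show "tent (p n) (x n) = x (n - 1)" using r by simp
    qed
  qed
  then show ?thesis by (auto simp: knaster_def tent_eq_fold1)
qed

lemma K_range: "x \<in> K \<Longrightarrow> 0 \<le> x n" "x \<in> K \<Longrightarrow> x n \<le> 1"
  by (auto simp: K_iff)

lemma P_ratio: assumes "m \<le> k" obtains q where "real (P k) / real (P m) = real q" "P k = q * P m" "q > 0"
proof -
  obtain q where q: "P k = q * P m" "q > 0" by (rule P_dvd[OF assms])
  have "real (P k) / real (P m) = real q" using q P_pos[of m] by simp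
  then show ?thesis using that q by blast
qed

lemma K_down: assumes "x \<in> K" "m \<le> k" shows "fold1 (real (P k) * x k / real (P m)) = x m"
  using assms(2)
proof (induction k rule: dec_induct)
  case base
  then show ?case using fold1_id K_range[OF assms(1)] P_pos[of m] by simp
next
  case (step k)
  obtain q where q: "real (P k) / real (P m) = real q" using P_ratio[OF step(1)] by metis
  have "x m = fold1 (real q * x k)" using step q by (metis times_divide_eq_left)
  also have "\<dots> = fold1 (real q * fold1 (real (p (Suc k)) * x (Suc k)))" using assms(1) by (simp add: K_iff)
  also have "\<dots> = fold1 (real q * (real (p (Suc k)) * x (Suc k)))" by (rule fold1_mult_fold1)
  also have "real q * (real (p (Suc k)) * x (Suc k)) = real (P (Suc k)) * x (Suc k) / real (P m)"
    by (simp add: q[symmetric] P_Suc)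
  finally show ?case by simp
qed

text \<open>As soon as P m \<ge> t \<ge> 0 the fold does nothing and t is P m times the coordinate;
  smaller indices are obtained by folding.\<close>

definition ray :: "real \<Rightarrow> nat \<Rightarrow> real" where "ray t m = fold1 (t / real (P m))"

lemma ray_K: "ray t \<in> K"
proof -
  have "fold1 (real (p (Suc n)) * fold1 (t / real (P (Suc n)))) = fold1 (t / real (P n))" for n
    using p2[of "Suc n"] by (simp add: fold1_mult_fold1 P_Suc)
  then show ?thesis by (auto simp: K_iff ray_def fold1_range)
qed

lemma ray_0: "ray 0 = (\<lambda>_. 0)" by (simp add: ray_def fun_eq_iff)

lemma ray_inj: assumes "0 \<le> s" "0 \<le> t" "ray s = ray t" shows "s = t"
proof -
  obtain n where n: "max s t \<le> real (P n)" using P_unbounded by blast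
  have "ray s n = s / real (P n)" "ray t n = t / real (P n)"
    unfolding ray_def by (rule fold1_id; use n assms(1,2) P_pos[of n] in auto)+
  moreover have "ray s n = ray t n" by (simp only: assms(3))
  ultimately have "s / real (P n) = t / real (P n)" by linarith
  then show ?thesis using P_pos[of n] by simp
qed

lemma ray_continuous: "continuous_on S ray"
proof (rule continuous_on_coordinatewise_then_product)
  show "continuous_on S (\<lambda>t. ray t m)" for m
    unfolding ray_def by (intro continuous_on_compose2[OF fold1_continuous[of UNIV]] continuous_intros) auto
qed

lemma K_eq_ray: assumes "x \<in> K" "m \<le> k" shows "ray (real (P k) * x k) m = x m"
  using K_down[OF assms] by (simp add: ray_def)

text \<open>Up to a small tail the metric sees finitely many coordinates, and one deep coordinate M
  determines these with Lipschitz constant at most P M. The factor 4 absorbs the factor 2 in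
  \<open>dist_fun_le_dist_first_terms\<close>.\<close>

lemma K_dist:
  assumes "\<epsilon> > 0"
  shows "\<exists>M \<delta>. \<delta> > 0 \<and> (\<forall>x\<in>K. \<forall>y\<in>K. \<bar>x M - y M\<bar> \<le> \<delta> \<longrightarrow> dist x y \<le> \<epsilon>)"
proof -
  obtain N where N: "(1/2::real) ^ N < \<epsilon>/2" using real_arch_pow_inv[of "\<epsilon>/2" "1/2"] assms by auto
  define M where "M = Max ((from_nat :: nat \<Rightarrow> nat) ` {..N})"
  have M: "from_nat n \<le> M" if "n \<le> N" for n unfolding M_def by (rule Max_ge) (use that in auto)
  have "dist x y \<le> \<epsilon>" if xy: "x \<in> K" "y \<in> K" "\<bar>x M - y M\<bar> \<le> \<epsilon> / (4 * real (P M))" for x y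
  proof -
    have "dist (x j) (y j) \<le> \<epsilon>/4" if j: "j \<le> M" for j
    proof -
      have "\<bar>x j - y j\<bar> \<le> \<bar>real (P M) * x M / real (P j) - real (P M) * y M / real (P j)\<bar>"
        using fold1_lipschitz K_down[OF xy(1) j] K_down[OF xy(2) j] by metis
      also have "\<dots> = real (P M) / real (P j) * \<bar>x M - y M\<bar>"
        by (simp add: abs_mult right_diff_distrib[symmetric] diff_divide_distrib[symmetric])
      also have "\<dots> \<le> real (P M) * \<bar>x M - y M\<bar>"
        using P_pos[of j] by (intro mult_right_mono) (auto simp: divide_le_eq mult_le_cancel_left1 Suc_le_eq)
      also have "\<dots> \<le> real (P M) * (\<epsilon> / (4 * real (P M)))" using xy by (intro mult_left_mono) auto
      also have "\<dots> = \<epsilon>/4" using P_pos[of M] by simp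
      finally show ?thesis by (simp add: dist_real_def)
    qed
    then have "Max {dist (x (from_nat n)) (y (from_nat n))|n. n \<le> N} \<le> \<epsilon>/4"
      using M by (intro Max.boundedI) auto
    then show ?thesis using dist_fun_le_dist_first_terms[of x y N] N by linarith
  qed
  then show ?thesis using assms P_pos[of M] by (intro exI[of _ M] exI[of _ "\<epsilon> / (4 * real (P M))"]) auto
qed

lemma uniformly_continuous_on_K:
  fixes f :: "(nat \<Rightarrow> real) \<Rightarrow> 'b::metric_space"
  assumes "continuous_on K f" "\<epsilon> > 0"
  shows "\<exists>\<delta>>0. \<forall>x\<in>K. \<forall>y\<in>K. dist x y < \<delta> \<longrightarrow> dist (f x) (f y) < \<epsilon>"
  using compact_uniformly_continuous[OF assms(1) compact_knaster] assms(2) unfolding uniformly_continuous_on_def by blast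

lemma coord_continuous: "continuous_on S (\<lambda>x::nat \<Rightarrow> real. x m)"
  by (rule continuous_on_subset[OF continuous_on_product_coordinates]) simp

lemma P_lifts: assumes "\<phi> \<in> lifts (real (P n))" "n \<le> k" shows "\<phi> \<in> lifts (real (P k))"
proof -
  obtain q where "P k = q * P n" by (rule P_dvd[OF assms(2)])
  then show ?thesis using lifts_mult[OF assms(1), of q] by simp
qed

text \<open>Folding at scale P k before applying \<phi> changes t by a symmetry that commutes with
  \<phi>; at the coarser index m it becomes a symmetry of \<open>fold1\<close>, because P m divides
  P k.\<close>

lemma fold1_lift:
  assumes "\<phi> \<in> lifts (real (P k))" "m \<le> k"
  shows "fold1 (\<phi> (real (P k) * fold1 (t / real (P k))) / real (P m)) = fold1 (\<phi> t / real (P m))"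
proof -
  obtain q where q: "P k = q * P m" by (rule P_dvd[OF assms(2)])
  obtain s j where sj: "s = 1 \<or> s = -1" "fold1 (t / real (P k)) = s * (t / real (P k)) + 2 * of_int j" by (rule fold1_repr)
  have "real (P k) * fold1 (t / real (P k)) = s * t + 2 * of_int j * real (P k)"
    using P_pos[of k] by (simp add: sj(2) field_simps)
  then have "\<phi> (real (P k) * fold1 (t / real (P k))) / real (P m) = (s * \<phi> t + 2 * of_int j * real (P k)) / real (P m)"
    using lifts_sym[OF assms(1) sj(1)] by simp
  also have "\<dots> = s * (\<phi> t / real (P m)) + 2 * of_int (j * int q)"
    using P_pos[of m] by (simp add: q field_simps)
  finally show ?thesis by (simp only: fold1_sym[OF sj(1)])
qed

text \<open>\<phi> acts on the unfolded coordinate P k * x k. The index n + m is a uniform choice of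
  k with n \<le> k and m \<le> k; by \<open>hat_eq\<close> every such k gives the same
  value.\<close>

definition hat :: "nat \<Rightarrow> (real \<Rightarrow> real) \<Rightarrow> (nat \<Rightarrow> real) \<Rightarrow> nat \<Rightarrow> real" where
  "hat n \<phi> = (\<lambda>x\<in>K. \<lambda>m. fold1 (\<phi> (real (P (n + m)) * x (n + m)) / real (P m)))"

lemma hat_eq:
  assumes "\<phi> \<in> lifts (real (P n))" "x \<in> K" "n \<le> k" "m \<le> k"
  shows "hat n \<phi> x m = fold1 (\<phi> (real (P k) * x k) / real (P m))"
proof -
  have up: "fold1 (\<phi> (real (P i) * x i) / real (P m)) = fold1 (\<phi> (real (P j) * x j) / real (P m))"
    if "n \<le> i" "m \<le> i" "i \<le> j" for i j
    using fold1_lift[OF P_lifts[OF assms(1) that(1)] that(2), of "real (P j) * x j"] K_down[OF assms(2) that(3)] by simp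
  have "hat n \<phi> x m = fold1 (\<phi> (real (P (n + m)) * x (n + m)) / real (P m))" using assms by (simp add: hat_def)
  also have "\<dots> = fold1 (\<phi> (real (P (n + m + k)) * x (n + m + k)) / real (P m))" by (rule up) auto
  also have "\<dots> = fold1 (\<phi> (real (P k) * x k) / real (P m))" using up[of k "n + m + k"] assms by simp
  finally show ?thesis .
qed

lemma hat_level: assumes "\<phi> \<in> lifts (real (P n))" "n \<le> n'" shows "hat n' \<phi> = hat n \<phi>"
proof
  fix x
  show "hat n' \<phi> x = hat n \<phi> x"
  proof (cases "x \<in> K")
    case True
    show ?thesis
    proof
      fix m
      show "hat n' \<phi> x m = hat n \<phi> x m"
        using hat_eq[OF assms(1) True, of "n' + m" m] hat_eq[OF P_lifts[OF assms] True, of "n' + m" m] assms(2) by simp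
    qed
  qed (simp add: hat_def)
qed

lemma hat_K: assumes "\<phi> \<in> lifts (real (P n))" "x \<in> K" shows "hat n \<phi> x \<in> K"
proof -
  have "fold1 (real (p (Suc m)) * hat n \<phi> x (Suc m)) = hat n \<phi> x m" for m
  proof -
    let ?k = "n + Suc m"
    have "fold1 (real (p (Suc m)) * hat n \<phi> x (Suc m)) = fold1 (real (p (Suc m)) * fold1 (\<phi> (real (P ?k) * x ?k) / real (P (Suc m))))"
      using hat_eq[OF assms, of ?k "Suc m"] by simp
    also have "\<dots> = fold1 (\<phi> (real (P ?k) * x ?k) / real (P m))"
      unfolding fold1_mult_fold1 using p2[of "Suc m"] by (simp add: P_Suc)
    finally show ?thesis using hat_eq[OF assms, of ?k m] by simp
  qed
  moreover have "0 \<le> hat n \<phi> x m \<and> hat n \<phi> x m \<le> 1" for m using assms by (simp add: hat_def fold1_range)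
  ultimately show ?thesis by (simp add: K_iff)
qed

text \<open>\<phi> preserves [0, P k], so from level n on the fold acts trivially.\<close>

lemma hat_deep: assumes "\<phi> \<in> lifts (real (P n))" "x \<in> K" "n \<le> k" shows "real (P k) * hat n \<phi> x k = \<phi> (real (P k) * x k)"
proof -
  have l: "\<phi> \<in> lifts (real (P k))" by (rule P_lifts[OF assms(1,3)])
  have "0 \<le> real (P k) * x k" "real (P k) * x k \<le> real (P k)"
    using K_range[OF assms(2)] by (auto simp: mult_left_le)
  then have "0 \<le> \<phi> (real (P k) * x k)" "\<phi> (real (P k) * x k) \<le> real (P k)"
    using lifts_mono_le[OF l, of 0] lifts_mono_le[OF l, of _ "real (P k)"] lifts_0[OF l] lifts_self[OF l] by fastforce+
  then have "fold1 (\<phi> (real (P k) * x k) / real (P k)) = \<phi> (real (P k) * x k) / real (P k)"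
    using P_pos[of k] by (intro fold1_id) auto
  then show ?thesis using hat_eq[OF assms(1,2,3) order_refl] P_pos[of k] by simp
qed

lemma hat_comp:
  assumes "\<phi> \<in> lifts (real (P n))" "\<psi> \<in> lifts (real (P n))" "x \<in> K"
  shows "hat n \<phi> (hat n \<psi> x) = hat n (\<phi> \<circ> \<psi>) x"
proof
  fix m
  show "hat n \<phi> (hat n \<psi> x) m = hat n (\<phi> \<circ> \<psi>) x m"
    using hat_eq[OF assms(1) hat_K[OF assms(2,3)], of "n + m" m] hat_eq[OF lifts_comp[OF assms(1,2)] assms(3), of "n + m" m]
      hat_deep[OF assms(2,3), of "n + m"] by simp
qed

lemma hat_id: assumes "x \<in> K" shows "hat n (\<lambda>t. t) x = x"
  using hat_eq[OF lifts_id assms] K_down[OF assms] by (metis (no_types, lifting) ext le_add1 le_add2)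

lemma hat_ray: assumes "\<phi> \<in> lifts (real (P n))" shows "hat n \<phi> (ray t) = ray (\<phi> t)"
proof
  fix m
  have "hat n \<phi> (ray t) m = fold1 (\<phi> (real (P (n + m)) * fold1 (t / real (P (n + m)))) / real (P m))"
    using hat_eq[OF assms ray_K, of "n + m" m t] by (simp add: ray_def)
  also have "\<dots> = ray (\<phi> t) m" unfolding ray_def by (rule fold1_lift[OF P_lifts[OF assms]]) auto
  finally show "hat n \<phi> (ray t) m = ray (\<phi> t) m" .
qed

lemma hat_continuous: assumes "\<phi> \<in> lifts (real (P n))" shows "continuous_on K (hat n \<phi>)"
proof -
  have "continuous_on K (\<lambda>x m. fold1 (\<phi> (real (P (n + m)) * x (n + m)) / real (P m)))"
    by (rule continuous_on_coordinatewise_then_product)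
      (intro continuous_on_compose2[OF fold1_continuous[of UNIV]] continuous_on_compose2[OF lifts_continuous[OF assms, of UNIV]]
        continuous_on_divide continuous_on_mult continuous_on_const coord_continuous; simp)
  then show ?thesis by (rule continuous_on_eq) (simp add: hat_def)
qed

lemma hat_inverse:
  assumes "\<phi> \<in> lifts (real (P n))" "x \<in> K"
  shows "hat n (inv_into UNIV \<phi>) (hat n \<phi> x) = x" "hat n \<phi> (hat n (inv_into UNIV \<phi>) x) = x"
proof -
  have b: "bij \<phi>" by (rule lifts_bij[OF assms(1)])
  have "inv_into UNIV \<phi> \<circ> \<phi> = (\<lambda>t. t)" "\<phi> \<circ> inv_into UNIV \<phi> = (\<lambda>t. t)"
    using b by (auto simp: fun_eq_iff bij_is_inj bij_is_surj surj_f_inv_f)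
  then show "hat n (inv_into UNIV \<phi>) (hat n \<phi> x) = x" "hat n \<phi> (hat n (inv_into UNIV \<phi>) x) = x"
    using hat_comp[OF assms(1) lifts_inv[OF assms(1)] assms(2)] hat_comp[OF lifts_inv[OF assms(1)] assms(1,2)] hat_id[OF assms(2)] by simp_all
qed

lemma hat_homeos: assumes "\<phi> \<in> lifts (real (P n))" shows "hat n \<phi> \<in> homeos K"
  by (rule homeosI_inverse[OF _ hat_continuous[OF assms] hat_continuous[OF lifts_inv[OF assms]]])
    (use hat_K[OF assms] hat_K[OF lifts_inv[OF assms]] hat_inverse[OF assms] in \<open>auto simp: hat_def\<close>)

lemma hat_near:
  assumes "\<phi> \<in> lifts (real (P n))" "\<psi> \<in> lifts (real (P n))" "x \<in> K" "\<And>t. \<bar>\<phi> t - \<psi> t\<bar> \<le> e"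
  shows "\<bar>hat n \<phi> x m - hat n \<psi> x m\<bar> \<le> e / real (P m)"
proof -
  let ?t = "real (P (n + m)) * x (n + m)"
  have "\<bar>hat n \<phi> x m - hat n \<psi> x m\<bar> \<le> \<bar>\<phi> ?t / real (P m) - \<psi> ?t / real (P m)\<bar>"
    using fold1_lipschitz assms(3) by (simp add: hat_def)
  also have "\<dots> = \<bar>\<phi> ?t - \<psi> ?t\<bar> / real (P m)" by (simp add: diff_divide_distrib[symmetric])
  also have "\<dots> \<le> e / real (P m)" using assms(4) by (intro divide_right_mono) auto
  finally show ?thesis .
qed

end

section \<open>Homeomorphisms near the identity\<close>

context tower
begin

text \<open>A larger variation would let the unfolded coordinate n pass two consecutive integers.
  There coordinate 0 takes the values 0 and 1, which cannot both be within less than 1/2 of its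
  starting value.\<close>

lemma path_variation:
  fixes \<gamma> :: "real \<Rightarrow> nat \<Rightarrow> real"
  assumes c: "continuous_on {0..T} \<gamma>" and K: "\<And>t. t \<in> {0..T} \<Longrightarrow> \<gamma> t \<in> K"
    and st: "s \<in> {0..T}" "t \<in> {0..T}" "\<And>r. r \<in> closed_segment s t \<Longrightarrow> \<bar>\<gamma> r 0 - \<gamma> s 0\<bar> < 1/2"
  shows "\<bar>\<gamma> s n - \<gamma> t n\<bar> \<le> 2 / real (P n)"
proof (rule ccontr)
  assume n: "\<not> ?thesis"
  define f where "f r = real (P n) * \<gamma> r n" for r
  define lo hi where "lo = min (f s) (f t)" and "hi = max (f s) (f t)"
  have "2 < real (P n) * \<bar>\<gamma> s n - \<gamma> t n\<bar>" using n P_pos[of n] by (simp add: field_simps)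
  also have "\<dots> = \<bar>f s - f t\<bar>" by (simp add: f_def abs_mult right_diff_distrib[symmetric])
  finally have gap: "hi - lo > 2" by (simp add: hi_def lo_def)
  have "continuous_on {0..T} (\<lambda>r. \<gamma> r n)" using c by (rule continuous_on_product_then_coordinatewise)
  then have cf: "continuous_on {0..T} f" unfolding f_def by (intro continuous_intros)
  have sub: "closed_segment s t \<subseteq> {0..T}" using st by (intro closed_segment_subset) auto
  have "connected (f ` closed_segment s t)"
    by (intro connected_continuous_image continuous_on_subset[OF cf sub] convex_connected) auto
  moreover have "lo \<in> f ` closed_segment s t" "hi \<in> f ` closed_segment s t"
    by (auto simp: lo_def hi_def min_def max_def)
  ultimately have ivl: "v \<in> f ` closed_segment s t" if "lo \<le> v" "v \<le> hi" for v
    using that connectedD_interval by blast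
  define k where "k = \<lceil>lo\<rceil>"
  have k: "lo \<le> of_int k" "of_int k + 1 \<le> hi" using gap unfolding k_def by linarith+
  have "of_int k \<in> f ` closed_segment s t" "of_int k + 1 \<in> f ` closed_segment s t"
    using k by (intro ivl; linarith)+
  then obtain r1 r2 where r1: "r1 \<in> closed_segment s t" "f r1 = of_int k"
    and r2: "r2 \<in> closed_segment s t" "f r2 = of_int k + 1" by (metis imageE)
  have z: "\<gamma> r 0 = fold1 (f r)" if "r \<in> closed_segment s t" for r
    using K_down[OF K[of r], of 0 n] that sub by (auto simp: f_def)
  have "\<bar>fold1 (of_int k + 1) - fold1 (of_int k)\<bar> = 1" using fold1_near_int[of "of_int k + 1" k] by simp
  then have "\<bar>\<gamma> r2 0 - \<gamma> r1 0\<bar> = 1" using z[OF r1(1)] z[OF r2(1)] r1(2) r2(2) by simp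
  then show False using st(3)[OF r1(1)] st(3)[OF r2(1)] by linarith
qed

text \<open>A time step of length e moves every unfolded coordinate by at most 2, so N steps from 0
  keep it below 2N at all levels. From a level with P n0 \<ge> 2N on, no folding occurs, the
  unfolded coordinates agree, and their common value is the parameter on the ray.\<close>

lemma path_lift:
  fixes \<gamma> :: "real \<Rightarrow> nat \<Rightarrow> real"
  assumes T: "T \<ge> 0" and c: "continuous_on {0..T} \<gamma>" and K: "\<And>t. t \<in> {0..T} \<Longrightarrow> \<gamma> t \<in> K" and z: "\<gamma> 0 = ray 0"
  shows "\<exists>\<theta>. continuous_on {0..T} \<theta> \<and> (\<forall>t\<in>{0..T}. \<theta> t \<ge> 0 \<and> \<gamma> t = ray (\<theta> t))"
proof -
  have cn: "continuous_on {0..T} (\<lambda>r. \<gamma> r n)" for n using c by (rule continuous_on_product_then_coordinatewise)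
  have "uniformly_continuous_on {0..T} (\<lambda>r. \<gamma> r 0)" by (intro compact_uniformly_continuous cn) auto
  then obtain d where d: "d > 0" "\<And>s t. s \<in> {0..T} \<Longrightarrow> t \<in> {0..T} \<Longrightarrow> dist t s < d \<Longrightarrow> dist (\<gamma> t 0) (\<gamma> s 0) < 1/2"
    unfolding uniformly_continuous_on_def by (metis half_gt_zero_iff zero_less_one)
  define e where "e = d / 2"
  have e: "e > 0" "e < d" using d by (auto simp: e_def)
  have var: "\<bar>\<gamma> s n - \<gamma> t n\<bar> \<le> 2 / real (P n)" if "s \<in> {0..T}" "t \<in> {0..T}" "\<bar>s - t\<bar> \<le> e" for s t n
  proof (rule path_variation[OF c K that(1,2)])
    fix r assume r: "r \<in> closed_segment s t"
    then have "r \<in> {0..T}" using that closed_segment_subset[of s "{0..T}" t] by auto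
    moreover have "dist r s < d" using r that e by (auto simp: closed_segment_eq_real_ivl dist_real_def split: if_splits)
    ultimately show "\<bar>\<gamma> r 0 - \<gamma> s 0\<bar> < 1/2" using d(2)[of s r] that by (simp add: dist_real_def)
  qed
  obtain N :: nat where N: "T \<le> real N * e" using reals_Archimedean3[OF e(1)] less_imp_le by blast
  have bnd: "\<gamma> t n \<le> 2 * real j / real (P n)" if "t \<in> {0..T}" "t \<le> real j * e" for t n j
    using that
  proof (induction j arbitrary: t)
    case 0
    then have "t = 0" by auto
    then show ?case using z by (simp add: ray_0)
  next
    case (Suc j)
    let ?s = "max 0 (t - e)"
    have "\<gamma> ?s n \<le> 2 * real j / real (P n)" using Suc e by (intro Suc.IH) (auto simp: algebra_simps)
    moreover have "\<bar>\<gamma> ?s n - \<gamma> t n\<bar> \<le> 2 / real (P n)" using Suc e by (intro var) auto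
    moreover have "2 * real (Suc j) / real (P n) = 2 * real j / real (P n) + 2 / real (P n)"
      by (simp add: add_divide_distrib[symmetric])
    ultimately show ?case by linarith
  qed
  obtain n0 where n0: "2 * real N \<le> real (P n0)" using P_unbounded by blast
  define \<theta> where "\<theta> t = real (P n0) * \<gamma> t n0" for t
  have stab: "real (P n) * \<gamma> t n = \<theta> t" if n: "n0 \<le> n" and t: "t \<in> {0..T}" for n t
    using n
  proof (induction n rule: dec_induct)
    case base then show ?case by (simp add: \<theta>_def)
  next
    case (step n)
    have g: "\<gamma> t \<in> K" using K t by auto
    have "real (P n0) \<le> real (P n)" using P_dvd[OF step(1)] by (metis P_pos dvd_imp_le dvd_triv_right of_nat_le_iff)
    then have "2 * real N \<le> real (P n)" using n0 by linarith
    moreover have "\<gamma> t (Suc n) \<le> 2 * real N / real (P (Suc n))" using bnd[OF t, of N] N t by auto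
    ultimately have "\<gamma> t (Suc n) \<le> real (P n) / real (P (Suc n))"
      by (meson divide_right_mono of_nat_0_le_iff order_trans)
    then have "\<gamma> t (Suc n) \<le> 1 / real (p (Suc n))" using P_pos[of n] by (simp add: P_Suc)
    then have "real (p (Suc n)) * \<gamma> t (Suc n) \<le> 1" using p2[of "Suc n"] by (simp add: field_simps)
    moreover have "0 \<le> real (p (Suc n)) * \<gamma> t (Suc n)" using K_range[OF g] by simp
    ultimately have "\<gamma> t n = real (p (Suc n)) * \<gamma> t (Suc n)" using g fold1_id by (metis K_iff)
    then show ?case using step by (simp add: P_Suc)
  qed
  have "\<gamma> t = ray (\<theta> t)" if t: "t \<in> {0..T}" for t
  proof
    fix m
    show "\<gamma> t m = ray (\<theta> t) m"
      using K_down[OF K[OF t], of m "max n0 m"] stab[of "max n0 m" t] t by (simp add: ray_def)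
  qed
  moreover have "continuous_on {0..T} \<theta>" unfolding \<theta>_def by (intro continuous_intros cn)
  moreover have "\<theta> t \<ge> 0" if "t \<in> {0..T}" for t using K_range[OF K[OF that]] by (simp add: \<theta>_def)
  ultimately show ?thesis by blast
qed

text \<open>If all coordinates were 0 or 1, the steps of degree 2, which send both values to 0,
  would give zeros at infinitely many indices and hence everywhere. A coordinate strictly inside
  forces the deeper ones inside, as integers fold to 0 or 1.\<close>

lemma interior_coord:
  assumes x: "x \<in> K" "x \<noteq> ray 0"
  obtains n where "\<And>m. m \<ge> n \<Longrightarrow> 0 < x m \<and> x m < 1"
proof -
  have "\<exists>n. x n \<noteq> 0 \<and> x n \<noteq> 1"
  proof (rule ccontr)
    assume n: "\<not> ?thesis"
    have "x m = 0" for m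
    proof -
      obtain k where k: "k > m" "p k = 2" using inf_even by blast
      then obtain j where j: "k = Suc j" "m \<le> j" by (cases k) auto
      have "x j = fold1 (2 * x (Suc j))" using x(1) k j by (metis K_iff of_nat_numeral)
      moreover have "fold1 2 = 0" using fold1_period[of 0 1] by simp
      ultimately have "x j = 0" using n by (metis fold1_0 mult_cancel_left1 mult_zero_right)
      then show ?thesis using K_down[OF x(1) j(2)] by simp
    qed
    then show False using x(2) by (auto simp: ray_0)
  qed
  then obtain n where n: "x n \<noteq> 0" "x n \<noteq> 1" by blast
  have "0 < x m \<and> x m < 1" if nm: "m \<ge> n" for m
  proof -
    obtain q where q: "real (P m) / real (P n) = real q" using P_ratio[OF nm] by metis
    have d: "x n = fold1 (real q * x m)" using K_down[OF x(1) nm] q by (metis times_divide_eq_left)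
    have "x m \<noteq> 0" using d n by auto
    moreover have "x m \<noteq> 1" using d n fold1_int[of "int q"] by auto
    ultimately show ?thesis using K_range[OF x(1), of m] by linarith
  qed
  then show ?thesis using that by blast
qed

text \<open>Inverts each tent map on the lap that contains the coordinate of x, so that the
  resulting arc passes through x.\<close>

fun branch :: "nat \<Rightarrow> (nat \<Rightarrow> real) \<Rightarrow> nat \<Rightarrow> real \<Rightarrow> real" where
  "branch n x 0 s = s"
| "branch n x (Suc i) s =
     (let d = real (p (n + Suc i)); j = \<lfloor>d * x (n + Suc i)\<rfloor>
      in if even j then (of_int j + branch n x i s) / d else (of_int j + 1 - branch n x i s) / d)"

text \<open>Coordinate n serves as the parameter of the arc, which makes it injective; since this
  coordinate of x is strictly inside [0,1], x is an inner point of the arc.\<close>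

lemma arc_through:
  assumes x: "x \<in> K" "x \<noteq> ray 0"
  obtains c s0 where "0 < s0" "s0 < (1::real)" "continuous_on {0..1} c" "inj_on c {0..1}" "c s0 = x" "\<And>s. s \<in> {0..1} \<Longrightarrow> c s \<in> K"
proof -
  obtain n where n: "\<And>m. m \<ge> n \<Longrightarrow> 0 < x m \<and> x m < 1" using interior_coord[OF x] by blast
  have x1: "x m = fold1 (real (p (Suc m)) * x (Suc m))" for m using x(1) by (simp add: K_iff)
  have fl: "fold1 (of_int j + a) = a" if "even j" "0 \<le> a" "a \<le> 1" for j a
  proof -
    obtain i where "j = 2 * i" using \<open>even j\<close> by (elim evenE)
    then show ?thesis using fold1_period[of a i] fold1_id that by (simp add: add.commute)
  qed
  have fl': "fold1 (of_int j + 1 - a) = a" if "odd j" "0 \<le> a" "a \<le> 1" for j a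
  proof -
    have "even (j + 1)" using that by simp
    then obtain i where i: "j + 1 = 2 * i" by (elim evenE)
    have "real_of_int (j + 1) = real_of_int (2 * i)" by (simp only: i)
    then have "of_int j + 1 - a = - a + 2 * of_int i" by simp
    then show ?thesis using fold1_period[of "- a" i] fold1_id that by simp
  qed
  have range: "0 \<le> branch n x i s \<and> branch n x i s \<le> 1" if s: "0 \<le> s" "s \<le> 1" for i s
  proof (induction i)
    case (Suc i)
    define d j where "d = p (n + Suc i)" and "j = \<lfloor>real d * x (n + Suc i)\<rfloor>"
    have d: "d \<ge> 2" using p2[of "n + Suc i"] by (simp add: d_def)
    have xx: "0 < x (n + Suc i)" "x (n + Suc i) < 1" using n[of "n + Suc i"] by auto
    have "0 \<le> j" using d xx by (simp add: j_def)
    moreover have "real d * x (n + Suc i) < real d" using d xx by simp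
    then have "j < int d" unfolding j_def by linarith
    ultimately have "0 \<le> real_of_int j" "real_of_int j + 1 \<le> real d" by linarith+
    then have 1: "0 \<le> real_of_int j + branch n x i s" "real_of_int j + branch n x i s \<le> real d"
      "0 \<le> real_of_int j + 1 - branch n x i s" "real_of_int j + 1 - branch n x i s \<le> real d" using Suc by linarith+
    have b: "branch n x (Suc i) s = (if even j then (of_int j + branch n x i s) / real d else (of_int j + 1 - branch n x i s) / real d)"
      by (simp only: branch.simps Let_def d_def j_def)
    show ?case using d 1 unfolding b by (auto simp: divide_le_eq)
  qed (use s in simp)
  have step: "fold1 (real (p (n + Suc i)) * branch n x (Suc i) s) = branch n x i s" if s: "0 \<le> s" "s \<le> 1" for i s
  proof -
    define d j where "d = p (n + Suc i)" and "j = \<lfloor>real d * x (n + Suc i)\<rfloor>"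
    have d: "d > 0" using p2[of "n + Suc i"] by (simp add: d_def)
    have b: "branch n x (Suc i) s = (if even j then (of_int j + branch n x i s) / real d else (of_int j + 1 - branch n x i s) / real d)"
      by (simp only: branch.simps Let_def d_def j_def)
    have "real d * branch n x (Suc i) s = (if even j then of_int j + branch n x i s else of_int j + 1 - branch n x i s)"
      using d unfolding b by simp
    then show ?thesis unfolding d_def[symmetric]
      using fl[of j "branch n x i s"] fl'[of j "branch n x i s"] range[OF s, of i] by simp
  qed
  have at: "branch n x i (x n) = x (n + i)" for i
  proof (induction i)
    case (Suc i)
    define d j where "d = p (n + Suc i)" and "j = \<lfloor>real d * x (n + Suc i)\<rfloor>"
    have d: "d > 0" using p2[of "n + Suc i"] by (simp add: d_def)
    have "x (n + i) = tent d (x (n + Suc i))" using x1[of "n + i"] by (simp add: d_def tent_eq_fold1)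
    also have "\<dots> = (if even j then real d * x (n + Suc i) - of_int j else 1 + of_int j - real d * x (n + Suc i))"
      by (simp add: tent_def j_def Let_def)
    finally have 1: "x (n + i) = (if even j then real d * x (n + Suc i) - of_int j else 1 + of_int j - real d * x (n + Suc i))" .
    have b: "branch n x (Suc i) (x n) = (if even j then (of_int j + branch n x i (x n)) / real d else (of_int j + 1 - branch n x i (x n)) / real d)"
      by (simp only: branch.simps Let_def d_def j_def)
    show ?case using d 1 unfolding b Suc by (simp only:) auto
  qed simp
  have cb: "continuous_on {0..1} (branch n x i)" for i
  proof (induction i)
    case 0 then show ?case by (simp add: continuous_on_id)
  next
    case (Suc i)
    have "p (n + Suc i) \<noteq> 0" using p2[of "n + Suc i"] by simp
    then show ?case using Suc unfolding branch.simps(2)[abs_def] Let_def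
      by (cases "even \<lfloor>real (p (n + Suc i)) * x (n + Suc i)\<rfloor>") (auto intro!: continuous_intros simp: if_distrib)
  qed
  define c where "c s m = (if m \<ge> n then branch n x (m - n) s else fold1 (real (P n) * s / real (P m)))" for s m
  have cn: "c s n = s" for s by (simp add: c_def)
  have "continuous_on {0..1} c"
  proof (rule continuous_on_coordinatewise_then_product)
    fix m
    show "continuous_on {0..1} (\<lambda>s. c s m)"
    proof (cases "m \<ge> n")
      case True then show ?thesis using cb by (simp add: c_def)
    next
      case False
      have "continuous_on {0..1} (\<lambda>s. fold1 (real (P n) * s / real (P m)))"
        by (intro continuous_on_compose2[OF fold1_continuous[of UNIV]] continuous_intros) auto
      then show ?thesis using False by (simp add: c_def)
    qed
  qed
  moreover have "inj_on c {0..1}" by (rule inj_onI) (metis cn)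
  moreover have "c (x n) = x"
  proof
    fix m show "c (x n) m = x m"
      using at[of "m - n"] K_down[OF x(1), of m n] by (auto simp: c_def)
  qed
  moreover have "c s \<in> K" if s: "s \<in> {0..1}" for s
  proof -
    have "0 \<le> c s m \<and> c s m \<le> 1" for m using range[of s "m - n"] s fold1_range by (auto simp: c_def)
    moreover have "fold1 (real (p (Suc m)) * c s (Suc m)) = c s m" for m
    proof -
      consider "m \<ge> n" | "Suc m = n" | "Suc m < n" by linarith
      then show ?thesis
      proof cases
        case 1
        then show ?thesis using step[of s "m - n"] s by (simp add: c_def Suc_diff_le)
      next
        case 2
        have "p (Suc m) > 0" using p2[of "Suc m"] by simp
        then have "real (p (Suc m)) * s = real (P (Suc m)) * s / real (P m)" using P_pos[of m] by (simp add: P_Suc)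
        then show ?thesis using 2 by (auto simp: c_def)
      next
        case 3
        have "p (Suc m) > 0" using p2[of "Suc m"] by simp
        then show ?thesis using 3 P_pos[of m] by (simp add: c_def fold1_mult_fold1 P_Suc)
      qed
    qed
    ultimately show ?thesis by (simp add: K_iff)
  qed
  ultimately show ?thesis using that[of "x n" c] n[of n] by auto
qed

text \<open>The point \<open>ray 0\<close> is the only end point of \<open>K\<close>: two injective paths issuing from it overlap.\<close>

lemma homeo_ray_0:
  assumes h: "h \<in> homeos K" shows "h (ray 0) = ray 0"
proof (rule ccontr)
  assume ne: "h (ray 0) \<noteq> ray 0"
  obtain g where g: "continuous_on K g" "\<forall>x\<in>K. g x \<in> K \<and> g (h x) = x \<and> h (g x) = x" using homeos_inverse_exists[OF h] by blast
  obtain c s0 where c: "0 < s0" "s0 < (1::real)" "continuous_on {0..1} c" "inj_on c {0..1}" "c s0 = h (ray 0)" "\<And>s. s \<in> {0..1} \<Longrightarrow> c s \<in> K"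
    using arc_through[OF homeos_mem[OF h ray_K] ne] by metis
  define T where "T = min s0 (1 - s0)"
  have T: "T > 0" using c by (simp add: T_def)
  have inj: "s = t" if "g (c s) = g (c t)" "s \<in> {0..1}" "t \<in> {0..1}" for s t
    using that g(2) c(4,6) by (metis inj_onD)
  have lift: "\<exists>\<theta>. continuous_on {0..T} \<theta> \<and> (\<forall>t\<in>{0..T}. \<theta> t \<ge> 0 \<and> g (c (s0 + \<sigma> * t)) = ray (\<theta> t))"
    if \<sigma>: "\<sigma> = 1 \<or> \<sigma> = - 1" for \<sigma> :: real
  proof (rule path_lift)
    have m: "s0 + \<sigma> * t \<in> {0..1}" if "t \<in> {0..T}" for t using that \<sigma> c(1,2) by (auto simp: T_def)
    have "continuous_on {0..T} (\<lambda>t. s0 + \<sigma> * t)" by (intro continuous_intros)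
    then have "continuous_on {0..T} (\<lambda>t. c (s0 + \<sigma> * t))"
      by (rule continuous_on_compose2[OF c(3)]) (use m in auto)
    then show "continuous_on {0..T} (\<lambda>t. g (c (s0 + \<sigma> * t)))"
      by (rule continuous_on_compose2[OF g(1)]) (use m c(6) in auto)
    show "g (c (s0 + \<sigma> * t)) \<in> K" if "t \<in> {0..T}" for t using m[OF that] c(6) g(2) by auto
    show "g (c (s0 + \<sigma> * 0)) = ray 0" using c(5) g(2) ray_K[of 0] by simp
  qed (use T in simp)
  obtain \<theta>1 where 1: "continuous_on {0..T} \<theta>1" "\<And>t. t \<in> {0..T} \<Longrightarrow> \<theta>1 t \<ge> 0 \<and> g (c (s0 + t)) = ray (\<theta>1 t)" using lift[of 1] by auto
  obtain \<theta>2 where 2: "continuous_on {0..T} \<theta>2" "\<And>t. t \<in> {0..T} \<Longrightarrow> \<theta>2 t \<ge> 0 \<and> g (c (s0 - t)) = ray (\<theta>2 t)" using lift[of "- 1"] by auto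
  have g0: "g (c s0) = ray 0" using c(5) g(2) ray_K[of 0] by simp
  have z: "\<theta>1 0 = 0" "\<theta>2 0 = 0" using 1(2)[of 0] 2(2)[of 0] g0 T ray_inj by force+
  have Tm: "s0 + t \<in> {0..1} \<and> s0 - t \<in> {0..1}" if "t \<in> {0..T}" for t using that c(1,2) by (auto simp: T_def)
  have clash: False if "s \<in> {0..T}" "t \<in> {0..T}" "\<theta>1 s = \<theta>2 t" "s + t > 0" for s t
    using inj[of "s0 + s" "s0 - t"] 1(2)[of s] 2(2)[of t] Tm[of s] Tm[of t] that by auto
  show False
  proof (cases "\<theta>1 T \<le> \<theta>2 T")
    case True
    then obtain t where "0 \<le> t" "t \<le> T" "\<theta>2 t = \<theta>1 T" using IVT'[of \<theta>2 0 "\<theta>1 T" T] z 1(2)[of T] 2(1) T by auto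
    then show False using clash[of T t] T by auto
  next
    case False
    then obtain t where "0 \<le> t" "t \<le> T" "\<theta>1 t = \<theta>2 T" using IVT'[of \<theta>1 0 "\<theta>2 T" T] z 2(2)[of T] 1(1) T by auto
    then show False using clash[of t T] T by auto
  qed
qed

text \<open>The parameter \<phi> t is chosen pointwise; by \<open>ray_inj\<close> it agrees with
  every lift of a bounded piece, hence is continuous. Being injective, nonnegative and 0 at 0, it
  increases.\<close>

lemma homeo_ray:
  assumes h: "h \<in> homeos K"
  obtains \<phi> where "ray_homeo \<phi>" "\<And>t. t \<ge> 0 \<Longrightarrow> h (ray t) = ray (\<phi> t)"
proof -
  have ex: "\<exists>\<theta>. continuous_on {0..T} \<theta> \<and> (\<forall>t\<in>{0..T}. \<theta> t \<ge> 0 \<and> h (ray t) = ray (\<theta> t))" if "T \<ge> 0" for T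
  proof (rule path_lift[OF that])
    show "continuous_on {0..T} (\<lambda>t. h (ray t))"
      by (rule continuous_on_compose2[OF homeos_continuous[OF h] ray_continuous]) (use ray_K in auto)
  qed (use homeos_mem[OF h] ray_K homeo_ray_0[OF h] in auto)
  define \<phi> where "\<phi> t = (SOME \<theta>. \<theta> \<ge> 0 \<and> h (ray t) = ray \<theta>)" for t
  have \<phi>: "\<phi> t \<ge> 0 \<and> h (ray t) = ray (\<phi> t)" if "t \<ge> 0" for t
    unfolding \<phi>_def by (rule someI_ex) (use ex[OF that] that in auto)
  have c: "continuous_on {0..T} \<phi>" for T
  proof (cases "T \<ge> 0")
    case True
    obtain \<theta> where \<theta>: "continuous_on {0..T} \<theta>" "\<And>t. t \<in> {0..T} \<Longrightarrow> \<theta> t \<ge> 0 \<and> h (ray t) = ray (\<theta> t)" using ex[OF True] by blast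
    show ?thesis by (rule continuous_on_eq[OF \<theta>(1)]) (use \<theta>(2) \<phi> ray_inj in force)
  qed auto
  have z: "\<phi> 0 = 0" using \<phi>[of 0] homeo_ray_0[OF h] ray_inj[of "\<phi> 0" 0] by simp
  obtain g where g: "\<forall>x\<in>K. g x \<in> K \<and> g (h x) = x \<and> h (g x) = x" using homeos_inverse_exists[OF h] by blast
  have inj: "s = t" if "\<phi> s = \<phi> t" "s \<ge> 0" "t \<ge> 0" for s t
  proof -
    have "h (ray s) = h (ray t)" using that \<phi>[of s] \<phi>[of t] by simp
    then have "g (h (ray s)) = g (h (ray t))" by simp
    then have "ray s = ray t" using g ray_K by simp
    then show ?thesis using ray_inj that by blast
  qed
  have "\<phi> s < \<phi> t" if st: "0 \<le> s" "s < t" for s t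
  proof (rule ccontr)
    assume "\<not> \<phi> s < \<phi> t"
    then obtain r where "0 \<le> r" "r \<le> s" "\<phi> r = \<phi> t" using IVT'[of \<phi> 0 "\<phi> t" s] z \<phi>[of t] c st by auto
    then show False using inj[of r t] st by auto
  qed
  moreover have "continuous_on {0..} \<phi>"
    unfolding continuous_on_eq_continuous_within
  proof
    fix x :: real assume x: "x \<in> {0..}"
    have "continuous (at x within {0..x + 1}) \<phi>" using c[of "x + 1"] x by (simp add: continuous_on_eq_continuous_within)
    moreover have "at x within {0..x + 1} = at x within {0..}"
      by (rule at_within_nhd[of _ "{..<x + 1}"]) (use x in auto)
    ultimately show "continuous (at x within {0..}) \<phi>" by simp
  qed
  ultimately show ?thesis using that[of \<phi>] z \<phi> by (auto simp: ray_homeo_def)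
qed

lemma lifts_ray_homeo: "\<phi> \<in> lifts A \<Longrightarrow> ray_homeo \<phi>"
  by (simp add: ray_homeo_def lifts_continuous lifts_mono)

text \<open>With \<open>N = P n\<close>, the map \<open>h\<close> nearly factors through the coordinate \<open>n\<close>, so its ray coordinate \<open>\<phi>\<close> is nearly
  symmetric about \<open>N\<close>; comparing \<open>\<phi>\<^sup>-\<^sup>1 N\<close> with its mirror image \<open>2N - \<phi>\<^sup>-\<^sup>1 N\<close> shows that \<open>\<phi> N\<close> is near \<open>N\<close>.\<close>

lemma homeo_approx:
  assumes h: "h \<in> homeos K" and near: "\<And>x. x \<in> K \<Longrightarrow> \<bar>h x 0 - x 0\<bar> \<le> 1/16" and \<eta>: "\<eta> > 0"
  shows "\<exists>n. \<exists>\<psi>\<in>lifts (real (P n)). \<forall>x\<in>K. \<bar>hat n \<psi> x M - h x M\<bar> \<le> \<eta>"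
proof -
  obtain \<phi> where \<phi>: "ray_homeo \<phi>" "\<And>t. t \<ge> 0 \<Longrightarrow> h (ray t) = ray (\<phi> t)" using homeo_ray[OF h] by blast
  \<comment> \<open>\<open>fold1_shadow\<close> turns the bound 1/16 in coordinate 0 into a bound of
    4/16 along the whole ray.\<close>
  have id: "\<bar>\<phi> t - t\<bar> < 1/4" if "t \<ge> 0" for t
  proof -
    have "\<bar>fold1 (\<phi> s) - fold1 s\<bar> \<le> 1/16" if "s \<ge> 0" for s
      using near[OF ray_K, of s] \<phi>(2)[OF that] by (simp add: ray_def)
    then show ?thesis using fold1_shadow[OF \<phi>(1) lifts_ray_homeo[OF lifts_id], of "1/16" t] that by simp
  qed
  define \<eta>' where "\<eta>' = min (\<eta>/2) (1/4)"
  have \<eta>': "\<eta>' > 0" "\<eta>' \<le> \<eta>/2" "\<eta>' \<le> 1/4" using \<eta> by (auto simp: \<eta>'_def)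
  have "continuous_on K (\<lambda>x. h x M)"
    using homeos_continuous[OF h] by (rule continuous_on_product_then_coordinatewise)
  from uniformly_continuous_on_K[OF this \<eta>'(1)]
  obtain d where d: "d > 0" "\<forall>x\<in>K. \<forall>y\<in>K. dist x y < d \<longrightarrow> dist (h x M) (h y M) < \<eta>'"
    by (elim exE conjE)
  obtain n0 \<delta> where n0: "\<delta> > 0" "\<forall>x\<in>K. \<forall>y\<in>K. \<bar>x n0 - y n0\<bar> \<le> \<delta> \<longrightarrow> dist x y \<le> d/2" using K_dist[of "d/2"] d(1) by auto
  define n where "n = max n0 M"
  have nM: "M \<le> n" "n0 \<le> n" by (auto simp: n_def)
  have fac: "\<bar>h x M - h y M\<bar> \<le> \<eta>'" if xy: "x \<in> K" "y \<in> K" "x n = y n" for x y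
  proof -
    have "x n0 = y n0" using K_down[OF xy(1) nM(2)] K_down[OF xy(2) nM(2)] xy(3) by simp
    then have "dist x y < d" using n0 xy d(1) by fastforce
    then show ?thesis using d(2) xy(1,2) by (force simp add: dist_real_def)
  qed
  define N where "N = real (P n)"
  have N: "N \<ge> 1" using P_pos[of n] by (simp add: N_def Suc_le_eq)
  obtain q where q: "N = real q * real (P M)" using P_dvd[OF nM(1)] unfolding N_def by (metis of_nat_mult)
  have PM: "real (P M) \<ge> 1" using P_pos[of M] by (simp add: Suc_le_eq)
  have cont: "continuous_on {a..b} \<phi>" if "0 \<le> a" for a b
    using \<phi>(1) that unfolding ray_homeo_def by (auto intro: continuous_on_subset)
  have mono: "\<phi> s < \<phi> t" if "0 \<le> s" "s < t" for s t using \<phi>(1) that by (simp add: ray_homeo_def)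
  have z: "\<phi> 0 = 0" using \<phi>(1) by (simp add: ray_homeo_def)
  have "\<phi> 0 \<le> N" "N \<le> \<phi> (N + 1)" using z N id[of "N + 1"] by linarith+
  then obtain t where t: "0 \<le> t" "t \<le> N + 1" "\<phi> t = N" using IVT'[of \<phi> 0 N "N + 1"] cont N by auto
  have tN: "\<bar>N - t\<bar> < 1/4" using id[OF t(1)] t(3) by simp
  define s where "s = 2 * N - t"
  have s: "s \<ge> 0" "\<bar>s - N\<bar> < 1/4" using tN N unfolding s_def by linarith+
  have "ray s n = ray t n"
  proof -
    have "s / N = - (t / N) + 2 * of_int 1" using N by (simp add: s_def field_simps)
    then show ?thesis using fold1_period[of "- (t / N)" 1] by (simp add: ray_def N_def)
  qed
  then have "\<bar>h (ray s) M - h (ray t) M\<bar> \<le> \<eta>'" by (intro fac ray_K)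
  then have fs: "\<bar>fold1 (\<phi> s / real (P M)) - fold1 (of_int (int q))\<bar> \<le> \<eta>'"
    using \<phi>(2)[OF s(1)] \<phi>(2)[OF t(1)] t(3) q PM by (simp add: ray_def)
  have "\<bar>\<phi> s - N\<bar> < 1/2" using id[OF s(1)] s(2) by linarith
  then have "\<bar>\<phi> s / real (P M) - of_int (int q)\<bar> \<le> 1/2"
  proof -
    assume a: "\<bar>\<phi> s - N\<bar> < 1/2"
    have "\<phi> s / real (P M) - of_int (int q) = (\<phi> s - N) / real (P M)" using PM by (simp add: q field_simps)
    then have "\<bar>\<phi> s / real (P M) - of_int (int q)\<bar> = \<bar>\<phi> s - N\<bar> / real (P M)" by simp
    also have "\<dots> \<le> \<bar>\<phi> s - N\<bar>" using PM by (simp add: divide_le_eq mult_le_cancel_left1)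
    finally show ?thesis using a by linarith
  qed
  then have "\<bar>\<phi> s / real (P M) - real q\<bar> \<le> \<eta>'" using fs fold1_near_int[of "\<phi> s / real (P M)" "int q"] by simp
  then have "\<bar>\<phi> s - N\<bar> \<le> \<eta>' * real (P M)"
  proof -
    assume a: "\<bar>\<phi> s / real (P M) - real q\<bar> \<le> \<eta>'"
    have "\<phi> s - N = (\<phi> s / real (P M) - real q) * real (P M)" using PM by (simp add: q field_simps)
    then show ?thesis using a PM by (simp add: abs_mult mult_right_mono)
  qed
  then have \<phi>N: "\<bar>\<phi> N - N\<bar> \<le> \<eta>' * real (P M)"
  proof -
    assume a: "\<bar>\<phi> s - N\<bar> \<le> \<eta>' * real (P M)"
    \<comment> \<open>N lies between t and its mirror image s, so \<phi> N lies between \<phi> t = N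
      and \<phi> s.\<close>
    consider "t < N" | "t = N" | "t > N" by linarith
    then show ?thesis
    proof cases
      case 1
      then have "\<phi> t < \<phi> N" "\<phi> N < \<phi> s" using t s by (auto intro!: mono simp: s_def)
      then show ?thesis using a t by linarith
    next
      case 2 then show ?thesis using t \<eta>' PM by simp
    next
      case 3
      then have "\<phi> N < \<phi> t" "\<phi> s < \<phi> N" using t s N by (auto intro!: mono simp: s_def)
      then show ?thesis using a t by linarith
    qed
  qed
  have pN: "\<phi> N > 0" using mono[of 0 N] z N by simp
  \<comment> \<open>Rescaling makes N a fixed point, so that \<open>ext\<close> applies, at a cost
    of at most the distance from \<phi> N to N.\<close>
  define g where "g x = \<phi> x * (N / \<phi> N)" for x
  have og: "oiso 0 N 0 N g"
  proof (rule oisoI)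
    show "g x < g y" if "0 \<le> x" "x < y" "y \<le> N" for x y
      unfolding g_def using mono[of x y] that pN N by (intro mult_strict_right_mono) auto
    have mle: "\<phi> x \<le> \<phi> y" if "0 \<le> x" "x \<le> y" for x y using mono[of x y] that by (cases "x = y") auto
    show "0 \<le> g x \<and> g x \<le> N" if "0 \<le> x" "x \<le> N" for x
      using mle[of 0 x] mle[of x N] z that pN N by (auto simp: g_def divide_le_eq mult.commute)
    show "\<exists>x\<ge>0. x \<le> N \<and> g x = y" if "0 \<le> y" "y \<le> N" for y
    proof -
      have "0 \<le> y * \<phi> N / N" "y * \<phi> N / N \<le> \<phi> N" using that pN N by (auto simp: divide_le_eq mult.commute)
      then obtain x where "0 \<le> x" "x \<le> N" "\<phi> x = y * \<phi> N / N" using IVT'[of \<phi> 0 "y * \<phi> N / N" N] z cont N by auto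
      then show ?thesis using pN N by (intro exI[of _ x]) (auto simp: g_def)
    qed
  qed
  have gn: "\<bar>g x - \<phi> x\<bar> \<le> \<eta>' * real (P M)" if "0 \<le> x" "x \<le> N" for x
  proof -
    have "0 \<le> \<phi> x" "\<phi> x \<le> \<phi> N" using mono[of 0 x] mono[of x N] z that by (cases "x = 0"; cases "x = N"; force)+
    then have r: "0 \<le> \<phi> x / \<phi> N" "\<phi> x / \<phi> N \<le> 1" using pN by auto
    have "g x - \<phi> x = \<phi> x / \<phi> N * (N - \<phi> N)" using pN by (simp add: g_def field_simps)
    then have "\<bar>g x - \<phi> x\<bar> = \<phi> x / \<phi> N * \<bar>\<phi> N - N\<bar>" using r by (simp only: abs_mult abs_of_nonneg abs_minus_commute)
    also have "\<dots> \<le> \<bar>\<phi> N - N\<bar>" using r by (intro mult_left_le_one_le) auto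
    finally show ?thesis using \<phi>N by linarith
  qed
  have Np: "N > 0" using N by simp
  define \<psi> where "\<psi> = ext N g"
  have \<psi>: "\<psi> \<in> lifts (real (P n))" using ext_lifts[OF Np og] by (simp add: \<psi>_def N_def)
  have "\<bar>hat n \<psi> x M - h x M\<bar> \<le> \<eta>" if x: "x \<in> K" for x
  proof -
    define r where "r = N * x n"
    have r: "0 \<le> r" "r \<le> N" using K_range[OF x, of n] N by (auto simp: r_def mult_left_le)
    have "hat n \<psi> x M = fold1 (g r / real (P M))"
      using hat_eq[OF \<psi> x order_refl nM(1)] ext_on[OF Np og r] by (simp add: r_def \<psi>_def N_def)
    moreover have "h (ray r) M = fold1 (\<phi> r / real (P M))" using \<phi>(2)[OF r(1)] by (simp add: ray_def)
    ultimately have "\<bar>hat n \<psi> x M - h (ray r) M\<bar> \<le> \<bar>g r / real (P M) - \<phi> r / real (P M)\<bar>" using fold1_lipschitz by simp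
    also have "\<dots> = \<bar>g r - \<phi> r\<bar> / real (P M)" by (simp add: diff_divide_distrib[symmetric])
    also have "\<dots> \<le> \<eta>'" using gn[OF r] PM by (simp add: divide_le_eq)
    finally have "\<bar>hat n \<psi> x M - h (ray r) M\<bar> \<le> \<eta>'" .
    moreover have "ray r n = x n" using K_eq_ray[OF x, of n n] by (simp add: r_def N_def)
    then have "\<bar>h (ray r) M - h x M\<bar> \<le> \<eta>'" by (intro fac ray_K x)
    ultimately show ?thesis using \<eta>' by linarith
  qed
  then show ?thesis using \<psi> by blast
qed

text \<open>On the ray, coordinate 0 of \<open>hat n \<phi>\<close> is \<open>fold1\<close> of
  \<phi>, so shadowing bounds the lifts on the half line, and oddness does the rest.\<close>

lemma hat_shadow:
  assumes \<phi>: "\<phi> \<in> lifts (real (P n))" and \<psi>: "\<psi> \<in> lifts (real (P n))" and \<delta>: "0 < \<delta>" "\<delta> \<le> 1/8"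
    and close: "\<And>x. x \<in> K \<Longrightarrow> \<bar>hat n \<phi> x 0 - hat n \<psi> x 0\<bar> \<le> \<delta>"
  shows "\<bar>\<phi> t - \<psi> t\<bar> \<le> 4 * \<delta>"
proof -
  have pos: "\<bar>\<phi> t - \<psi> t\<bar> \<le> 4 * \<delta>" if "t \<ge> 0" for t
  proof -
    have "\<bar>fold1 (\<phi> s) - fold1 (\<psi> s)\<bar> \<le> \<delta>" for s
      using close[OF ray_K, of s] by (simp add: hat_ray[OF \<phi>] hat_ray[OF \<psi>]) (simp add: ray_def)
    then show ?thesis using fold1_shadow[OF lifts_ray_homeo[OF \<phi>] lifts_ray_homeo[OF \<psi>] \<delta>] that by force
  qed
  show ?thesis using pos[of t] pos[of "- t"] lifts_minus[OF \<phi>, of t] lifts_minus[OF \<psi>, of t] by (cases "t \<ge> 0") auto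
qed

end

section \<open>The open subgroup\<close>

context tower
begin

lemma coord0_close: assumes "e > 0" shows "\<exists>\<delta>>0. \<forall>x\<in>K. \<forall>y\<in>K. dist x y \<le> \<delta> \<longrightarrow> \<bar>x 0 - y 0\<bar> \<le> e"
proof -
  obtain \<delta> where "\<delta> > 0" "\<forall>x\<in>K. \<forall>y\<in>K. dist x y < \<delta> \<longrightarrow> dist (x 0) (y 0) < e"
    using uniformly_continuous_on_K[OF coord_continuous[of K 0] assms] by (elim exE conjE)
  then show ?thesis by (intro exI[of _ "\<delta>/2"]) (auto simp: dist_real_def less_imp_le)
qed

text \<open>One \<delta> works for all levels n, since closeness is tested in a single coordinate M
  that depends only on e.\<close>

lemma hat_dist:
  assumes "e > 0"
  shows "\<exists>\<delta>>0. \<forall>n. \<forall>\<phi>\<in>lifts (real (P n)). \<forall>\<psi>\<in>lifts (real (P n)). (\<forall>t. \<bar>\<phi> t - \<psi> t\<bar> \<le> \<delta>) \<longrightarrow> sup_dist K (hat n \<phi>) (hat n \<psi>) < e"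
proof -
  obtain M \<delta> where M: "\<delta> > 0" "\<And>x y. x \<in> K \<Longrightarrow> y \<in> K \<Longrightarrow> \<bar>x M - y M\<bar> \<le> \<delta> \<Longrightarrow> dist x y \<le> e/2"
    using K_dist[of "e/2"] assms by (metis half_gt_zero)
  have "sup_dist K (hat n \<phi>) (hat n \<psi>) < e"
    if l: "\<phi> \<in> lifts (real (P n))" "\<psi> \<in> lifts (real (P n))" "\<And>t. \<bar>\<phi> t - \<psi> t\<bar> \<le> \<delta>" for n \<phi> \<psi>
  proof -
    have "dist (hat n \<phi> x) (hat n \<psi> x) \<le> e/2" if x: "x \<in> K" for x
    proof (rule M(2)[OF hat_K[OF l(1) x] hat_K[OF l(2) x]])
      have "\<bar>hat n \<phi> x M - hat n \<psi> x M\<bar> \<le> \<delta> / real (P M)" by (rule hat_near[OF l(1,2) x l(3)])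
      also have "\<dots> \<le> \<delta>" using M(1) P_pos[of M] by (simp add: divide_le_eq mult_le_cancel_left1 Suc_le_eq del: P_pos)
      finally show "\<bar>hat n \<phi> x M - hat n \<psi> x M\<bar> \<le> \<delta>" .
    qed
    then have "sup_dist K (hat n \<phi>) (hat n \<psi>) \<le> e/2"
      using sup_dist_le[OF compact_knaster hat_homeos[OF l(1)] hat_homeos[OF l(2)], of "e/2"] assms by simp
    then show ?thesis using assms by linarith
  qed
  then show ?thesis using M(1) by blast
qed

text \<open>Again independent of n: closeness in coordinate 0 already bounds the lifts. It
  translates the radius of \<open>conj_nearby\<close> into the sup metric.\<close>

lemma hat_dist_converse:
  assumes "e > 0"
  shows "\<exists>\<delta>>0. \<forall>n. \<forall>\<phi>\<in>lifts (real (P n)). \<forall>\<psi>\<in>lifts (real (P n)). sup_dist K (hat n \<phi>) (hat n \<psi>) \<le> \<delta> \<longrightarrow> (\<forall>t. \<bar>\<phi> t - \<psi> t\<bar> \<le> e)"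
proof -
  define e' where "e' = min (1/8) (e/4)"
  have e': "0 < e'" "e' \<le> 1/8" "4 * e' \<le> e" using assms by (auto simp: e'_def)
  obtain \<delta> where \<delta>: "\<delta> > 0" "\<forall>x\<in>K. \<forall>y\<in>K. dist x y \<le> \<delta> \<longrightarrow> \<bar>x 0 - y 0\<bar> \<le> e'" using coord0_close[OF e'(1)] by blast
  have "\<bar>\<phi> t - \<psi> t\<bar> \<le> e" if l: "\<phi> \<in> lifts (real (P n))" "\<psi> \<in> lifts (real (P n))" "sup_dist K (hat n \<phi>) (hat n \<psi>) \<le> \<delta>" for n \<phi> \<psi> t
  proof -
    have "\<bar>hat n \<phi> x 0 - hat n \<psi> x 0\<bar> \<le> e'" if x: "x \<in> K" for x
      using sup_dist_point[OF compact_knaster hat_homeos[OF l(1)] hat_homeos[OF l(2)] x] l(3) \<delta>(2) hat_K[OF l(1) x] hat_K[OF l(2) x] by simp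
    from hat_shadow[OF l(1,2) e'(1,2) this, of t] show ?thesis using e'(3) by linarith
  qed
  then show ?thesis using \<delta>(1) by blast
qed

section \<open>The group of level homeomorphisms and its closure\<close>

definition level_homeos :: "((nat \<Rightarrow> real) \<Rightarrow> nat \<Rightarrow> real) set" where
  "level_homeos = {hat n \<phi> | n \<phi>. \<phi> \<in> lifts (real (P n))}"

lemma level_homeos_subset: "level_homeos \<subseteq> homeos K"
  by (auto simp: level_homeos_def hat_homeos)

lemma level_homeosD:
  assumes "f \<in> level_homeos"
  shows "\<exists>n \<phi>. \<forall>m\<ge>n. \<phi> \<in> lifts (real (P m)) \<and> f = hat m \<phi>"
proof -
  obtain n \<phi> where f: "\<phi> \<in> lifts (real (P n))" "f = hat n \<phi>" using assms by (auto simp: level_homeos_def)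
  have "\<phi> \<in> lifts (real (P m)) \<and> f = hat m \<phi>" if "m \<ge> n" for m
    using P_lifts[OF f(1) that] hat_level[OF f(1) that] f(2) by simp
  then show ?thesis by blast
qed

lemma hat_mult:
  assumes "\<phi> \<in> lifts (real (P n))" "\<psi> \<in> lifts (real (P n))"
  shows "hat n \<phi> \<otimes>\<^bsub>Homeo K\<^esub> hat n \<psi> = hat n (\<phi> \<circ> \<psi>)"
  by (rule homeos_eqI[of _ K])
    (use assms hat_homeos lifts_comp in \<open>auto simp: mult_Homeo hat_comp\<close>)

lemma level_mult: assumes "f \<in> level_homeos" "g \<in> level_homeos" shows "f \<otimes>\<^bsub>Homeo K\<^esub> g \<in> level_homeos"
proof -
  obtain n \<phi> where f: "\<And>m. m \<ge> n \<Longrightarrow> \<phi> \<in> lifts (real (P m)) \<and> f = hat m \<phi>" using level_homeosD[OF assms(1)] by blast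
  obtain k \<psi> where g: "\<And>m. m \<ge> k \<Longrightarrow> \<psi> \<in> lifts (real (P m)) \<and> g = hat m \<psi>" using level_homeosD[OF assms(2)] by blast
  let ?m = "max n k"
  have "f \<otimes>\<^bsub>Homeo K\<^esub> g = hat ?m (\<phi> \<circ> \<psi>)" using f[of ?m] g[of ?m] hat_mult by simp
  moreover have "\<phi> \<circ> \<psi> \<in> lifts (real (P ?m))" using f[of ?m] g[of ?m] lifts_comp by simp
  ultimately show ?thesis unfolding level_homeos_def by blast
qed

lemma level_inv: assumes "f \<in> level_homeos" shows "inv\<^bsub>Homeo K\<^esub> f \<in> level_homeos"
proof -
  obtain n \<phi> where f: "\<phi> \<in> lifts (real (P n))" "f = hat n \<phi>" using assms by (auto simp: level_homeos_def)
  note i = lifts_inv[OF f(1)]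
  have "inv\<^bsub>Homeo K\<^esub> f = hat n (inv_into UNIV \<phi>)"
  proof (rule group.inv_equality[OF group_Homeo])
    show "hat n (inv_into UNIV \<phi>) \<otimes>\<^bsub>Homeo K\<^esub> f = \<one>\<^bsub>Homeo K\<^esub>"
    proof (rule homeos_eqI[of _ K])
      show "\<one>\<^bsub>Homeo K\<^esub> \<in> homeos K" using monoid.one_closed[OF group.is_monoid[OF group_Homeo], of K] by simp
      show "(hat n (inv_into UNIV \<phi>) \<otimes>\<^bsub>Homeo K\<^esub> f) x = \<one>\<^bsub>Homeo K\<^esub> x" if "x \<in> K" for x
        using that f hat_homeos[OF f(1)] hat_homeos[OF i] hat_inverse(1)[OF f(1) that] by (simp add: mult_Homeo one_Homeo)
    qed (use f hat_homeos[OF f(1)] hat_homeos[OF i] in simp)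
  qed (use f hat_homeos[OF f(1)] hat_homeos[OF i] in simp_all)
  then show ?thesis using i unfolding level_homeos_def by blast
qed

definition level_closure :: "((nat \<Rightarrow> real) \<Rightarrow> nat \<Rightarrow> real) set" where
  "level_closure = {h \<in> homeos K. \<forall>e>0. \<exists>l\<in>level_homeos. sup_dist K h l < e}"

lemma level_closure_subset: "level_closure \<subseteq> homeos K" by (auto simp: level_closure_def)

lemma level_closure_approx: "h \<in> level_closure \<Longrightarrow> e > 0 \<Longrightarrow> \<exists>l\<in>level_homeos. sup_dist K h l < e"
  by (simp add: level_closure_def)

lemma level_level_closure: "level_homeos \<subseteq> level_closure"
proof
  fix l assume l: "l \<in> level_homeos"
  then have "l \<in> homeos K" using level_homeos_subset by auto
  moreover from this have "sup_dist K l l = 0" using Metric_space.mdist_zero[OF Metric_space_sup_dist[OF compact_knaster]] by metis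
  ultimately show "l \<in> level_closure" using l unfolding level_closure_def by force
qed

lemma sup_dist_triangle: "f \<in> homeos K \<Longrightarrow> g \<in> homeos K \<Longrightarrow> h \<in> homeos K \<Longrightarrow> sup_dist K f h \<le> sup_dist K f g + sup_dist K g h"
  using Metric_space.triangle[OF Metric_space_sup_dist[OF compact_knaster]] by metis

lemma sup_dist_commute: "sup_dist K f g = sup_dist K g f"
  using Metric_space.commute[OF Metric_space_sup_dist[OF compact_knaster]] by metis

lemma sup_dist_half:
  "f \<in> homeos K \<Longrightarrow> g \<in> homeos K \<Longrightarrow> h \<in> homeos K \<Longrightarrow> sup_dist K f g < e/2 \<Longrightarrow> sup_dist K h g < e/2 \<Longrightarrow> sup_dist K f h < e"
  using sup_dist_triangle[of f g h] sup_dist_commute[of h g] by simp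

lemma level_closure_closed:
  assumes "h \<in> homeos K" "\<And>e. e > 0 \<Longrightarrow> \<exists>l\<in>level_closure. sup_dist K h l < e" shows "h \<in> level_closure"
proof -
  have "\<exists>l\<in>level_homeos. sup_dist K h l < e" if e: "e > 0" for e
  proof -
    obtain u where u: "u \<in> level_closure" "sup_dist K h u < e/2" using assms(2)[of "e/2"] e by auto
    obtain l where l: "l \<in> level_homeos" "sup_dist K u l < e/2" using level_closure_approx[OF u(1), of "e/2"] e by auto
    have "sup_dist K h l \<le> sup_dist K h u + sup_dist K u l"
      using assms(1) u l level_closure_subset level_homeos_subset by (intro sup_dist_triangle) auto
    then show ?thesis using u l by (intro bexI[of _ l]) auto
  qed
  then show ?thesis using assms(1) by (simp add: level_closure_def)
qed

text \<open>A homeomorphism near a level homeomorphism \<open>l\<close> is, after right translation by the inverse of \<open>l\<close>, near the identity.\<close>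

lemma near_level_in_level_closure: "\<exists>\<epsilon>>0. \<forall>h\<in>homeos K. \<forall>l\<in>level_homeos. sup_dist K h l \<le> \<epsilon> \<longrightarrow> h \<in> level_closure"
proof -
  obtain \<epsilon> where \<epsilon>: "\<epsilon> > 0" "\<forall>x\<in>K. \<forall>y\<in>K. dist x y \<le> \<epsilon> \<longrightarrow> \<bar>x 0 - y 0\<bar> \<le> 1/16" using coord0_close[of "1/16"] by auto
  have "h \<in> level_closure" if h: "h \<in> homeos K" and l: "l \<in> level_homeos" and hl: "sup_dist K h l \<le> \<epsilon>" for h l
  proof -
    have lh: "l \<in> homeos K" using l level_homeos_subset by auto
    define k where "k = h \<otimes>\<^bsub>Homeo K\<^esub> inv\<^bsub>Homeo K\<^esub> l"
    have kh: "k \<in> homeos K" using h lh by (simp add: k_def)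
    have kl: "k (l x) = h x" if "x \<in> K" for x
      using that h lh inv_Homeo_left[OF lh that] homeos_mem[OF lh that] by (simp add: k_def mult_Homeo)
    have near: "\<bar>k y 0 - y 0\<bar> \<le> 1/16" if y: "y \<in> K" for y
    proof -
      obtain x where x: "x \<in> K" "l x = y" using homeos_onto[OF lh y] by blast
      have "dist (h x) (l x) \<le> \<epsilon>" using sup_dist_point[OF compact_knaster h lh x(1)] hl by simp
      then show ?thesis using \<epsilon>(2) kl[OF x(1)] x homeos_mem[OF h x(1)] y by auto
    qed
    have "\<exists>l'\<in>level_homeos. sup_dist K h l' < e" if e: "e > 0" for e
    proof -
      obtain M \<delta> where M: "\<delta> > 0" "\<And>x y. x \<in> K \<Longrightarrow> y \<in> K \<Longrightarrow> \<bar>x M - y M\<bar> \<le> \<delta> \<Longrightarrow> dist x y \<le> e/2"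
        using K_dist[of "e/2"] e by (metis half_gt_zero)
      obtain n \<psi> where \<psi>: "\<psi> \<in> lifts (real (P n))" "\<forall>x\<in>K. \<bar>hat n \<psi> x M - k x M\<bar> \<le> \<delta>"
        using homeo_approx[OF kh near M(1)] by blast
      let ?l = "hat n \<psi> \<otimes>\<^bsub>Homeo K\<^esub> l"
      have L: "hat n \<psi> \<in> level_homeos" using \<psi>(1) by (auto simp: level_homeos_def)
      have ll: "?l \<in> level_homeos" using level_mult[OF L l] .
      have "dist (h x) (?l x) \<le> e/2" if x: "x \<in> K" for x
      proof -
        have lx: "l x \<in> K" using homeos_mem[OF lh x] .
        have "dist (hat n \<psi> (l x)) (k (l x)) \<le> e/2"
          using \<psi>(2) lx by (intro M(2) hat_K[OF \<psi>(1)] homeos_mem[OF kh]) auto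
        then show ?thesis using kl[OF x] mult_Homeo[OF hat_homeos[OF \<psi>(1)] lh x] by (simp add: dist_commute)
      qed
      then have "sup_dist K h ?l \<le> e/2"
        using sup_dist_le[OF compact_knaster h, of ?l "e/2"] ll level_homeos_subset e by auto
      then show ?thesis using ll e by (intro bexI[of _ ?l]) auto
    qed
    then show ?thesis using h by (simp add: level_closure_def)
  qed
  then show ?thesis using \<epsilon>(1) by blast
qed

text \<open>The \<epsilon> of \<open>near_level_in_level_closure\<close> is the same for all level
  homeomorphisms, so it still yields a ball of radius \<epsilon>/2 about each of their
  limits.\<close>

lemma openin_level_closure: "openin (homeo_topology K) level_closure"
proof (rule openin_homeo_topologyI[OF compact_knaster level_closure_subset])
  fix h assume h: "h \<in> level_closure"
  obtain \<epsilon> where \<epsilon>: "\<epsilon> > 0" "\<forall>h\<in>homeos K. \<forall>l\<in>level_homeos. sup_dist K h l \<le> \<epsilon> \<longrightarrow> h \<in> level_closure" using near_level_in_level_closure by blast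
  obtain l where l: "l \<in> level_homeos" "sup_dist K h l < \<epsilon>/2" using level_closure_approx[OF h, of "\<epsilon>/2"] \<epsilon>(1) by auto
  have "g \<in> level_closure" if g: "g \<in> homeos K" "sup_dist K h g < \<epsilon>/2" for g
  proof -
    have "sup_dist K g l \<le> sup_dist K g h + sup_dist K h l"
      using g h l level_closure_subset level_homeos_subset by (intro sup_dist_triangle) auto
    then have "sup_dist K g l \<le> \<epsilon>" using g l sup_dist_commute[of g h] by simp
    then show ?thesis using \<epsilon>(2) g l by blast
  qed
  then show "\<exists>r>0. \<forall>g\<in>homeos K. sup_dist K h g < r \<longrightarrow> g \<in> level_closure" using \<epsilon>(1) by (intro exI[of _ "\<epsilon>/2"]) auto
qed

lemma subgroup_level_closure: "subgroup level_closure (Homeo K)"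
proof
  show "level_closure \<subseteq> carrier (Homeo K)" using level_closure_subset by simp
next
  fix f g assume fg: "f \<in> level_closure" "g \<in> level_closure"
  then have h: "f \<in> homeos K" "g \<in> homeos K" using level_closure_subset by auto
  show "f \<otimes>\<^bsub>Homeo K\<^esub> g \<in> level_closure"
  proof (rule level_closure_closed)
    fix e :: real assume e: "e > 0"
    obtain \<delta> where \<delta>: "\<delta> > 0" "\<forall>x\<in>K. \<forall>y\<in>K. dist x y \<le> \<delta> \<longrightarrow> dist (f x) (f y) \<le> e/4"
      using homeos_uniformly_continuous[OF compact_knaster h(1), of "e/4"] e by auto
    obtain a where a: "a \<in> level_homeos" "sup_dist K f a < e/4" using level_closure_approx[OF fg(1), of "e/4"] e by auto
    obtain b where b: "b \<in> level_homeos" "sup_dist K g b < \<delta>" using level_closure_approx[OF fg(2) \<delta>(1)] by auto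
    have ab: "a \<in> homeos K" "b \<in> homeos K" using a b level_homeos_subset by auto
    have "dist ((f \<otimes>\<^bsub>Homeo K\<^esub> g) x) ((a \<otimes>\<^bsub>Homeo K\<^esub> b) x) \<le> e/2" if x: "x \<in> K" for x
    proof -
      have m: "g x \<in> K" "b x \<in> K" using homeos_mem h ab x by auto
      have "dist (g x) (b x) \<le> \<delta>" using sup_dist_point[OF compact_knaster h(2) ab(2) x] b by simp
      then have "dist (f (g x)) (f (b x)) \<le> e/4" using \<delta>(2) m by blast
      moreover have "dist (f (b x)) (a (b x)) \<le> e/4" using sup_dist_point[OF compact_knaster h(1) ab(1) m(2)] a by simp
      ultimately show ?thesis using dist_triangle[of "f (g x)" "a (b x)" "f (b x)"] h ab x by (simp add: mult_Homeo)
    qed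
    then have "sup_dist K (f \<otimes>\<^bsub>Homeo K\<^esub> g) (a \<otimes>\<^bsub>Homeo K\<^esub> b) \<le> e/2"
      using sup_dist_le[OF compact_knaster mult_Homeo_mem[OF h] mult_Homeo_mem[OF ab], of "e/2"] e by simp
    then show "\<exists>l\<in>level_closure. sup_dist K (f \<otimes>\<^bsub>Homeo K\<^esub> g) l < e"
      using level_mult[OF a(1) b(1)] level_level_closure e by (intro bexI[of _ "a \<otimes>\<^bsub>Homeo K\<^esub> b"]) auto
  qed (use h in simp)
next
  have "hat 0 (\<lambda>t. t) \<in> level_homeos" using lifts_id[of "real (P 0)"] unfolding level_homeos_def by blast
  moreover have "hat 0 (\<lambda>t. t) = \<one>\<^bsub>Homeo K\<^esub>"
  proof (rule homeos_eqI[OF hat_homeos[OF lifts_id]])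
    show "\<one>\<^bsub>Homeo K\<^esub> \<in> homeos K" using monoid.one_closed[OF group.is_monoid[OF group_Homeo], of K] by simp
  qed (simp add: hat_id one_Homeo)
  ultimately show "\<one>\<^bsub>Homeo K\<^esub> \<in> level_closure" using level_level_closure by auto
next
  fix f assume f: "f \<in> level_closure"
  then have h: "f \<in> homeos K" using level_closure_subset by auto
  let ?i = "inv\<^bsub>Homeo K\<^esub> f"
  have ih: "?i \<in> homeos K" using h by simp
  show "?i \<in> level_closure"
  proof (rule level_closure_closed[OF ih])
    fix e :: real assume e: "e > 0"
    obtain \<delta> where \<delta>: "\<delta> > 0" "\<forall>x\<in>K. \<forall>y\<in>K. dist x y \<le> \<delta> \<longrightarrow> dist (?i x) (?i y) \<le> e/2"
      using homeos_uniformly_continuous[OF compact_knaster ih, of "e/2"] e by auto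
    obtain a where a: "a \<in> level_homeos" "sup_dist K f a < \<delta>" using level_closure_approx[OF f \<delta>(1)] by auto
    have ah: "a \<in> homeos K" using a level_homeos_subset by auto
    let ?j = "inv\<^bsub>Homeo K\<^esub> a"
    have "dist (?i x) (?j x) \<le> e/2" if x: "x \<in> K" for x
    proof -
      let ?y = "?j x"
      have y: "?y \<in> K" "a ?y = x" using homeos_mem[OF inv_Homeo_mem[OF ah] x] inv_Homeo_right[OF ah x] by auto
      have "dist (f ?y) (a ?y) \<le> \<delta>" using sup_dist_point[OF compact_knaster h ah y(1)] a by simp
      then have "dist (?i (a ?y)) (?i (f ?y)) \<le> e/2" using \<delta>(2) homeos_mem[OF h y(1)] homeos_mem[OF ah y(1)] by (simp add: dist_commute)
      then show ?thesis using y inv_Homeo_left[OF h y(1)] by simp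
    qed
    then have "sup_dist K ?i ?j \<le> e/2" using sup_dist_le[OF compact_knaster ih inv_Homeo_mem[OF ah], of "e/2"] e by simp
    then show "\<exists>l\<in>level_closure. sup_dist K ?i l < e" using level_inv[OF a(1)] level_level_closure e by (intro bexI[of _ ?j]) auto
  qed
qed

section \<open>Near conjugacy in the closed subgroup\<close>

abbreviation LG :: "((nat \<Rightarrow> real) \<Rightarrow> nat \<Rightarrow> real) monoid" where
  "LG \<equiv> (Homeo K)\<lparr>carrier := level_closure\<rparr>"

lemma metric_group_level_closure: "metric_group LG (sup_dist K)"
  by (rule metric_group_homeos[OF compact_knaster subgroup_level_closure level_closure_closed])

lemma cj_level_closure:
  assumes "h \<in> level_closure" "x \<in> level_closure" "h \<otimes>\<^bsub>Homeo K\<^esub> x = y \<otimes>\<^bsub>Homeo K\<^esub> h" "y \<in> level_closure"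
  shows "metric_group.cj LG h x = y"
  by (rule metric_group.cj_eqI[OF metric_group_level_closure]) (use assms in auto)

lemma hat_cj:
  assumes l: "h \<in> lifts (real (P n))" "z1 \<in> lifts (real (P n))" "z2 \<in> lifts (real (P n))" and eq: "h \<circ> z1 = z2 \<circ> h"
  shows "metric_group.cj LG (hat n h) (hat n z1) = hat n z2"
proof -
  have u: "hat n f \<in> level_closure" if "f \<in> lifts (real (P n))" for f using level_level_closure that by (auto simp: level_homeos_def)
  show ?thesis using u l hat_mult[OF l(1,2)] hat_mult[OF l(3,1)] eq by (intro cj_level_closure) auto
qed

text \<open>The lower bound m places the common level beyond the level of a given F, so that its
  period is a multiple of that of F.\<close>

lemma two_levels:
  assumes "y1 \<in> level_closure" "y2 \<in> level_closure" "e > 0"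
  obtains n g1 g2 where "n \<ge> m" "g1 \<in> lifts (real (P n))" "g2 \<in> lifts (real (P n))"
    "sup_dist K y1 (hat n g1) < e" "sup_dist K y2 (hat n g2) < e"
proof -
  obtain l1 where l1: "l1 \<in> level_homeos" "sup_dist K y1 l1 < e" using level_closure_approx[OF assms(1,3)] by blast
  obtain l2 where l2: "l2 \<in> level_homeos" "sup_dist K y2 l2 < e" using level_closure_approx[OF assms(2,3)] by blast
  obtain n1 g1 where 1: "\<And>m. m \<ge> n1 \<Longrightarrow> g1 \<in> lifts (real (P m)) \<and> l1 = hat m g1" using level_homeosD[OF l1(1)] by blast
  obtain n2 g2 where 2: "\<And>m. m \<ge> n2 \<Longrightarrow> g2 \<in> lifts (real (P m)) \<and> l2 = hat m g2" using level_homeosD[OF l2(1)] by blast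
  show ?thesis using that[of "max m (max n1 n2)" g1 g2] 1[of "max m (max n1 n2)"] 2[of "max m (max n1 n2)"] l1 l2 by simp
qed

lemma level_closure_global:
  assumes y: "y1 \<in> level_closure" "y2 \<in> level_closure" "\<eta> > 0"
  shows "\<exists>z1\<in>level_closure. \<exists>z2\<in>level_closure. \<exists>h\<in>level_closure. sup_dist K z1 y1 < \<eta> \<and> sup_dist K z2 y2 < \<eta> \<and> z2 = metric_group.cj LG h z1"
proof -
  have u: "hat n f \<in> level_closure" if "f \<in> lifts (real (P n))" for n f using level_level_closure that by (auto simp: level_homeos_def)
  have hm: "hat n f \<in> homeos K" if "f \<in> lifts (real (P n))" for n f using hat_homeos that .
  have yh: "y1 \<in> homeos K" "y2 \<in> homeos K" using y level_closure_subset by auto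
  have "\<eta>/2 > 0" using y by simp
  obtain n g1 g2 where g: "g1 \<in> lifts (real (P n))" "g2 \<in> lifts (real (P n))" "sup_dist K y1 (hat n g1) < \<eta>/2" "sup_dist K y2 (hat n g2) < \<eta>/2"
    using two_levels[OF y(1,2) \<open>\<eta>/2 > 0\<close>, of 0] by metis
  obtain \<delta> where \<delta>: "\<delta> > 0" "\<forall>n. \<forall>\<phi>\<in>lifts (real (P n)). \<forall>\<psi>\<in>lifts (real (P n)). (\<forall>t. \<bar>\<phi> t - \<psi> t\<bar> \<le> \<delta>) \<longrightarrow> sup_dist K (hat n \<phi>) (hat n \<psi>) < \<eta>/2"
    using hat_dist[OF \<open>\<eta>/2 > 0\<close>] by blast
  have "real (P n) > 0" by simp
  obtain z1 z2 h where z: "z1 \<in> lifts (real (P n))" "z2 \<in> lifts (real (P n))" "h \<in> lifts (real (P n))"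
    "\<forall>x. \<bar>z1 x - g1 x\<bar> \<le> \<delta>" "\<forall>x. \<bar>z2 x - g2 x\<bar> \<le> \<delta>" "h \<circ> z1 = z2 \<circ> h"
    using lifts_conj_dense[OF g(1,2) \<open>real (P n) > 0\<close> \<delta>(1)] by blast
  have "sup_dist K (hat n z1) (hat n g1) < \<eta>/2" "sup_dist K (hat n z2) (hat n g2) < \<eta>/2" using \<delta>(2) z g by blast+
  then have "sup_dist K (hat n z1) y1 < \<eta>" "sup_dist K (hat n z2) y2 < \<eta>"
    using g(3,4) sup_dist_half[OF hm[OF z(1)] hm[OF g(1)] yh(1)] sup_dist_half[OF hm[OF z(2)] hm[OF g(2)] yh(2)] by simp_all
  then show ?thesis using u z hat_cj[OF z(3,1,2,6)] by metis
qed

text \<open>The point x' is \<open>hat n F\<close> for a tame F. Elements near it are approximated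
  at some level k \<ge> n, and \<open>conj_nearby\<close> applies with D = P k / P n.\<close>

lemma level_closure_local:
  assumes e: "\<epsilon> > 0" and x: "x \<in> level_closure" and \<eta>: "\<eta> > 0"
  shows "\<exists>x'\<in>level_closure. sup_dist K x x' < \<eta> \<and> (\<exists>\<delta>>0. \<forall>y1\<in>level_closure. \<forall>y2\<in>level_closure. sup_dist K x' y1 < \<delta> \<longrightarrow> sup_dist K x' y2 < \<delta> \<longrightarrow> (\<forall>\<eta>>0. \<exists>z1\<in>level_closure. \<exists>z2\<in>level_closure. \<exists>h\<in>level_closure.
     sup_dist K h \<one>\<^bsub>Homeo K\<^esub> < \<epsilon> \<and> sup_dist K z1 y1 < \<eta> \<and> sup_dist K z2 y2 < \<eta> \<and> z2 = metric_group.cj LG h z1))"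
proof -
  have u: "hat n f \<in> level_closure" if "f \<in> lifts (real (P n))" for n f using level_level_closure that by (auto simp: level_homeos_def)
  have hm: "hat n f \<in> homeos K" if "f \<in> lifts (real (P n))" for n f using hat_homeos that .
  have one: "hat n (\<lambda>t. t) = \<one>\<^bsub>Homeo K\<^esub>" for n
  proof (rule homeos_eqI[OF hat_homeos[OF lifts_id]])
    show "\<one>\<^bsub>Homeo K\<^esub> \<in> homeos K" using monoid.one_closed[OF group.is_monoid[OF group_Homeo], of K] by simp
  qed (simp add: hat_id one_Homeo)
  have "\<eta>/2 > 0" using \<eta> by simp
  obtain l where l: "l \<in> level_homeos" "sup_dist K x l < \<eta>/2" using level_closure_approx[OF x \<open>\<eta>/2 > 0\<close>] by blast
  obtain n f where f: "f \<in> lifts (real (P n))" "l = hat n f" using l(1) by (auto simp: level_homeos_def)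
  obtain \<delta>1 where 1: "\<delta>1 > 0" "\<forall>n. \<forall>\<phi>\<in>lifts (real (P n)). \<forall>\<psi>\<in>lifts (real (P n)). (\<forall>t. \<bar>\<phi> t - \<psi> t\<bar> \<le> \<delta>1) \<longrightarrow> sup_dist K (hat n \<phi>) (hat n \<psi>) < \<eta>/2"
    using hat_dist[OF \<open>\<eta>/2 > 0\<close>] by blast
  obtain \<delta>2 where 2: "\<delta>2 > 0" "\<forall>n. \<forall>\<phi>\<in>lifts (real (P n)). \<forall>\<psi>\<in>lifts (real (P n)). (\<forall>t. \<bar>\<phi> t - \<psi> t\<bar> \<le> \<delta>2) \<longrightarrow> sup_dist K (hat n \<phi>) (hat n \<psi>) < \<epsilon>"
    using hat_dist[OF e] by blast
  have "real (P n) > 0" by simp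
  obtain F \<delta> where F: "F \<in> lifts (real (P n))" "\<forall>t. \<bar>F t - f t\<bar> \<le> \<delta>1" "\<delta> > 0"
    "conj_nearby (real (P n)) \<delta>2 \<delta> F"
    using lifts_local_conj[OF f(1) \<open>real (P n) > 0\<close> 2(1) 1(1)] by blast
  obtain \<delta>3 where 3: "\<delta>3 > 0" "\<forall>n. \<forall>\<phi>\<in>lifts (real (P n)). \<forall>\<psi>\<in>lifts (real (P n)). sup_dist K (hat n \<phi>) (hat n \<psi>) \<le> \<delta>3 \<longrightarrow> (\<forall>t. \<bar>\<phi> t - \<psi> t\<bar> \<le> \<delta>)"
    using hat_dist_converse[OF F(3)] by blast
  let ?x = "hat n F"
  have xh: "x \<in> homeos K" using x level_closure_subset by auto
  have "sup_dist K (hat n F) (hat n f) < \<eta>/2" using 1(2) F(1,2) f(1) by blast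
  then have near: "sup_dist K x ?x < \<eta>"
    using sup_dist_triangle[OF xh hm[OF f(1)] hm[OF F(1)]] l(2) f(2) sup_dist_commute[of ?x] by simp
  have main: "\<exists>z1\<in>level_closure. \<exists>z2\<in>level_closure. \<exists>h\<in>level_closure. sup_dist K h \<one>\<^bsub>Homeo K\<^esub> < \<epsilon> \<and> sup_dist K z1 y1 < \<eta>' \<and> sup_dist K z2 y2 < \<eta>' \<and> z2 = metric_group.cj LG h z1"
    if y: "y1 \<in> level_closure" "y2 \<in> level_closure" "sup_dist K ?x y1 < \<delta>3/2" "sup_dist K ?x y2 < \<delta>3/2" and \<eta>': "\<eta>' > 0" for y1 y2 \<eta>'
  proof -
    have yh: "y1 \<in> homeos K" "y2 \<in> homeos K" using y level_closure_subset by auto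
    have p: "min (\<eta>'/2) (\<delta>3/2) > 0" "\<eta>'/2 > 0" using \<eta>' 3 by auto
    obtain k g1 g2 where g: "k \<ge> n" "g1 \<in> lifts (real (P k))" "g2 \<in> lifts (real (P k))"
      "sup_dist K y1 (hat k g1) < min (\<eta>'/2) (\<delta>3/2)" "sup_dist K y2 (hat k g2) < min (\<eta>'/2) (\<delta>3/2)"
      using two_levels[OF y(1,2) p(1), of n] by metis
    have Fk: "F \<in> lifts (real (P k))" "hat n F = hat k F" using P_lifts[OF F(1) g(1)] hat_level[OF F(1) g(1)] by auto
    have "sup_dist K (hat k g1) (hat k F) < \<delta>3" "sup_dist K (hat k g2) (hat k F) < \<delta>3"
      using sup_dist_half[OF hm[OF g(2)] yh(1) hm[OF Fk(1)], of \<delta>3] sup_dist_half[OF hm[OF g(3)] yh(2) hm[OF Fk(1)], of \<delta>3]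
        y(3,4) g(4,5) unfolding Fk(2) by (simp_all add: sup_dist_commute)
    then have "sup_dist K (hat k g1) (hat k F) \<le> \<delta>3" "sup_dist K (hat k g2) (hat k F) \<le> \<delta>3" by simp_all
    then have gF: "\<forall>t. \<bar>g1 t - F t\<bar> \<le> \<delta>" "\<forall>t. \<bar>g2 t - F t\<bar> \<le> \<delta>" using 3(2) g(2,3) Fk(1) by blast+
    obtain \<delta>4 where 4: "\<delta>4 > 0" "\<forall>n. \<forall>\<phi>\<in>lifts (real (P n)). \<forall>\<psi>\<in>lifts (real (P n)). (\<forall>t. \<bar>\<phi> t - \<psi> t\<bar> \<le> \<delta>4) \<longrightarrow> sup_dist K (hat n \<phi>) (hat n \<psi>) < \<eta>'/2"
      using hat_dist[OF p(2)] by blast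
    obtain D where D: "P k = D * P n" "D > 0" by (rule P_dvd[OF g(1)])
    have DP: "real D * real (P n) = real (P k)" by (simp add: D)
    obtain z1 z2 h where z: "z1 \<in> lifts (real (P k))" "z2 \<in> lifts (real (P k))" "h \<in> lifts (real (P k))"
      "\<forall>x. \<bar>z1 x - g1 x\<bar> \<le> \<delta>4" "\<forall>x. \<bar>z2 x - g2 x\<bar> \<le> \<delta>4" "\<forall>x. \<bar>h x - x\<bar> \<le> \<delta>2" "h \<circ> z1 = z2 \<circ> h"
      using F(4)[unfolded conj_nearby_def, rule_format, OF D(2), unfolded DP, OF g(2,3), OF gF(1)[rule_format] gF(2)[rule_format] 4(1)] by blast
    have "sup_dist K (hat k z1) (hat k g1) < \<eta>'/2" "sup_dist K (hat k z2) (hat k g2) < \<eta>'/2" using 4(2) z g by blast+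
    then have zy: "sup_dist K (hat k z1) y1 < \<eta>'" "sup_dist K (hat k z2) y2 < \<eta>'"
      using g(4,5) sup_dist_half[OF hm[OF z(1)] hm[OF g(2)] yh(1)] sup_dist_half[OF hm[OF z(2)] hm[OF g(3)] yh(2)] by simp_all
    have "sup_dist K (hat k h) (hat k (\<lambda>t. t)) < \<epsilon>" 
      using 2(2)[rule_format, OF z(3) lifts_id] z(6) by blast
    then have "sup_dist K (hat k h) \<one>\<^bsub>Homeo K\<^esub> < \<epsilon>" by (simp only: one)
    then show ?thesis using u[OF z(1)] u[OF z(2)] u[OF z(3)] zy hat_cj[OF z(3,1,2,7)] by metis
  qed
  show ?thesis
    by (rule bexI[OF _ u[OF F(1)]], rule conjI[OF near], rule exI[of _ "\<delta>3/2"]) (use 3(1) main in auto)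
qed

lemma comeager_class_level_closure:
  "\<exists>u\<in>level_closure. comeager_in (subtopology (homeo_topology K) level_closure) {inv\<^bsub>Homeo K\<^esub> h \<otimes>\<^bsub>Homeo K\<^esub> u \<otimes>\<^bsub>Homeo K\<^esub> h | h. h \<in> level_closure}"
proof -
  interpret metric_group LG "sup_dist K" by (rule metric_group_level_closure)
  have top: "mtopology = subtopology (homeo_topology K) level_closure"
    using mtopology_sup_dist[OF compact_knaster level_closure_subset] by simp
  have inv: "inv\<^bsub>LG\<^esub> h = inv\<^bsub>Homeo K\<^esub> h" if "h \<in> level_closure" for h
    by (rule group.m_inv_consistent[OF group_Homeo subgroup_level_closure that])
  have "\<exists>u\<in>carrier LG. comeager_in mtopology
    {inv\<^bsub>LG\<^esub> h \<otimes>\<^bsub>LG\<^esub> u \<otimes>\<^bsub>LG\<^esub> h | h. h \<in> carrier LG}"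
  proof (rule comeager_conjugacy_class)
    fix \<epsilon> \<eta> :: real and x assume "\<epsilon> > 0" "x \<in> carrier LG" "\<eta> > 0"
    then obtain x' \<delta> where x': "x' \<in> level_closure" "sup_dist K x x' < \<eta>" "\<delta> > 0"
      "\<And>y1 y2 \<eta>. y1 \<in> level_closure \<Longrightarrow> y2 \<in> level_closure \<Longrightarrow> sup_dist K x' y1 < \<delta> \<Longrightarrow> sup_dist K x' y2 < \<delta> \<Longrightarrow> \<eta> > 0 \<Longrightarrow> \<exists>z1\<in>level_closure. \<exists>z2\<in>level_closure. \<exists>h\<in>level_closure.
         sup_dist K h \<one>\<^bsub>Homeo K\<^esub> < \<epsilon> \<and> sup_dist K z1 y1 < \<eta> \<and> sup_dist K z2 y2 < \<eta> \<and> z2 = cj h z1"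
      using level_closure_local[of \<epsilon> x \<eta>] by simp metis
    have "good {h \<in> carrier LG. sup_dist K h \<one>\<^bsub>LG\<^esub> < \<epsilon>} x' \<delta>"
      unfolding good_def
    proof (intro ballI allI impI)
      fix y1 y2 and \<eta> :: real assume y: "y1 \<in> mball x' \<delta>" "y2 \<in> mball x' \<delta>" "\<eta> > 0"
      then have "y1 \<in> level_closure" "sup_dist K x' y1 < \<delta>" "y2 \<in> level_closure" "sup_dist K x' y2 < \<delta>" unfolding in_mball by simp_all
      then obtain z1 z2 h where "z1 \<in> level_closure" "z2 \<in> level_closure" "h \<in> level_closure" "sup_dist K h \<one>\<^bsub>Homeo K\<^esub> < \<epsilon>" "sup_dist K z1 y1 < \<eta>" "sup_dist K z2 y2 < \<eta>" "z2 = cj h z1"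
        using x'(4)[of y1 y2 \<eta>] y(3) by blast
      then show "\<exists>z1\<in>carrier LG. \<exists>z2\<in>carrier LG.
        \<exists>h\<in>{h \<in> carrier LG. sup_dist K h \<one>\<^bsub>LG\<^esub> < \<epsilon>}.
          sup_dist K z1 y1 < \<eta> \<and> sup_dist K z2 y2 < \<eta> \<and> z2 = cj h z1"
        by auto
    qed
    then show "\<exists>x'\<in>carrier LG. sup_dist K x x' < \<eta> \<and>
       (\<exists>\<delta>>0. good {h \<in> carrier LG. sup_dist K h \<one>\<^bsub>LG\<^esub> < \<epsilon>} x' \<delta>)"
      using x' by (intro bexI[of _ x'] conjI exI[of _ \<delta>]) auto
  next
    fix y1 y2 and \<eta> :: real
    assume "y1 \<in> carrier LG" "y2 \<in> carrier LG" "\<eta> > 0"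
    then show "\<exists>z1\<in>carrier LG. \<exists>z2\<in>carrier LG. \<exists>h\<in>carrier LG.
        sup_dist K z1 y1 < \<eta> \<and> sup_dist K z2 y2 < \<eta> \<and> z2 = cj h z1"
      using level_closure_global by simp
  qed
  then obtain u where u: "u \<in> level_closure" "comeager_in mtopology
    {inv\<^bsub>LG\<^esub> h \<otimes>\<^bsub>LG\<^esub> u \<otimes>\<^bsub>LG\<^esub> h | h. h \<in> carrier LG}"
    by auto
  have "{inv\<^bsub>LG\<^esub> h \<otimes>\<^bsub>LG\<^esub> u \<otimes>\<^bsub>LG\<^esub> h | h. h \<in> carrier LG}
    = {inv\<^bsub>Homeo K\<^esub> h \<otimes>\<^bsub>Homeo K\<^esub> u \<otimes>\<^bsub>Homeo K\<^esub> h | h. h \<in> level_closure}"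
    using inv by (intro Collect_cong) (auto, metis+)
  then show ?thesis using u top by auto
qed

end

theorem theorem1p2:
  fixes p :: "nat \<Rightarrow> nat" and K :: "(nat \<Rightarrow> real) set"
  assumes "\<forall>n\<ge>1. prime (p n)"
    and "\<forall>q. prime q \<longrightarrow> infinite {n. n \<ge> 1 \<and> p n = q}"
    and "K = knaster p"
  shows "\<exists>U. subgroup U (Homeo K) \<and> openin (homeo_topology K) U \<and>
           (\<exists>u\<in>U. comeager_in (subtopology (homeo_topology K) U)
              {inv\<^bsub>Homeo K\<^esub> h \<otimes>\<^bsub>Homeo K\<^esub> u \<otimes>\<^bsub>Homeo K\<^esub> h | h. h \<in> U})"
proof -
  interpret tower p
  proof
    show "2 \<le> p n" if "1 \<le> n" for n using assms(1) that prime_ge_2_nat by blast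
    show "\<exists>n>m. p n = 2" for m
    proof -
      have "infinite {n. n \<ge> 1 \<and> p n = 2}" using assms(2) two_is_prime_nat by blast
      then show ?thesis unfolding infinite_nat_iff_unbounded by blast
    qed
  qed
  show ?thesis unfolding assms(3) using subgroup_level_closure openin_level_closure comeager_class_level_closure by blast
qed

end
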